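(* Let $P$ be a probability distribution on $\mathbb N$ with $P(1)<1$, let $n_o\sim P$, and assume $\mathbb E[e^{\theta n_o}]<\infty$ for some $\theta>0$. With $g_2,\upsilon,\beta_0,f_0,m_l,h_l,M_1$ as in the context: (1) $\beta_0\in\left(\max_x\,x\,\upsilon([x,\infty)),\ \mathbb E[n_o]-1\right)$, and $\beta_0$ is the largest eigenvalue of $M_1$ in magnitude. The corresponding eigenfunctions are $$\text{right: }\mu(m,x)=\frac mx f_0(x),\qquad \text{left: }\nu(k-1,z)=P(k)\frac{e^{-z}z^{k-1}}{(k-1)!}f_0(z).$$ These eigenfunctions are (up to a normalization factor) the unique non-negative right and left eigenfunctions of $M_1$, respectively. (2) There exist $0<\gamma<1$ and a constant $\widehat M>0$, independent of $x,m,z$ and $k$, such that for all $x\in\mathbb R_+$, $z>0$, $k\ge1$, $m\ge0$ and $l\ge2$, $$m_l(m,x;k-1,z)=\frac{P(k)e^{-z}z^{k-1}}{(k-1)!}\,\frac mx\,\beta_0^{\,l}f_0(x)f_0(z)\left(1+\widehat M\,O(\gamma^{l-2})\frac{x}{\beta_0^2f_0(z)f_0(x)}\right).$$ (3) $m_l(m,x;k-1,z)=h_l(x,z)\,\dfrac{P(k)e^{-z}z^{k-1}}{(k-1)!}\,\dfrac mx$. (4) Put $\eta=(1-e^{-\theta})/2$ and $V(x)=f_0'(0)\,e^{\eta x}\,\frac{x}{f_0(x)}$. For all (measurable) functions $g:\mathbb R_+\to\mathbb R$ satisfying $|g(x)|\le V(x)$ for all $x\in\mathbb R_+$, $$\left|\int_0^\infty\frac{h_l(x,y)g_2(y)f_0(y)g(y)}{\beta_0^{\,l}f_0(x)}\,dy-\int_0^\infty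 g_2(y)(f_0(y))^2g(y)\,dy\right|\le M\gamma^lV(x),\qquad l\ge2,$$ where the constants $M$ and $0<\gamma<1$ are independent of $x$ and $l$.
   Context: $\mathbb N=\{1,2,\dots\}$, $\mathbb Z_+=\{0,1,\dots\}$, $\mathbb R_+=[0,\infty)$. Expressions such as $f_0(x)/x$, $x/f_0(x)$, $h_l(x,\cdot)/x$ and $h_l(x,\cdot)/f_0(x)$ at $x=0$ are interpreted as limits as $x\downarrow0$. **Functions.** $g_2(x)=e^{-x}\sum_{k=2}^\infty P(k)\frac{x^{k-2}}{(k-2)!}$, and $\upsilon$ is the measure on $\mathbb R_+$ with Lebesgue density $g_2$. Let $G_0\equiv1$, $G_i(x)=\int_{y=x}^\infty\int_{z=y}^\infty g_2(z)G_{i-1}(z)\,dz\,dy$ for $i\ge1$, and $L(\beta,x)=\sum_{i\ge0}G_i(x)(-1/\beta)^i$. $\beta_0$ is the largest $\beta>0$ with $L(\beta,0)=0$, and $f_0(x)=L(\beta_0,x)\big/\big(\int_0^\infty g_2(y)L(\beta_0,y)^2dy\big)^{1/2}$, so $\int_0^\infty g_2(y)f_0(y)^2\,dy=1$. **The growth operator.** For the Erlang Weighted Tree with potential degree distribution $P$, vertices have types in $\mathbb Z_+\times\mathbb R_+$. A vertex of type $(m,x)$ has $m$ potential children; each independently has $K\sim P$, $Z$ which given $K$ has the Erlang density $e^{-z}z^{K-1}/(K-1)!$, and an independent uniform $U$ on $[0,1]$; it is an actual child iff $xU<Z$, and then has type $(K-1,Z)$. (The root has type $(n_o,v_o)$ with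 $n_o\sim P$ and $v_o$ given $n_o$ of density $e^{-x}x^{n_o}/n_o!$.) For Borel $A\subset\mathbb R_+$, $M_l(m,x;k-1,A)=\int_A m_l(m,x;k-1,z)\,dz$ is the expected number of generation-$l$ vertices with type in $\{k-1\}\times A$ given that the root has type $(m,x)$. Here $$m_1(m,x;k-1,z)=\frac mx\min(x,z)P(k)\frac{e^{-z}z^{k-1}}{(k-1)!},$$ and for $l\ge2$ $$m_l(m,x;k-1,z)=\int_0^\infty\sum_{k'=1}^\infty m_{l-1}(m,x;k'-1,z')\,m_1(k'-1,z';k-1,z)\,dz'.$$ Also $h_1(x,z)=\min(x,z)$ and $h_l(x,z)=\int_0^\infty h_{l-1}(x,z')g_2(z')h_1(z',z)\,dz'$ for $l\ge2$. **Eigenfunctions of $M_1$.** If there exist a non-zero function $\mu$ on $\mathbb Z_+\times\mathbb R_+$ and $\beta\in\mathbb R$ such that $\beta\mu(m,x)=\int_0^\infty\sum_{k=1}^\infty m_1(m,x;k-1,z)\mu(k-1,z)\,dz$, then $\mu$ is called a right eigenfunction of $M_1$ corresponding to the eigenvalue $\beta$. Similarly, a left eigenfunction corresponding to the eigenvalue $\beta$ is a non-zero function $\nu$ with $\beta\nu(k-1,z)=\int_0^\infty\sum_{m=0}^\infty\nu(m,x)m_1(m,x;k-1,z)\,dx$.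
   Formalization: Uniqueness of the non-negative right and left eigenfunctions is stated only for non-zero eigenvalues; for eigenvalue 0 it fails, e.g. ν(0,z)=e^{-z}, ν(m,·)=0 for m≥1 is a non-negative left eigenfunction since m_1(0,x;·,·)=0. *)

theory Defs
  imports "HOL-Probability.Probability"
begin

text \<open>
  The quotient \<open>f x / g x\<close> on the half-line \<open>{0..}\<close>, where the value at \<open>x = 0\<close> is the limit
  as \<open>x\<close> decreases to 0.
\<close>
definition quot0 :: "(real \<Rightarrow> real) \<Rightarrow> (real \<Rightarrow> real) \<Rightarrow> real \<Rightarrow> real" where
  "quot0 f g x = (if x = 0 then Lim (at_right 0) (\<lambda>t. f t / g t) else f x / g x)"

definition g2 :: "nat pmf \<Rightarrow> real \<Rightarrow> real" where
  "g2 P x = exp (- x) * (\<Sum>j. pmf P (j + 2) * x ^ j / fact j)"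

definition upsilon :: "nat pmf \<Rightarrow> real measure" where
  "upsilon P = density lborel (\<lambda>x. ennreal (indicator {0..} x * g2 P x))"

primrec G :: "nat pmf \<Rightarrow> nat \<Rightarrow> real \<Rightarrow> real" where
  "G P 0 x = 1"
| "G P (Suc i) x = (LBINT y:{x..}. (LBINT z:{y..}. g2 P z * G P i z))"

definition L :: "nat pmf \<Rightarrow> real \<Rightarrow> real \<Rightarrow> real" where
  "L P \<beta> x = (\<Sum>i. G P i x * (- 1 / \<beta>) ^ i)"

definition beta0 :: "nat pmf \<Rightarrow> real" where
  "beta0 P = (GREATEST \<beta>. \<beta> > 0 \<and> L P \<beta> 0 = 0)"

definition f0 :: "nat pmf \<Rightarrow> real \<Rightarrow> real" where
  "f0 P x = L P (beta0 P) x / sqrt (LBINT y:{0..}. g2 P y * (L P (beta0 P) y)\<^sup>2)"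

text \<open>
  \<open>m1 P m x j z\<close> is the kernel from type \<open>(m, x)\<close> to type \<open>(j, z)\<close>, where \<open>j\<close> plays the role of
  \<open>k - 1\<close>; accordingly, sums over \<open>k \<ge> 1\<close> become sums over all natural numbers \<open>j\<close>.  The factor
  \<open>min x z / x\<close> is a limit at \<open>x = 0\<close>.
\<close>
definition m1 :: "nat pmf \<Rightarrow> nat \<Rightarrow> real \<Rightarrow> nat \<Rightarrow> real \<Rightarrow> real" where
  "m1 P m x j z =
     real m * quot0 (\<lambda>t. min t z) (\<lambda>t. t) x * (pmf P (j + 1) * exp (- z) * z ^ j / fact j)"

text \<open>In the next two functions the generation index starts at 1; the value at index 0 is irrelevant.\<close>

fun ml :: "nat pmf \<Rightarrow> nat \<Rightarrow> nat \<Rightarrow> real \<Rightarrow> nat \<Rightarrow> real \<Rightarrow> real" where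
  "ml P 0 m x j z = 0"
| "ml P (Suc 0) m x j z = m1 P m x j z"
| "ml P (Suc (Suc l)) m x j z =
     (LBINT z':{0..}. (\<Sum>j'. ml P (Suc l) m x j' z' * m1 P j' z' j z))"

fun hl :: "nat pmf \<Rightarrow> nat \<Rightarrow> real \<Rightarrow> real \<Rightarrow> real" where
  "hl P 0 x z = 0"
| "hl P (Suc 0) x z = min x z"
| "hl P (Suc (Suc l)) x z = (LBINT z':{0..}. hl P (Suc l) x z' * g2 P z' * min z' z)"

text \<open>
  Eigenfunctions of \<open>M\<^sub>1\<close> are functions on \<open>\<nat> \<times> {0..}\<close>; values at negative second arguments play
  no role.  Convergence of the series (for almost every \<open>z\<close>) and integrability of its sum are
  part of the eigenvalue equation: in HOL a divergent integral has the value 0.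
\<close>
definition right_eigenfunction :: "nat pmf \<Rightarrow> real \<Rightarrow> (nat \<Rightarrow> real \<Rightarrow> real) \<Rightarrow> bool" where
  "right_eigenfunction P \<beta> \<mu> \<longleftrightarrow>
     (\<exists>m. \<exists>x\<ge>0. \<mu> m x \<noteq> 0) \<and>
     (\<forall>m. \<forall>x\<ge>0.
        (AE z in lborel. 0 \<le> z \<longrightarrow> summable (\<lambda>j. m1 P m x j z * \<mu> j z)) \<and>
        set_integrable lborel {0..} (\<lambda>z. \<Sum>j. m1 P m x j z * \<mu> j z) \<and>
        \<beta> * \<mu> m x = (LBINT z:{0..}. (\<Sum>j. m1 P m x j z * \<mu> j z)))"

definition left_eigenfunction :: "nat pmf \<Rightarrow> real \<Rightarrow> (nat \<Rightarrow> real \<Rightarrow> real) \<Rightarrow> bool" where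
  "left_eigenfunction P \<beta> \<nu> \<longleftrightarrow>
     (\<exists>j. \<exists>z\<ge>0. \<nu> j z \<noteq> 0) \<and>
     (\<forall>j. \<forall>z\<ge>0.
        (AE x in lborel. 0 \<le> x \<longrightarrow> summable (\<lambda>m. \<nu> m x * m1 P m x j z)) \<and>
        set_integrable lborel {0..} (\<lambda>x. \<Sum>m. \<nu> m x * m1 P m x j z) \<and>
        \<beta> * \<nu> j z = (LBINT x:{0..}. (\<Sum>m. \<nu> m x * m1 P m x j z)))"

definition is_eigenvalue :: "nat pmf \<Rightarrow> real \<Rightarrow> bool" where
  "is_eigenvalue P \<beta> \<longleftrightarrow> (\<exists>\<mu>. right_eigenfunction P \<beta> \<mu>) \<or> (\<exists>\<nu>. left_eigenfunction P \<beta> \<nu>)"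

definition mu0 :: "nat pmf \<Rightarrow> nat \<Rightarrow> real \<Rightarrow> real" where
  "mu0 P m x = real m * quot0 (f0 P) (\<lambda>t. t) x"

definition nu0 :: "nat pmf \<Rightarrow> nat \<Rightarrow> real \<Rightarrow> real" where
  "nu0 P j z = pmf P (j + 1) * exp (- z) * z ^ j / fact j * f0 P z"

definition proportional :: "(nat \<Rightarrow> real \<Rightarrow> real) \<Rightarrow> (nat \<Rightarrow> real \<Rightarrow> real) \<Rightarrow> bool" where
  "proportional \<phi> \<psi> \<longleftrightarrow> (\<exists>c. c \<noteq> 0 \<and> (\<forall>m. \<forall>x\<ge>0. \<phi> m x = c * \<psi> m x))"

definition nonneg_fun :: "(nat \<Rightarrow> real \<Rightarrow> real) \<Rightarrow> bool" where
  "nonneg_fun \<phi> \<longleftrightarrow> (\<forall>m. \<forall>x\<ge>0. 0 \<le> \<phi> m x)"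

text \<open>The derivative of \<open>f0\<close> at 0 is one-sided, since \<open>f0\<close> is a function on \<open>{0..}\<close>.\<close>
definition V :: "nat pmf \<Rightarrow> real \<Rightarrow> real \<Rightarrow> real" where
  "V P \<theta> x = (let \<eta> = (1 - exp (- \<theta>)) / 2
     in vector_derivative (f0 P) (at 0 within {0..}) * exp (\<eta> * x) * quot0 (\<lambda>t. t) (f0 P) x)"

end

theory Submission
  imports Defs
begin

text \<open>
  Everything reduces to the symmetric operator \<open>T \<phi> x = \<integral> min x z \<phi> z \<upsilon>(dz)\<close>, because \<open>M\<^sub>1\<close>
  depends on the discrete type only through fixed factors.  The series \<open>L \<beta>\<close> solves
  \<open>L \<beta> x = 1 - \<integral> (z - x)\<^sup>+ L \<beta> z \<upsilon>(dz) / \<beta>\<close>, and at the supremum of all \<open>\<beta>\<close> for which \<open>L \<beta>\<close> is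
  somewhere nonpositive it is nonnegative, hence nondecreasing, hence zero at \<open>0\<close>; this supremum is
  \<open>\<beta>\<^sub>0\<close>, and \<open>f\<^sub>0\<close> is a positive eigenfunction of \<open>T\<close>.

  An eigenfunction \<open>\<phi>\<close> of \<open>T\<close> for \<open>\<bar>b\<bar> \<ge> \<beta>\<^sub>0\<close> satisfies \<open>\<bar>b\<bar> \<bar>\<phi>\<bar> \<le> T \<bar>\<phi>\<bar>\<close>; pairing with \<open>f\<^sub>0\<close>
  forces equality, so \<open>\<phi>\<close> has constant sign and \<open>b = \<beta>\<^sub>0\<close>.  Applied to a combination
  \<open>\<phi> - c f\<^sub>0\<close> that vanishes at 1, this gives simplicity.

  The Markov kernel \<open>min x y f\<^sub>0 y / (\<beta>\<^sub>0 f\<^sub>0 x) \<upsilon>(dy)\<close> satisfies a Doeblin condition uniformly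
  in \<open>x\<close>, since \<open>min x y \<ge> min x 1 * min y 1\<close> while \<open>f\<^sub>0 x\<close> is at most a multiple of \<open>min x 1\<close>.  Hence
  \<open>h\<^sub>l x z / (\<beta>\<^sub>0\<^sup>l f\<^sub>0 x f\<^sub>0 z)\<close> converges to 1 geometrically and uniformly in \<open>x\<close> and \<open>z\<close>, which
  yields both the expansion of \<open>m\<^sub>l\<close> and the weighted estimate for \<open>g\<close>.
\<close>

section \<open>The operator with kernel min\<close>

text \<open>Symmetry and positivity of the kernel take the place of spectral theory: no compactness
  of the operator and no orthogonal expansion is used. An eigenfunction of \<open>M\<^sub>1\<close>
  is an arbitrary function, so neither measurability nor square integrability may be assumed. For a
  nonzero eigenvalue the equation itself puts the reduced function into the class
  \<open>lin_growth\<close>, and the finite second moment of \<upsilon> makes all pairings finite.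
  The Doeblin argument needs a bounded starting density, which \<open>min x z\<close> does not
  provide: on the diagonal near the origin it is of order \<open>x\<close>, while
  \<open>f\<^sub>0 x * f\<^sub>0 z\<close> is of order \<open>x\<^sup>2\<close>. One more
  integration supplies the missing factor, whence the restriction to \<open>l \<ge> 2\<close>. As
  \<open>f\<^sub>0\<close> vanishes at 0, kernels are divided by \<open>x\<close> beforehand, and
  values at \<open>x = 0\<close> are limits by dominated convergence. The supremum is taken over
  nonpositivity anywhere, not over zeros at 0, because positivity is what survives the limit in
  \<beta>. This requires continuity in \<beta> uniformly on an unbounded half-line, which the fast
  decay of the coefficients provides.\<close>

locale min_kernel = finite_measure U for U :: "real measure" +
  assumes sets_eq_borel [measurable_cong]: "sets U = sets borel"
    and AE_pos: "AE z in U. 0 < z"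
    and integrable_sq: "integrable U (\<lambda>z. z\<^sup>2)"
begin

definition T :: "(real \<Rightarrow> real) \<Rightarrow> real \<Rightarrow> real" where
  "T \<phi> x = (\<integral>z. min x z * \<phi> z \<partial>U)"

text \<open>A class stable under \<open>T\<close> that contains the kernels \<open>min x\<close> and
  \<open>max (z - x) 0\<close>; products of two members are integrable because second moments are
  finite. The bound is asked for \<open>x > 0\<close> only, since \<open>U\<close> gives no mass to
  the rest.\<close>

definition lin_growth :: "(real \<Rightarrow> real) \<Rightarrow> bool" where
  "lin_growth \<phi> \<longleftrightarrow> \<phi> \<in> borel_measurable borel \<and> (\<exists>C\<ge>0. \<forall>x>0. \<bar>\<phi> x\<bar> \<le> C * (1 + x))"

lemma lin_growth_measurable [measurable_dest]: "lin_growth \<phi> \<Longrightarrow> \<phi> \<in> borel_measurable borel"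
  by (simp add: lin_growth_def)

lemma lin_growthI:
  assumes "\<phi> \<in> borel_measurable borel" "\<And>x. x > 0 \<Longrightarrow> \<bar>\<phi> x\<bar> \<le> C * (1 + x)"
  shows "lin_growth \<phi>"
proof -
  have "C * 2 \<ge> 0" using assms(2)[of 1] by simp
  then show ?thesis using assms unfolding lin_growth_def by (intro conjI exI[of _ C]) auto
qed

lemma lin_growthE:
  assumes "lin_growth \<phi>"
  obtains C where "C \<ge> 0" "\<And>x. x > 0 \<Longrightarrow> \<bar>\<phi> x\<bar> \<le> C * (1 + x)"
  using assms unfolding lin_growth_def by blast

lemma lin_growth_bounded:
  assumes "\<phi> \<in> borel_measurable borel" "\<And>x. x > 0 \<Longrightarrow> \<bar>\<phi> x\<bar> \<le> C"
  shows "lin_growth \<phi>"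
proof (rule lin_growthI[where C = C])
  fix x :: real assume x: "x > 0"
  have "C \<ge> 0" using assms(2)[OF x] by linarith
  then have "0 \<le> C * x" using x by simp
  then show "\<bar>\<phi> x\<bar> \<le> C * (1 + x)" using assms(2)[OF x] by (simp add: algebra_simps)
qed fact

lemma lin_growth_min: "lin_growth (min x)"
proof (rule lin_growthI[where C = "1 + \<bar>x\<bar>"])
  fix z :: real assume "z > 0"
  moreover have "0 \<le> \<bar>x\<bar> * z" using \<open>z > 0\<close> by simp
  ultimately show "\<bar>min x z\<bar> \<le> (1 + \<bar>x\<bar>) * (1 + z)"
    by (auto simp: algebra_simps min_def)
qed measurable

lemma lin_growth_abs: "lin_growth \<phi> \<Longrightarrow> lin_growth (\<lambda>x. \<bar>\<phi> x\<bar>)"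
  unfolding lin_growth_def by auto

lemma lin_growth_scale:
  assumes "lin_growth \<phi>" shows "lin_growth (\<lambda>x. c * \<phi> x)"
proof -
  obtain C where C: "C \<ge> 0" "\<And>x. x > 0 \<Longrightarrow> \<bar>\<phi> x\<bar> \<le> C * (1 + x)" using lin_growthE[OF assms] by blast
  show ?thesis
  proof (rule lin_growthI[where C = "\<bar>c\<bar> * C"])
    fix x :: real assume "x > 0"
    then show "\<bar>c * \<phi> x\<bar> \<le> \<bar>c\<bar> * C * (1 + x)"
      using mult_left_mono[OF C(2), of x "\<bar>c\<bar>"] by (simp add: abs_mult mult.assoc)
  qed (use assms in measurable)
qed

lemma lin_growth_add:
  assumes "lin_growth \<phi>" "lin_growth \<psi>" shows "lin_growth (\<lambda>x. \<phi> x + \<psi> x)"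
proof -
  obtain C where C: "C \<ge> 0" "\<And>x. x > 0 \<Longrightarrow> \<bar>\<phi> x\<bar> \<le> C * (1 + x)" using lin_growthE[OF assms(1)] by blast
  obtain D where D: "D \<ge> 0" "\<And>x. x > 0 \<Longrightarrow> \<bar>\<psi> x\<bar> \<le> D * (1 + x)" using lin_growthE[OF assms(2)] by blast
  show ?thesis
  proof (rule lin_growthI[where C = "C + D"])
    fix x :: real assume "x > 0"
    then show "\<bar>\<phi> x + \<psi> x\<bar> \<le> (C + D) * (1 + x)"
      using C(2)[of x] D(2)[of x] by (simp add: distrib_right)
  qed (use assms in measurable)
qed

lemma lin_growth_diff:
  assumes "lin_growth \<phi>" "lin_growth \<psi>" shows "lin_growth (\<lambda>x. \<phi> x - \<psi> x)"
  using lin_growth_add[OF assms(1) lin_growth_scale[OF assms(2), of "-1"]] by simp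

lemma integrable_lin_growth_mult:
  assumes "lin_growth \<phi>" "lin_growth \<psi>" shows "integrable U (\<lambda>x. \<phi> x * \<psi> x)"
proof -
  obtain C where C: "C \<ge> 0" "\<And>x. x > 0 \<Longrightarrow> \<bar>\<phi> x\<bar> \<le> C * (1 + x)" using lin_growthE[OF assms(1)] by blast
  obtain D where D: "D \<ge> 0" "\<And>x. x > 0 \<Longrightarrow> \<bar>\<psi> x\<bar> \<le> D * (1 + x)" using lin_growthE[OF assms(2)] by blast
  have "integrable U (\<lambda>x. 2 * C * D * (1 + x\<^sup>2))" using integrable_sq by simp
  then show ?thesis
  proof (rule Bochner_Integration.integrable_bound)
    show "(\<lambda>x. \<phi> x * \<psi> x) \<in> borel_measurable U" using assms by measurable
    show "AE x in U. norm (\<phi> x * \<psi> x) \<le> norm (2 * C * D * (1 + x\<^sup>2))"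
      using AE_pos
    proof eventually_elim
      case (elim x)
      have "\<bar>\<phi> x * \<psi> x\<bar> \<le> (C * (1 + x)) * (D * (1 + x))"
        unfolding abs_mult using C D elim by (intro mult_mono) auto
      also have "\<dots> = C * D * ((1 + x) * (1 + x))" by simp
      also have "\<dots> \<le> C * D * (2 * (1 + x\<^sup>2))"
      proof (rule mult_left_mono)
        have "0 \<le> (1 - x)\<^sup>2" by simp
        then show "(1 + x) * (1 + x) \<le> 2 * (1 + x\<^sup>2)" by (simp add: power2_eq_square algebra_simps)
      qed (use C D in simp)
      finally show ?case using C D by (simp add: abs_mult algebra_simps)
    qed
  qed
qed

lemma integrable_lin_growth: "lin_growth \<phi> \<Longrightarrow> integrable U \<phi>"
  using integrable_lin_growth_mult[OF _ lin_growth_bounded[of "\<lambda>_. 1" 1]] by simp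

lemma lin_growth_id: "lin_growth (\<lambda>x. x)"
  by (rule lin_growthI[where C = 1]) auto

lemma integrable_min_mult: "lin_growth \<phi> \<Longrightarrow> integrable U (\<lambda>z. min x z * \<phi> z)"
  by (rule integrable_lin_growth_mult[OF lin_growth_min])

lemma T_measurable [measurable (raw)]:
  assumes [measurable]: "\<phi> \<in> borel_measurable borel" shows "T \<phi> \<in> borel_measurable borel"
  unfolding T_def by measurable

lemma T_nonneg: "x \<ge> 0 \<Longrightarrow> (\<And>z. z > 0 \<Longrightarrow> 0 \<le> \<phi> z) \<Longrightarrow> 0 \<le> T \<phi> x"
  unfolding T_def using AE_pos by (intro integral_nonneg_AE) (auto elim!: eventually_mono)

lemma T_abs_le:
  assumes "lin_growth \<phi>" "x \<ge> 0" shows "\<bar>T \<phi> x\<bar> \<le> x * (\<integral>z. \<bar>\<phi> z\<bar> \<partial>U)"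
proof -
  have "\<bar>T \<phi> x\<bar> \<le> (\<integral>z. \<bar>min x z * \<phi> z\<bar> \<partial>U)" unfolding T_def by (rule integral_abs_bound)
  also have "\<dots> \<le> (\<integral>z. x * \<bar>\<phi> z\<bar> \<partial>U)"
  proof (rule integral_mono_AE)
    show "integrable U (\<lambda>z. \<bar>min x z * \<phi> z\<bar>)" using integrable_min_mult[OF assms(1)] by simp
    show "integrable U (\<lambda>z. x * \<bar>\<phi> z\<bar>)" using integrable_lin_growth[OF assms(1)] by simp
    show "AE z in U. \<bar>min x z * \<phi> z\<bar> \<le> x * \<bar>\<phi> z\<bar>"
      using AE_pos by eventually_elim (use assms in \<open>auto simp: abs_mult intro!: mult_right_mono\<close>)
  qed
  finally show ?thesis by simp
qed

lemma lin_growth_T: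
  assumes "lin_growth \<phi>" shows "lin_growth (T \<phi>)"
proof (rule lin_growthI[where C = "\<integral>z. \<bar>\<phi> z\<bar> \<partial>U"])
  fix x :: real assume "x > 0"
  then show "\<bar>T \<phi> x\<bar> \<le> (\<integral>z. \<bar>\<phi> z\<bar> \<partial>U) * (1 + x)"
    using T_abs_le[OF assms, of x] by (simp add: algebra_simps add_increasing)
qed (use assms in measurable)

lemma T_scale: "T (\<lambda>z. c * \<phi> z) x = c * T \<phi> x"
  unfolding T_def by (subst integral_mult_right_zero[symmetric]) (simp add: algebra_simps)

lemma T_diff: "lin_growth \<phi> \<Longrightarrow> lin_growth \<psi> \<Longrightarrow> T (\<lambda>z. \<phi> z - \<psi> z) x = T \<phi> x - T \<psi> x"
  unfolding T_def by (simp add: right_diff_distrib integrable_min_mult)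

lemma T_0: "T \<phi> 0 = 0"
proof -
  have "AE z in U. min 0 z * \<phi> z = 0" using AE_pos by eventually_elim auto
  then show ?thesis unfolding T_def by (rule integral_eq_zero_AE)
qed

text \<open>Fubini applies because \<open>min y z \<le> y\<close> dominates the integrand by a
  product of two integrable functions of one variable each.\<close>

lemma T_symmetric:
  assumes [measurable_dest]: "lin_growth \<phi>" "lin_growth \<psi>"
  shows "(\<integral>z. T \<phi> z * \<psi> z \<partial>U) = (\<integral>z. \<phi> z * T \<psi> z \<partial>U)"
proof -
  interpret UU: pair_sigma_finite U U ..
  let ?a = "\<lambda>y. \<bar>\<phi> y\<bar> * y" and ?b = "\<lambda>z. \<bar>\<psi> z\<bar>"
  let ?k = "\<lambda>(y, z). \<phi> y * min y z * \<psi> z"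
  have [measurable]: "\<phi> \<in> borel_measurable borel" "\<psi> \<in> borel_measurable borel"
    using assms by (auto dest: lin_growth_measurable)
  have a: "integrable U ?a"
    by (rule integrable_lin_growth_mult[OF lin_growth_abs[OF assms(1)] lin_growth_id])
  have b: "integrable U ?b" using integrable_lin_growth[OF assms(2)] by simp
  have "integrable (U \<Otimes>\<^sub>M U) (\<lambda>(y, z). ?a y * ?b z)"
  proof (rule UU.Fubini_integrable)
    show "integrable U (\<lambda>x. \<integral>y. norm (case (x, y) of (y, z) \<Rightarrow> ?a y * ?b z) \<partial>U)"
      using integrable_norm[OF a] by (simp add: abs_mult)
    show "AE x in U. integrable U (\<lambda>y. case (x, y) of (y, z) \<Rightarrow> ?a y * ?b z)"
      using b by simp
  qed measurable
  then have k: "integrable (U \<Otimes>\<^sub>M U) ?k"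
  proof (rule Bochner_Integration.integrable_bound)
    have "AE p in U \<Otimes>\<^sub>M U. 0 < fst p \<and> 0 < snd p"
    proof (rule UU.AE_pair_measure)
      show "AE y in U. AE z in U. 0 < fst (y, z) \<and> 0 < snd (y, z)"
        using AE_pos by eventually_elim (use AE_pos in simp)
    qed measurable
    then show "AE p in U \<Otimes>\<^sub>M U. norm (?k p) \<le> norm (case p of (y, z) \<Rightarrow> ?a y * ?b z)"
    proof eventually_elim
      case (elim p)
      obtain y z where p: "p = (y, z)" by (cases p)
      then show ?case using elim by (auto simp: abs_mult intro!: mult_right_mono mult_left_mono)
    qed
  qed measurable
  have "(\<integral>z. T \<phi> z * \<psi> z \<partial>U) = (\<integral>z. (\<integral>y. ?k (y, z) \<partial>U) \<partial>U)"
    unfolding T_def by (simp add: min.commute mult.commute)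
  also have "\<dots> = (\<integral>y. (\<integral>z. ?k (y, z) \<partial>U) \<partial>U)"
    using UU.Fubini_integral[OF k[folded case_prod_eta]] by simp
  also have "\<dots> = (\<integral>z. \<phi> z * T \<psi> z \<partial>U)"
    unfolding T_def by (simp add: mult.assoc)
  finally show ?thesis .
qed

end

section \<open>Iterates of the kernel and their limits at the origin\<close>

lemma min_le_min_1_mult:
  fixes x y :: real assumes "0 \<le> x" "0 \<le> y" shows "min x y \<le> min x 1 * (1 + y)"
proof (cases "x \<le> 1")
  case True
  have "0 \<le> x * y" using assms by simp
  then have "x \<le> x * (1 + y)" by (simp add: distrib_left)
  moreover have "min x 1 = x" using True by simp
  ultimately show ?thesis by (metis min.cobounded1 order_trans)
qed auto

lemma integral_dominated_convergence_at_right_0: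
  fixes s :: "real \<Rightarrow> 'a \<Rightarrow> real"
  assumes "f \<in> borel_measurable M" "\<And>t. t > 0 \<Longrightarrow> s t \<in> borel_measurable M" "integrable M w"
    and "AE x in M. ((\<lambda>t. s t x) \<longlongrightarrow> f x) (at_right 0)"
    and "\<And>t. 0 < t \<Longrightarrow> AE x in M. \<bar>s t x\<bar> \<le> w x"
  shows "((\<lambda>t. \<integral>x. s t x \<partial>M) \<longlongrightarrow> (\<integral>x. f x \<partial>M)) (at_right 0)"
proof (rule tendsto_at_right_sequentially[where b = 1])
  fix S :: "nat \<Rightarrow> real"
  assume S: "\<And>n. 0 < S n" "S \<longlonglongrightarrow> 0"
  have "filterlim S (at_right 0) sequentially"
    using S by (intro tendsto_imp_filterlim_at_right) auto
  then show "(\<lambda>n. \<integral>x. s (S n) x \<partial>M) \<longlonglongrightarrow> (\<integral>x. f x \<partial>M)"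
    using assms S
    by (intro integral_dominated_convergence[where w = w])
       (auto elim!: eventually_mono intro: filterlim_compose)
qed simp

context min_kernel
begin

text \<open>\<open>kern l x z\<close> is \<open>h\<^sub>l\<^sub>+\<^sub>1 x z / x\<close>, with the limit value at \<open>x = 0\<close>.\<close>
primrec kern :: "nat \<Rightarrow> real \<Rightarrow> real \<Rightarrow> real" where
  "kern 0 x z = (if x = 0 then indicator {0<..} z else min x z / x)"
| "kern (Suc l) x z = T (kern l x) z"

lemma kern_0_range: "x \<ge> 0 \<Longrightarrow> z \<ge> 0 \<Longrightarrow> 0 \<le> kern 0 x z \<and> kern 0 x z \<le> 1"
  by (auto simp: indicator_def field_simps)

lemma lin_growth_kern: "x \<ge> 0 \<Longrightarrow> lin_growth (kern l x)"
proof (induction l)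
  case 0
  have "kern 0 x = (if x = 0 then indicator {0<..} else (\<lambda>z. min x z / x))" by auto
  also have "\<dots> \<in> borel_measurable borel" by simp
  finally show ?case
    using kern_0_range[OF 0] by (intro lin_growth_bounded[where C = 1]) (auto simp del: kern.simps)
next
  case (Suc l)
  then show ?case by (simp add: lin_growth_T)
qed

lemma kern_nonneg: "x \<ge> 0 \<Longrightarrow> z \<ge> 0 \<Longrightarrow> 0 \<le> kern l x z"
proof (induction l arbitrary: z)
  case 0
  then show ?case by (simp only: kern_0_range)
next
  case (Suc l)
  show ?case unfolding kern.simps by (rule T_nonneg[OF Suc.prems(2)]) (use Suc in simp)
qed

text \<open>A bound that is uniform in \<open>x\<close> as well serves as majorant when
  \<open>x\<close> tends to 0. Each step multiplies it by at most the first moment of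
  \<open>U\<close>, because \<open>min z y \<le> y\<close>.\<close>

lemma kern_bounded: "\<exists>C. \<forall>x\<ge>0. \<forall>z\<ge>0. kern l x z \<le> C"
proof (induction l)
  case 0
  show ?case by (intro exI[of _ 1] allI impI) (simp only: kern_0_range)
next
  case (Suc l)
  then obtain C where C: "\<And>x z. x \<ge> 0 \<Longrightarrow> z \<ge> 0 \<Longrightarrow> kern l x z \<le> C" by blast
  have le: "kern (Suc l) x z \<le> (\<integral>y. y * C \<partial>U)" if "x \<ge> 0" "z \<ge> 0" for x z
    unfolding kern.simps T_def
  proof (rule integral_mono_AE)
    show "integrable U (\<lambda>y. min z y * kern l x y)"
      by (rule integrable_min_mult[OF lin_growth_kern[OF that(1)]])
    show "integrable U (\<lambda>y. y * C)" using integrable_lin_growth[OF lin_growth_id] by simp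
    show "AE y in U. min z y * kern l x y \<le> y * C"
      using AE_pos
    proof eventually_elim
      case (elim y)
      then show ?case
        using that by (intro mult_mono C kern_nonneg) auto
    qed
  qed
  show ?case by (intro exI allI impI) (rule le)
qed

text \<open>For \<open>z > 0\<close> the base kernel equals its limit as soon as
  \<open>t < z\<close>, and for \<open>z = 0\<close> it is identically zero; dominated convergence
  carries this through the iterates.\<close>

lemma kern_tendsto_0: "z \<ge> 0 \<Longrightarrow> ((\<lambda>t. kern l t z) \<longlongrightarrow> kern l 0 z) (at_right 0)"
proof (induction l arbitrary: z)
  case 0
  show ?case
  proof (cases "z = 0")
    case True
    have "eventually (\<lambda>t. kern 0 t z = kern 0 0 z) (at_right 0)"
      using eventually_at_right_less[of 0] by eventually_elim (use True in auto)
    then show ?thesis by (rule tendsto_eventually)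
  next
    case False
    then have "eventually (\<lambda>t. t < z) (at_right 0)"
      using 0 by (intro eventually_at_right_real[THEN eventually_mono, of 0 z]) auto
    with eventually_at_right_less[of 0] have "eventually (\<lambda>t. kern 0 t z = kern 0 0 z) (at_right 0)"
      by eventually_elim (use False 0 in auto)
    then show ?thesis by (rule tendsto_eventually)
  qed
next
  case (Suc l)
  obtain C where C: "\<And>x z. x \<ge> 0 \<Longrightarrow> z \<ge> 0 \<Longrightarrow> kern l x z \<le> C" using kern_bounded by blast
  show ?case unfolding kern.simps T_def
  proof (rule integral_dominated_convergence_at_right_0[where w = "\<lambda>y. y * C"])
    show "(\<lambda>y. min z y * kern l 0 y) \<in> borel_measurable U"
      by (intro borel_measurable_integrable integrable_min_mult lin_growth_kern) simp
    show "(\<lambda>y. min z y * kern l t y) \<in> borel_measurable U" if "t > 0" for t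
      using that by (intro borel_measurable_integrable integrable_min_mult lin_growth_kern) simp
    show "integrable U (\<lambda>y. y * C)" using integrable_lin_growth[OF lin_growth_id] by simp
    show "AE y in U. ((\<lambda>t. min z y * kern l t y) \<longlongrightarrow> min z y * kern l 0 y) (at_right 0)"
      using AE_pos by eventually_elim (auto intro!: tendsto_intros Suc.IH)
    show "AE y in U. \<bar>min z y * kern l t y\<bar> \<le> y * C" if "t > 0" for t
      using AE_pos
    proof eventually_elim
      case (elim y)
      then have "min z y * kern l t y \<le> y * C"
        using that by (intro mult_mono C kern_nonneg) auto
      then show ?case
        using elim that Suc.prems kern_nonneg[of t y l] by (simp add: abs_mult)
    qed
  qed
qed

declare kern.simps [simp del]

end

section \<open>Positive eigenfunctions\<close>

text \<open>Convergence and uniqueness follow from one strictly positive bounded eigenfunction,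
  however it is obtained. The normalization \<open>f_norm\<close> makes \<open>f\<close> itself the
  limit of the rescaled kernels.\<close>

locale min_kernel_eigen = min_kernel +
  fixes \<beta> :: real and f :: "real \<Rightarrow> real" and B :: real
  assumes \<beta>_pos: "0 < \<beta>"
    and f_measurable [measurable]: "f \<in> borel_measurable borel"
    and f_pos: "x > 0 \<Longrightarrow> 0 < f x"
    and f_le: "x > 0 \<Longrightarrow> f x \<le> B"
    and eigen: "x \<ge> 0 \<Longrightarrow> T f x = \<beta> * f x"
    and f_norm: "(\<integral>x. f x * f x \<partial>U) = 1"
begin

lemma f_0: "f 0 = 0"
  using eigen[of 0] T_0[of f] \<beta>_pos by simp

lemma f_nonneg: "x \<ge> 0 \<Longrightarrow> 0 \<le> f x"
  using f_pos[of x] f_0 by (cases "x = 0") auto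

lemma lin_growth_f: "lin_growth f"
  by (rule lin_growth_bounded[where C = B]) (use f_le f_nonneg in \<open>auto simp: abs_le_iff intro: order_trans[rotated]\<close>)

text \<open>The derivative of \<open>f\<close> at 0: dividing \<open>\<beta> * f x = T f x\<close>
  by \<open>x\<close> and letting \<open>x\<close> tend to 0 replaces the kernel
  \<open>min x z / x\<close> by 1.\<close>

definition slope :: real where "slope = (\<integral>x. f x \<partial>U) / \<beta>"

lemma f_le_slope: assumes "x \<ge> 0" shows "f x \<le> slope * x"
proof -
  have "(\<integral>z. \<bar>f z\<bar> \<partial>U) = (\<integral>z. f z \<partial>U)"
    using AE_pos by (intro integral_cong_AE) (auto elim!: eventually_mono simp: f_nonneg)
  then show ?thesis
    using T_abs_le[OF lin_growth_f assms] eigen[OF assms] \<beta>_pos f_nonneg[OF assms]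
    by (simp add: slope_def field_simps)
qed

lemma slope_pos: "0 < slope"
  using f_le_slope[of 1] f_pos[of 1] by simp

text \<open>A product of two numbers in the unit interval lies below each of them, so
  \<open>min x 1 * min 1 z \<le> min x z\<close>. Integrating against \<open>f\<close> and using the
  eigenvalue equation at \<open>x\<close> and at 1 gives the bound.\<close>

lemma f_ge: assumes "x \<ge> 0" shows "f 1 * min x 1 \<le> f x"
proof -
  have "min x 1 * T f 1 = (\<integral>z. min x 1 * (min 1 z * f z) \<partial>U)"
    unfolding T_def by simp
  also have "\<dots> \<le> T f x" unfolding T_def
  proof (rule integral_mono_AE)
    show "integrable U (\<lambda>z. min x 1 * (min 1 z * f z))"
      using integrable_min_mult[OF lin_growth_f] by simp
    show "integrable U (\<lambda>z. min x z * f z)" by (rule integrable_min_mult[OF lin_growth_f])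
    show "AE z in U. min x 1 * (min 1 z * f z) \<le> min x z * f z"
      using AE_pos
    proof eventually_elim
      case (elim z)
      have "min x 1 * min 1 z \<le> min x z"
        using elim assms mult_left_le[of z x] by (auto simp: min_def mult_le_cancel_left1 mult_left_le)
      then show ?case using mult_right_mono[of _ _ "f z"] f_pos[OF elim] by (simp add: mult.assoc)
    qed
  qed
  finally show ?thesis using eigen[OF assms] eigen[of 1] \<beta>_pos by (simp add: mult_ac)
qed

text \<open>Up to 1 the linear bound \<open>slope * x\<close> is used and beyond 1 the global bound
  \<open>B\<close>, so that \<open>f x\<close> lies between \<open>f 1\<close> and \<open>D\<close>
  times \<open>min x 1\<close>.\<close>

definition D :: real where "D = max slope B"

lemma D_pos: "0 < D" using slope_pos by (simp add: D_def)

lemma f_le_D: assumes "x \<ge> 0" shows "f x \<le> D * min x 1"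
proof (cases "x \<le> 1")
  case True
  have "slope * x \<le> D * x" using assms by (simp add: D_def mult_right_mono)
  with True f_le_slope[OF assms] show ?thesis by simp
next
  case False
  then show ?thesis using f_le[of x] by (simp add: D_def)
qed

lemma f_mono: assumes "0 \<le> x" "x \<le> y" shows "f x \<le> f y"
proof -
  have "T f x \<le> T f y" unfolding T_def
  proof (rule integral_mono_AE)
    show "AE z in U. min x z * f z \<le> min y z * f z"
      using AE_pos
      by eventually_elim (use assms in \<open>auto intro!: mult_right_mono f_nonneg\<close>)
  qed (rule integrable_min_mult[OF lin_growth_f])+
  then show ?thesis using eigen[of x] eigen[of y] assms \<beta>_pos by simp
qed

text \<open>Continuous extension of \<open>f x / x\<close>, so that
  \<open>kern l x z / fquot x\<close> stands for \<open>h\<^sub>l\<^sub>+\<^sub>1 x z / f x\<close>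
  at the origin too.\<close>

definition fquot :: "real \<Rightarrow> real" where
  "fquot x = (if x = 0 then slope else f x / x)"

lemma fquot_pos: "x \<ge> 0 \<Longrightarrow> 0 < fquot x"
  using slope_pos f_pos[of x] by (auto simp: fquot_def)

lemma fquot_le: "x \<ge> 0 \<Longrightarrow> fquot x \<le> slope"
  using f_le_slope[of x] by (auto simp: fquot_def field_simps)

text \<open>Symmetry moves each application of \<open>T\<close> from the kernel to \<open>f\<close>,
  where it only multiplies by \<open>\<beta>\<close>. This identifies the constant by which the
  kernel, paired with \<open>f\<close>, becomes a probability density.\<close>

lemma kern_integral: "x \<ge> 0 \<Longrightarrow> (\<integral>z. kern l x z * f z \<partial>U) = \<beta> ^ Suc l * fquot x"
proof (induction l)
  case 0
  show ?case
  proof (cases "x = 0")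
    case True
    have "(\<integral>z. kern 0 x z * f z \<partial>U) = (\<integral>z. f z \<partial>U)"
      using AE_pos True lin_growth_kern[of x 0]
      by (intro integral_cong_AE) (auto elim!: eventually_mono simp: kern.simps)
    then show ?thesis using True \<beta>_pos by (simp add: fquot_def slope_def)
  next
    case False
    have "(\<integral>z. kern 0 x z * f z \<partial>U) = (\<integral>z. (min x z * f z) / x \<partial>U)"
      using False by (simp add: kern.simps)
    also have "\<dots> = T f x / x" unfolding T_def by simp
    finally show ?thesis using False eigen[OF 0] by (simp add: fquot_def)
  qed
next
  case (Suc l)
  have "(\<integral>z. kern (Suc l) x z * f z \<partial>U) = (\<integral>z. kern l x z * T f z \<partial>U)"
    unfolding kern.simps by (rule T_symmetric[OF lin_growth_kern[OF Suc.prems] lin_growth_f])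
  also have "\<dots> = (\<integral>z. \<beta> * (kern l x z * f z) \<partial>U)"
    using AE_pos lin_growth_kern[OF Suc.prems, of l, THEN lin_growth_measurable]
    by (intro integral_cong_AE) (auto elim!: eventually_mono simp: eigen)
  also have "\<dots> = \<beta> * (\<beta> ^ Suc l * fquot x)" using Suc by simp
  finally show ?case by simp
qed

lemma fquot_tendsto: "((\<lambda>t. f t / t) \<longlongrightarrow> slope) (at_right 0)"
proof -
  have "((\<lambda>t. \<integral>z. kern 0 t z * f z \<partial>U) \<longlongrightarrow> (\<integral>z. kern 0 0 z * f z \<partial>U)) (at_right 0)"
  proof (rule integral_dominated_convergence_at_right_0[where w = f])
    show "integrable U f" by (rule integrable_lin_growth[OF lin_growth_f])
    show "(\<lambda>z. kern 0 0 z * f z) \<in> borel_measurable U"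
      by (intro borel_measurable_integrable integrable_lin_growth_mult lin_growth_kern lin_growth_f) simp
    show "(\<lambda>z. kern 0 t z * f z) \<in> borel_measurable U" if "t > 0" for t
      using that
      by (intro borel_measurable_integrable integrable_lin_growth_mult lin_growth_kern lin_growth_f) simp
    show "AE z in U. ((\<lambda>t. kern 0 t z * f z) \<longlongrightarrow> kern 0 0 z * f z) (at_right 0)"
      using AE_pos by eventually_elim (intro tendsto_mult kern_tendsto_0 tendsto_const less_imp_le)
    show "AE z in U. \<bar>kern 0 t z * f z\<bar> \<le> f z" if "t > 0" for t
      using AE_pos
    proof eventually_elim
      case (elim z)
      have "0 \<le> kern 0 t z" "kern 0 t z \<le> 1" using kern_0_range[of t z] that elim by auto
      then have "0 \<le> kern 0 t z * f z" "kern 0 t z * f z \<le> 1 * f z"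
        using f_pos[OF elim] by (auto intro!: mult_right_mono)
      then show ?case by simp
    qed
  qed
  also have "(\<integral>z. kern 0 0 z * f z \<partial>U) = \<beta> * slope"
    using kern_integral[of 0 0] by (simp only: fquot_def) simp
  finally have "((\<lambda>t. \<beta> * (f t / t)) \<longlongrightarrow> \<beta> * slope) (at_right 0)"
  proof (rule Lim_transform_eventually)
    show "eventually (\<lambda>t. (\<integral>z. kern 0 t z * f z \<partial>U) = \<beta> * (f t / t)) (at_right 0)"
      using eventually_at_right_less[of "0::real"]
    proof eventually_elim
      case (elim t)
      then show ?case using kern_integral[of t 0] by (simp only: fquot_def) simp
    qed
  qed
  then have "((\<lambda>t. \<beta> * (f t / t) / \<beta>) \<longlongrightarrow> \<beta> * slope / \<beta>) (at_right 0)"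
    using \<beta>_pos by (intro tendsto_divide) auto
  then show ?thesis using \<beta>_pos by simp
qed

section \<open>Pairing with the eigenfunction and geometric contraction\<close>

lemma AE_of_integral_f_nonpos:
  assumes "lin_growth \<phi>" "\<And>z. z > 0 \<Longrightarrow> 0 \<le> \<phi> z" "\<And>z. z > 0 \<Longrightarrow> \<phi> z \<le> 0 \<Longrightarrow> P z"
    and "(\<integral>z. \<phi> z * f z \<partial>U) \<le> 0"
  shows "AE z in U. P z"
proof -
  have nn: "AE z in U. 0 \<le> \<phi> z * f z"
    using AE_pos by eventually_elim (use assms(2) f_nonneg in simp)
  then have "0 \<le> (\<integral>z. \<phi> z * f z \<partial>U)" by (rule integral_nonneg_AE)
  with assms(4) have "(\<integral>z. \<phi> z * f z \<partial>U) = 0" by simp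
  then have "AE z in U. \<phi> z * f z = 0"
    using integral_nonneg_eq_0_iff_AE[OF integrable_lin_growth_mult[OF assms(1) lin_growth_f] nn] by simp
  then show ?thesis using AE_pos
  proof eventually_elim
    case (elim z)
    then show ?case using f_pos[of z] by (intro assms(3)) auto
  qed
qed

text \<open>As \<open>f\<close> has norm one, pairing a sandwich
  \<open>a * f \<le> w \<le> b * f\<close> with \<open>f\<close> shows that \<open>a\<close> and
  \<open>b\<close> lie on either side of 1. The limit need not be tracked: the gap
  \<open>b - a\<close> already controls the distance of \<open>w\<close> from
  \<open>f\<close>.\<close>

lemma normalized_bounds:
  assumes "lin_growth w" "(\<integral>z. w z * f z \<partial>U) = 1"
  shows "(\<And>z. z > 0 \<Longrightarrow> a * f z \<le> w z) \<Longrightarrow> a \<le> 1"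
    and "(\<And>z. z > 0 \<Longrightarrow> w z \<le> b * f z) \<Longrightarrow> 1 \<le> b"
proof -
  have ff: "(\<integral>z. (c * f z) * f z \<partial>U) = c" for c using f_norm by (simp add: mult.assoc)
  note int = integrable_lin_growth_mult[OF lin_growth_scale[OF lin_growth_f] lin_growth_f]
    integrable_lin_growth_mult[OF assms(1) lin_growth_f]
  { assume a: "\<And>z. z > 0 \<Longrightarrow> a * f z \<le> w z"
    have "(\<integral>z. (a * f z) * f z \<partial>U) \<le> (\<integral>z. w z * f z \<partial>U)"
    proof (rule integral_mono_AE[OF int])
      show "AE z in U. (a * f z) * f z \<le> w z * f z"
        using AE_pos by eventually_elim (use a f_nonneg in \<open>simp add: mult_right_mono\<close>)
    qed
    then show "a \<le> 1" using ff assms by simp }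
  { assume b: "\<And>z. z > 0 \<Longrightarrow> w z \<le> b * f z"
    have "(\<integral>z. w z * f z \<partial>U) \<le> (\<integral>z. (b * f z) * f z \<partial>U)"
    proof (rule integral_mono_AE[OF int(2) int(1)])
      show "AE z in U. w z * f z \<le> (b * f z) * f z"
        using AE_pos by eventually_elim (use b f_nonneg in \<open>simp add: mult_right_mono\<close>)
    qed
    then show "1 \<le> b" using ff assms by simp }
qed

text \<open>The kernel \<open>min x z\<close> dominates the rank-one kernel
  \<open>f x / D * min 1 z\<close>, because \<open>f x / D \<le> min x 1\<close>.\<close>

lemma T_ge_minorization:
  assumes "lin_growth \<phi>" "\<And>z. z > 0 \<Longrightarrow> 0 \<le> \<phi> z" "x \<ge> 0"
  shows "f x / D * T \<phi> 1 \<le> T \<phi> x"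
proof -
  have "f x / D * T \<phi> 1 = (\<integral>z. f x / D * (min 1 z * \<phi> z) \<partial>U)" unfolding T_def by simp
  also have "\<dots> \<le> T \<phi> x" unfolding T_def
  proof (rule integral_mono_AE)
    show "integrable U (\<lambda>z. f x / D * (min 1 z * \<phi> z))"
      using integrable_min_mult[OF assms(1)] by simp
    show "integrable U (\<lambda>z. min x z * \<phi> z)" by (rule integrable_min_mult[OF assms(1)])
    show "AE z in U. f x / D * (min 1 z * \<phi> z) \<le> min x z * \<phi> z"
      using AE_pos
    proof eventually_elim
      case (elim z)
      have "f x / D \<le> min x 1"
        by (subst pos_divide_le_eq[OF D_pos], subst mult.commute) (rule f_le_D[OF assms(3)])
      then have "f x / D * min 1 z \<le> min x 1 * min 1 z"
        using elim by (intro mult_right_mono) auto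
      also have "\<dots> \<le> min x z"
        using elim assms(3) by (auto simp: min_def mult_le_cancel_left1 mult_left_le)
      finally show ?case
        using mult_right_mono[OF _ assms(2)[OF elim]] by (simp only: mult.assoc[symmetric])
    qed
  qed
  finally show ?thesis .
qed

text \<open>In the Markov normalization the rank-one minorant has mass \<open>f 1 / D\<close>, since
  the integral of \<open>min 1 z * f z\<close> is \<open>\<beta> * f 1\<close>.\<close>

definition contr :: real where "contr = 1 - f 1 / D"

lemma contr_range: "0 \<le> contr" "contr < 1"
  using f_le_D[of 1] D_pos f_pos[of 1] by (auto simp: contr_def field_simps)

text \<open>The minorization is applied to the nonnegative functions \<open>w - a * f\<close> and
  \<open>b * f - w\<close>. The value \<open>T w 1\<close> enters both new bounds and cancels in
  their difference.\<close>

lemma T_contraction: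
  assumes w: "lin_growth w" and ab: "\<And>z. z > 0 \<Longrightarrow> a * f z \<le> w z" "\<And>z. z > 0 \<Longrightarrow> w z \<le> b * f z"
  shows "\<exists>a' b'. b' - a' = contr * (b - a) \<and>
    (\<forall>z\<ge>0. a' * f z \<le> T w z / \<beta> \<and> T w z / \<beta> \<le> b' * f z)"
proof (intro exI conjI allI impI)
  let ?a = "a + (T w 1 / \<beta> - a * f 1) / D" and ?b = "b - (b * f 1 - T w 1 / \<beta>) / D"
  show "?b - ?a = contr * (b - a)"
    using D_pos by (simp add: contr_def field_simps)
  fix z :: real assume z: "z \<ge> 0"
  have "f z / D * T (\<lambda>y. w y - a * f y) 1 \<le> T (\<lambda>y. w y - a * f y) z"
    by (rule T_ge_minorization[OF lin_growth_diff[OF w lin_growth_scale[OF lin_growth_f]] _ z]) (use ab in simp)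
  then have "f z / D * (T w 1 - a * (\<beta> * f 1)) \<le> T w z - a * (\<beta> * f z)"
    using z by (simp add: T_diff w lin_growth_scale lin_growth_f T_scale eigen)
  then have "f z / D * (T w 1 - a * (\<beta> * f 1)) / \<beta> \<le> (T w z - a * (\<beta> * f z)) / \<beta>"
    using \<beta>_pos by (intro divide_right_mono) auto
  then show "?a * f z \<le> T w z / \<beta>"
    using \<beta>_pos D_pos by (simp add: field_simps)
  have "f z / D * T (\<lambda>y. b * f y - w y) 1 \<le> T (\<lambda>y. b * f y - w y) z"
    by (rule T_ge_minorization[OF lin_growth_diff[OF lin_growth_scale[OF lin_growth_f] w] _ z]) (use ab in simp)
  then have "f z / D * (b * (\<beta> * f 1) - T w 1) \<le> b * (\<beta> * f z) - T w z"
    using z by (simp add: T_diff w lin_growth_scale lin_growth_f T_scale eigen)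
  then have "f z / D * (b * (\<beta> * f 1) - T w 1) / \<beta> \<le> (b * (\<beta> * f z) - T w z) / \<beta>"
    using \<beta>_pos by (intro divide_right_mono) auto
  also have "\<dots> = b * f z - T w z / \<beta>" using \<beta>_pos by (simp add: diff_divide_distrib)
  also have "f z / D * (b * (\<beta> * f 1) - T w 1) / \<beta> = f z * ((b * f 1 - T w 1 / \<beta>) / D)"
    using \<beta>_pos D_pos by (simp add: field_simps)
  finally show "T w z / \<beta> \<le> ?b * f z" by (simp only: left_diff_distrib mult.commute[of "f z"])
qed

text \<open>Growth in \<open>z\<close> is harmless; what matters is that \<open>x\<close> enters
  through \<open>fquot x\<close>, so that dividing by \<open>fquot x\<close> stays uniform down to
  \<open>x = 0\<close>.\<close>

lemma kern_0_le:
  assumes "x \<ge> 0" "z > 0" shows "kern 0 x z \<le> fquot x / f 1 * (1 + z)"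
proof (cases "x = 0")
  case True
  have "1 * 1 \<le> slope / f 1 * (1 + z)"
    using f_le_slope[of 1] f_pos[of 1] assms by (intro mult_mono) auto
  then show ?thesis using True assms by (simp add: fquot_def kern.simps)
next
  case False
  have "min x z \<le> min x 1 * (1 + z)"
    using assms by (intro min_le_min_1_mult) auto
  also have "\<dots> \<le> f x / f 1 * (1 + z)"
    using f_ge[of x] f_pos[of 1] assms
    by (intro mult_right_mono) (simp_all add: pos_le_divide_eq mult.commute)
  finally have "min x z / x \<le> f x / f 1 * (1 + z) / x"
    using assms by (intro divide_right_mono) auto
  then show ?thesis using False by (simp add: fquot_def kern.simps field_simps)
qed

text \<open>Length of the initial sandwich. Each of the two kernels composed in
  \<open>kern (Suc 0)\<close> contributes a factor \<open>1 + z\<close> and a division by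
  \<open>f 1\<close>; \<open>\<beta>\<^sup>2\<close> normalizes two generations.\<close>

definition conv_const :: real where
  "conv_const = (\<integral>z. (1 + z) * (1 + z) \<partial>U) / (f 1 * f 1 * \<beta>\<^sup>2)"

text \<open>The outer kernel yields the factor \<open>min z 1\<close>, which is at most
  \<open>f z / f 1\<close>, and the inner kernel yields \<open>fquot x\<close>.\<close>

lemma kern_1_le:
  assumes "x \<ge> 0" "z \<ge> 0"
  shows "kern (Suc 0) x z / (\<beta>\<^sup>2 * fquot x) \<le> conv_const * f z"
proof -
  have l1: "lin_growth (\<lambda>z. 1 + z)" by (rule lin_growthI[where C = 1]) auto
  let ?I = "\<integral>z. (1 + z) * (1 + z) \<partial>U"
  have I: "0 \<le> ?I" by simp
  have "kern (Suc 0) x z \<le> (\<integral>y. (min z 1 * fquot x / f 1) * ((1 + y) * (1 + y)) \<partial>U)"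
    unfolding kern.simps(2) T_def
  proof (rule integral_mono_AE)
    show "integrable U (\<lambda>y. min z y * kern 0 x y)"
      by (rule integrable_min_mult[OF lin_growth_kern[OF assms(1)]])
    show "integrable U (\<lambda>y. (min z 1 * fquot x / f 1) * ((1 + y) * (1 + y)))"
      by (intro integrable_mult_right impI integrable_lin_growth_mult l1)
    show "AE y in U. min z y * kern 0 x y \<le> (min z 1 * fquot x / f 1) * ((1 + y) * (1 + y))"
      using AE_pos
    proof eventually_elim
      case (elim y)
      have "min z y * kern 0 x y \<le> (min z 1 * (1 + y)) * (fquot x / f 1 * (1 + y))"
        using assms elim kern_0_range[of x y]
        by (intro mult_mono kern_0_le min_le_min_1_mult) auto
      then show ?case by (simp add: mult_ac)
    qed
  qed
  also have "\<dots> = min z 1 * fquot x / f 1 * ?I" by simp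
  also have "\<dots> \<le> (f z / f 1) * fquot x / f 1 * ?I"
    using f_ge[OF assms(2)] f_pos[of 1] fquot_pos[OF assms(1)] I
    by (intro mult_right_mono divide_right_mono) (auto simp: field_simps)
  finally show ?thesis
    using fquot_pos[OF assms(1)] \<beta>_pos f_pos[of 1] by (simp add: conv_const_def field_simps)
qed

text \<open>
  The Markov kernel \<open>min x y f y / (\<beta> f x) U(dy)\<close> is bounded below by a fixed measure, uniformly
  in \<open>x\<close>, so each application of \<open>T\<close> shrinks the gap between the bounds \<open>a\<close> and \<open>b\<close> by the
  factor \<open>contr\<close>.
\<close>
lemma kern_bounds:
  assumes "x \<ge> 0"
  shows "\<exists>a b. b - a = contr ^ n * conv_const \<and>
    (\<forall>z\<ge>0. a * f z \<le> kern (Suc n) x z / (\<beta> ^ (n + 2) * fquot x) \<and>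
            kern (Suc n) x z / (\<beta> ^ (n + 2) * fquot x) \<le> b * f z)"
proof (induction n)
  case 0
  show ?case
    by (rule exI[of _ 0], rule exI[of _ conv_const])
      (use kern_1_le[OF assms] kern_nonneg[OF assms, of _ "Suc 0"] fquot_pos[OF assms] \<beta>_pos in
        \<open>auto simp: power2_eq_square\<close>)
next
  case (Suc n)
  let ?w = "\<lambda>z. kern (Suc n) x z / (\<beta> ^ (n + 2) * fquot x)"
  obtain a b where ab: "b - a = contr ^ n * conv_const"
    "\<And>z. z \<ge> 0 \<Longrightarrow> a * f z \<le> ?w z" "\<And>z. z \<ge> 0 \<Longrightarrow> ?w z \<le> b * f z"
    using Suc by blast
  have w: "lin_growth ?w"
    using lin_growth_scale[OF lin_growth_kern[OF assms], of "1 / (\<beta> ^ (n + 2) * fquot x)"] by simp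
  obtain a' b' where ab': "b' - a' = contr * (b - a)"
    "\<And>z. z \<ge> 0 \<Longrightarrow> a' * f z \<le> T ?w z / \<beta>" "\<And>z. z \<ge> 0 \<Longrightarrow> T ?w z / \<beta> \<le> b' * f z"
    using T_contraction[OF w, of a b] ab by auto
  have "T ?w z / \<beta> = kern (Suc (Suc n)) x z / (\<beta> ^ (Suc n + 2) * fquot x)" for z
    using T_scale[of "1 / (\<beta> ^ (n + 2) * fquot x)" "kern (Suc n) x" z]
    unfolding kern.simps(2)[of "Suc n"] by simp
  then show ?case using ab ab' by (intro exI[of _ a'] exI[of _ b']) auto
qed

theorem kern_convergence:
  assumes "x \<ge> 0" "z \<ge> 0"
  shows "\<bar>kern (Suc n) x z - \<beta> ^ (n + 2) * fquot x * f z\<bar>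
    \<le> conv_const * contr ^ n * (\<beta> ^ (n + 2) * fquot x * f z)"
proof -
  let ?c = "\<beta> ^ (n + 2) * fquot x"
  let ?w = "\<lambda>z. kern (Suc n) x z / ?c"
  have c: "?c > 0" using \<beta>_pos fquot_pos[OF assms(1)] by simp
  obtain a b where ab: "b - a = contr ^ n * conv_const"
    "\<And>z. z \<ge> 0 \<Longrightarrow> a * f z \<le> ?w z" "\<And>z. z \<ge> 0 \<Longrightarrow> ?w z \<le> b * f z"
    using kern_bounds[OF assms(1), of n] by blast
  have w: "lin_growth ?w"
    using lin_growth_scale[OF lin_growth_kern[OF assms(1)], of "1 / ?c"] by simp
  have "(\<integral>z. ?w z * f z \<partial>U) = (\<integral>z. kern (Suc n) x z * f z / ?c \<partial>U)" by simp
  also have "\<dots> = 1"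
    using kern_integral[OF assms(1), of "Suc n"] \<beta>_pos fquot_pos[OF assms(1)] by simp
  finally have one: "(\<integral>z. ?w z * f z \<partial>U) = 1" .
  \<comment> \<open>Both \<open>?w z\<close> and \<open>f z\<close> then lie between
    \<open>a * f z\<close> and \<open>b * f z\<close>, so their distance is at most the gap.\<close>
  have "a \<le> 1" by (rule normalized_bounds(1)[OF w one ab(2)]) simp
  moreover have "1 \<le> b" by (rule normalized_bounds(2)[OF w one ab(3)]) simp
  ultimately have "a * f z \<le> f z" "f z \<le> b * f z"
    using f_nonneg[OF assms(2)] mult_right_mono[of a 1 "f z"] mult_right_mono[of 1 b "f z"] by auto
  then have "\<bar>?w z - f z\<bar> \<le> b * f z - a * f z" using ab(2,3)[OF assms(2)] by linarith
  also have "\<dots> = contr ^ n * conv_const * f z" unfolding ab(1)[symmetric] by (simp add: algebra_simps)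
  finally have "?c * \<bar>?w z - f z\<bar> \<le> ?c * (contr ^ n * conv_const * f z)"
    using c by (intro mult_left_mono) auto
  moreover have "?c * \<bar>?w z - f z\<bar> = \<bar>?c * (?w z - f z)\<bar>" by (subst abs_mult[of ?c]) (simp only: abs_of_pos[OF c])
  moreover have "?c * (?w z - f z) = kern (Suc n) x z - ?c * f z" using \<beta>_pos fquot_pos[OF assms(1)] by (simp add: right_diff_distrib)
  ultimately show ?thesis by (simp add: mult_ac)
qed

lemma conv_const_nonneg: "0 \<le> conv_const"
  by (simp add: conv_const_def)

section \<open>Uniqueness of eigenfunctions\<close>

text \<open>Equality in the triangle inequality for \<open>T \<phi> x\<close> at a single
  \<open>x > 0\<close> already fixes the sign of \<open>\<phi>\<close>, because the kernel is
  positive almost everywhere. Such an \<open>x\<close> exists: the defect \<open>?d\<close> is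
  nonnegative, and its pairing with \<open>f\<close> is \<open>\<beta> - \<bar>b\<bar>\<close> times
  a positive number.\<close>

lemma eigenfunction_dominant:
  assumes \<phi>: "lin_growth \<phi>" and b: "\<And>x. x \<ge> 0 \<Longrightarrow> T \<phi> x = b * \<phi> x" "b \<noteq> 0"
    and nz: "\<exists>x\<ge>0. \<phi> x \<noteq> 0" and ge: "\<beta> \<le> \<bar>b\<bar>"
  shows "b = \<beta>" "\<exists>s. AE z in U. \<bar>\<phi> z\<bar> = s * \<phi> z"
proof -
  let ?a = "\<lambda>z. \<bar>\<phi> z\<bar>"
  have a: "lin_growth ?a" by (rule lin_growth_abs[OF \<phi>])
  have [measurable]: "\<phi> \<in> borel_measurable borel" by (rule lin_growth_measurable[OF \<phi>])
  \<comment> \<open>If \<open>\<phi>\<close> vanished almost everywhere it would vanish everywhere,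
    since \<open>T \<phi>\<close> depends only on the almost everywhere class.\<close>
  have pos: "0 < (\<integral>z. ?a z * f z \<partial>U)"
  proof (rule ccontr)
    assume "\<not> ?thesis"
    then have "AE z in U. \<phi> z = 0"
      by (intro AE_of_integral_f_nonpos[OF a]) auto
    then have "T \<phi> x = 0" for x
      unfolding T_def by (intro integral_eq_zero_AE) (auto elim!: eventually_mono)
    then show False using b nz by auto
  qed
  have le: "\<bar>b\<bar> * ?a x \<le> T ?a x" if "x \<ge> 0" for x
  proof -
    have "\<bar>b\<bar> * ?a x = \<bar>T \<phi> x\<bar>" using b that by (simp add: abs_mult)
    also have "\<dots> \<le> (\<integral>z. \<bar>min x z * \<phi> z\<bar> \<partial>U)" unfolding T_def by (rule integral_abs_bound)
    also have "\<dots> = T ?a x" unfolding T_def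
      using AE_pos that by (intro integral_cong_AE) (auto elim!: eventually_mono simp: abs_mult)
    finally show ?thesis .
  qed
  let ?d = "\<lambda>x. T ?a x - \<bar>b\<bar> * ?a x"
  have d: "lin_growth ?d" by (intro lin_growth_diff lin_growth_T lin_growth_scale a)
  have "(\<integral>z. T ?a z * f z \<partial>U) = (\<integral>z. ?a z * T f z \<partial>U)" by (rule T_symmetric[OF a lin_growth_f])
  also have "\<dots> = (\<integral>z. \<beta> * (?a z * f z) \<partial>U)"
    using AE_pos by (intro integral_cong_AE) (auto elim!: eventually_mono simp: eigen)
  finally have Ta: "(\<integral>z. T ?a z * f z \<partial>U) = \<beta> * (\<integral>z. ?a z * f z \<partial>U)" by simp
  have "(\<integral>z. ?d z * f z \<partial>U) = (\<integral>z. T ?a z * f z - \<bar>b\<bar> * (?a z * f z) \<partial>U)"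
    by (simp add: left_diff_distrib mult.assoc)
  also have "\<dots> = (\<beta> - \<bar>b\<bar>) * (\<integral>z. ?a z * f z \<partial>U)"
    using integrable_lin_growth_mult[OF lin_growth_T[OF a] lin_growth_f]
      integrable_lin_growth_mult[OF a lin_growth_f] Ta by (simp add: left_diff_distrib)
  also have "\<dots> \<le> 0" using ge pos by (simp add: mult_le_0_iff)
  finally have "AE z in U. ?d z = 0"
  proof (rule AE_of_integral_f_nonpos[OF d, rotated 2])
    show dn: "0 \<le> ?d z" if "z > 0" for z using le[of z] that by simp
    show "?d z = 0" if "z > 0" "?d z \<le> 0" for z using dn[OF that(1)] that(2) by simp
  qed
  then have "AE z in U. z > 0 \<and> ?d z = 0" using AE_pos by eventually_elim auto
  \<comment> \<open>An almost everywhere statement yields a point only for a nonzero measure;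
    \<open>f_norm\<close> guarantees that.\<close>
  have "\<exists>x. x > 0 \<and> ?d x = 0"
  proof (rule ccontr)
    assume no: "\<nexists>x. x > 0 \<and> ?d x = 0"
    have "AE z in U. f z * f z = 0"
      using \<open>AE z in U. z > 0 \<and> ?d z = 0\<close> by eventually_elim (use no in auto)
    then have "(\<integral>z. f z * f z \<partial>U) = 0" by (rule integral_eq_zero_AE)
    then show False using f_norm by simp
  qed
  then obtain x where x: "x > 0" "?d x = 0" by (elim exE conjE)
  \<comment> \<open>\<open>s\<close> is the candidate for the common sign: \<open>?e\<close> is
    nonnegative and has zero integral against the positive kernel \<open>min x\<close>.\<close>
  define s where "s = sgn (T \<phi> x)"
  have "s * T \<phi> x = \<bar>T \<phi> x\<bar>" by (simp add: s_def sgn_mult_self_eq abs_sgn mult.commute)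
  also have "\<dots> = T ?a x" using x b(1)[of x] by (simp add: abs_mult)
  finally have s: "s * T \<phi> x = T ?a x" .
  let ?e = "\<lambda>z. ?a z - s * \<phi> z"
  have "T ?e x = 0" using s by (simp add: T_diff a \<phi> lin_growth_scale T_scale)
  moreover have e0: "0 \<le> ?e z" for z
    by (auto simp: s_def sgn_real_def)
  have nn: "AE z in U. 0 \<le> min x z * ?e z"
    using AE_pos by eventually_elim (use x e0 in \<open>auto intro!: mult_nonneg_nonneg\<close>)
  ultimately have "AE z in U. min x z * ?e z = 0"
    using integral_nonneg_eq_0_iff_AE[OF integrable_min_mult[of ?e x] nn] a \<phi>
    by (simp add: T_def lin_growth_diff lin_growth_scale)
  then have AEs: "AE z in U. \<bar>\<phi> z\<bar> = s * \<phi> z"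
    using AE_pos by eventually_elim (use x in \<open>auto simp: min_def split: if_splits\<close>)
  then show "\<exists>s. AE z in U. \<bar>\<phi> z\<bar> = s * \<phi> z" by (rule exI)
  \<comment> \<open>Having constant sign, \<open>\<phi>\<close> is not orthogonal to
    \<open>f\<close>, so symmetry forces the two eigenvalues to agree.\<close>
  have "b * (\<integral>z. \<phi> z * f z \<partial>U) = (\<integral>z. b * \<phi> z * f z \<partial>U)" by (simp add: mult.assoc)
  also have "\<dots> = (\<integral>z. T \<phi> z * f z \<partial>U)"
    using AE_pos b by (intro integral_cong_AE) (auto elim!: eventually_mono)
  also have "\<dots> = (\<integral>z. \<phi> z * T f z \<partial>U)" by (rule T_symmetric[OF \<phi> lin_growth_f])
  also have "\<dots> = (\<integral>z. \<beta> * (\<phi> z * f z) \<partial>U)"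
    using AE_pos by (intro integral_cong_AE) (auto elim!: eventually_mono simp: eigen)
  finally have "b * (\<integral>z. \<phi> z * f z \<partial>U) = \<beta> * (\<integral>z. \<phi> z * f z \<partial>U)" by simp
  moreover have "(\<integral>z. ?a z * f z \<partial>U) = (\<integral>z. s * (\<phi> z * f z) \<partial>U)"
    using AEs by (intro integral_cong_AE) (auto elim!: eventually_mono)
  then have "(\<integral>z. \<phi> z * f z \<partial>U) \<noteq> 0" using pos by auto
  ultimately show "b = \<beta>" by simp
qed

theorem eigenfunction_simple:
  assumes \<phi>: "lin_growth \<phi>" and b: "\<And>x. x \<ge> 0 \<Longrightarrow> T \<phi> x = \<beta> * \<phi> x"
  shows "\<exists>c. \<forall>x\<ge>0. \<phi> x = c * f x"
proof -
  define c where "c = \<phi> 1 / f 1"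
  let ?\<psi> = "\<lambda>x. \<phi> x - c * f x"
  have \<psi>: "lin_growth ?\<psi>" by (intro lin_growth_diff lin_growth_scale \<phi> lin_growth_f)
  have e: "T ?\<psi> x = \<beta> * ?\<psi> x" if "x \<ge> 0" for x
    using that b eigen by (simp add: T_diff \<phi> lin_growth_scale lin_growth_f T_scale algebra_simps)
  have "?\<psi> x = 0" if "x \<ge> 0" for x
  proof (rule ccontr)
    assume "?\<psi> x \<noteq> 0"
    with that have nz: "\<exists>x\<ge>0. ?\<psi> x \<noteq> 0" by blast
    obtain s where s: "AE z in U. \<bar>?\<psi> z\<bar> = s * ?\<psi> z"
      using eigenfunction_dominant(2)[OF \<psi> e _ nz] \<beta>_pos by auto
    have [measurable]: "?\<psi> \<in> borel_measurable borel" by (rule lin_growth_measurable[OF \<psi>])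
    \<comment> \<open>Integrating the sign relation against \<open>min 1\<close> gives a multiple of
      \<open>?\<psi> 1\<close>, the value that the choice of \<open>c\<close> makes zero.\<close>
    have "T (\<lambda>z. \<bar>?\<psi> z\<bar>) 1 = T (\<lambda>z. s * ?\<psi> z) 1" unfolding T_def
      using s by (intro integral_cong_AE) (auto elim!: eventually_mono)
    also have "\<dots> = s * (\<beta> * ?\<psi> 1)" by (simp only: T_scale e[of 1] zero_le_one)
    also have "?\<psi> 1 = 0" using f_pos[of 1] by (simp add: c_def)
    finally have 0: "(\<integral>z. min 1 z * \<bar>?\<psi> z\<bar> \<partial>U) = 0" by (simp add: T_def)
    have nn: "AE z in U. 0 \<le> min 1 z * \<bar>?\<psi> z\<bar>" using AE_pos by eventually_elim auto
    have "AE z in U. min 1 z * \<bar>?\<psi> z\<bar> = 0"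
      using 0 integral_nonneg_eq_0_iff_AE[OF integrable_min_mult[OF lin_growth_abs[OF \<psi>]] nn] by simp
    then have "AE z in U. min x z * ?\<psi> z = 0"
      using AE_pos by eventually_elim (auto simp: min_def split: if_splits)
    \<comment> \<open>The eigenvalue equation turns vanishing almost everywhere into vanishing at
      the given point.\<close>
    then have "T ?\<psi> x = 0" unfolding T_def by (rule integral_eq_zero_AE)
    then show False using e[OF that] \<open>?\<psi> x \<noteq> 0\<close> \<beta>_pos by simp
  qed
  then show ?thesis by (intro exI[of _ c]) auto
qed

text \<open>For the second claim: eigenfunctions for different eigenvalues are orthogonal by
  symmetry, while a nonnegative nonzero \<open>\<phi>\<close> is not orthogonal to the positive
  \<open>f\<close>.\<close>

lemma eigenvalue_bound:
  assumes \<phi>: "lin_growth \<phi>" and b: "\<And>x. x \<ge> 0 \<Longrightarrow> T \<phi> x = b * \<phi> x" "b \<noteq> 0"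
    and nz: "\<exists>x\<ge>0. \<phi> x \<noteq> 0"
  shows "b \<noteq> \<beta> \<Longrightarrow> \<bar>b\<bar> < \<beta>" "(\<And>x. x \<ge> 0 \<Longrightarrow> 0 \<le> \<phi> x) \<Longrightarrow> b = \<beta>"
proof -
  show "\<bar>b\<bar> < \<beta>" if "b \<noteq> \<beta>" using eigenfunction_dominant(1)[OF assms] that by linarith
  assume nn: "\<And>x. x \<ge> 0 \<Longrightarrow> 0 \<le> \<phi> x"
  have [measurable]: "\<phi> \<in> borel_measurable borel" by (rule lin_growth_measurable[OF \<phi>])
  have "b * (\<integral>z. \<phi> z * f z \<partial>U) = (\<integral>z. b * \<phi> z * f z \<partial>U)" by (simp add: mult.assoc)
  also have "\<dots> = (\<integral>z. T \<phi> z * f z \<partial>U)"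
    using AE_pos b by (intro integral_cong_AE) (auto elim!: eventually_mono)
  also have "\<dots> = (\<integral>z. \<phi> z * T f z \<partial>U)" by (rule T_symmetric[OF \<phi> lin_growth_f])
  also have "\<dots> = (\<integral>z. \<beta> * (\<phi> z * f z) \<partial>U)"
    using AE_pos by (intro integral_cong_AE) (auto elim!: eventually_mono simp: eigen)
  finally have "b * (\<integral>z. \<phi> z * f z \<partial>U) = \<beta> * (\<integral>z. \<phi> z * f z \<partial>U)" by simp
  moreover have "(\<integral>z. \<phi> z * f z \<partial>U) \<noteq> 0"
  proof
    assume "(\<integral>z. \<phi> z * f z \<partial>U) = 0"
    then have "AE z in U. \<phi> z = 0"
      by (intro AE_of_integral_f_nonpos[OF \<phi>]) (simp_all add: nn antisym)
    then have "T \<phi> x = 0" for x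
      unfolding T_def by (intro integral_eq_zero_AE) (auto elim!: eventually_mono)
    then show False using b nz by auto
  qed
  ultimately show "b = \<beta>" by simp
qed

end

section \<open>The measure \<open>\<upsilon>\<close>\<close>

locale ewt =
  fixes P :: "nat pmf" and \<theta> :: real
  assumes P_0: "pmf P 0 = 0"
    and P_1: "pmf P 1 < 1"
    and \<theta>_pos: "\<theta> > 0"
    and integrable_exp_P: "integrable (measure_pmf P) (\<lambda>n. exp (\<theta> * real n))"
begin

abbreviation U :: "real measure" where "U \<equiv> upsilon P"

definition mgf :: real where "mgf = measure_pmf.expectation P (\<lambda>n. exp (\<theta> * real n))"

lemma pmf_le: "pmf P k \<le> mgf * exp (- \<theta> * real k)"
proof -
  have "pmf P k * exp (\<theta> * real k) = (\<integral>n. indicator {k} n * exp (\<theta> * real k) \<partial>measure_pmf P)"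
    by (simp add: pmf.rep_eq)
  also have "\<dots> \<le> mgf" unfolding mgf_def
  proof (rule integral_mono[OF _ integrable_exp_P])
    show "integrable (measure_pmf P) (\<lambda>n. indicator {k} n * exp (\<theta> * real k))"
      by (intro measure_pmf.integrable_const_bound[where B = "exp (\<theta> * real k)"]) (auto simp: indicator_def)
  qed (auto simp: indicator_def)
  finally show ?thesis by (simp add: exp_minus field_simps)
qed

lemma mgf_nonneg: "0 \<le> mgf" unfolding mgf_def by simp

text \<open>The exponential rate of \<open>g2\<close>: by \<open>pmf_le\<close> its series grows at
  most like \<open>exp (exp (- \<theta>) * x)\<close>, against the factor \<open>exp (- x)\<close>.
  The exponent \<eta> in \<open>V\<close> is half of it, which leaves room for polynomial
  factors.\<close>

definition decay :: real where "decay = 1 - exp (- \<theta>)"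

lemma decay_pos: "0 < decay" using \<theta>_pos by (simp add: decay_def)

lemma summable_pmf_exp: "summable (\<lambda>j. pmf P (j + i) * x ^ j / fact j)"
proof (rule summable_comparison_test')
  show "summable (\<lambda>j. inverse (fact j) * \<bar>x\<bar> ^ j)" by (rule summable_exp)
  show "norm (pmf P (j + i) * x ^ j / fact j) \<le> inverse (fact j) * \<bar>x\<bar> ^ j" if "j \<ge> 0" for j
  proof -
    have "pmf P (j + i) * \<bar>x\<bar> ^ j \<le> 1 * \<bar>x\<bar> ^ j" by (intro mult_right_mono pmf_le_1) auto
    then show ?thesis by (simp add: abs_mult power_abs divide_simps)
  qed
qed

text \<open>Mass beyond 1 makes \<open>g2\<close> strictly positive on the open half-line, on which
  all strict inequalities and uniqueness arguments rest.\<close>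

lemma pmf_pos_ex: "\<exists>j. 0 < pmf P (j + 2)"
proof (rule ccontr)
  assume "\<not> ?thesis"
  then have 2: "pmf P (j + 2) = 0" for j by (metis pmf_nonneg antisym_conv1 less_eq_real_def)
  have "set_pmf P \<subseteq> {1}"
  proof
    fix k assume "k \<in> set_pmf P"
    then have "pmf P k \<noteq> 0" by (simp add: set_pmf_iff)
    then have "k \<noteq> 0" "\<not> 2 \<le> k" using P_0 2[of "k - 2"] by (metis, metis le_add_diff_inverse2)
    then show "k \<in> {1}" by auto
  qed
  then have "measure (measure_pmf P) {1} = 1"
    using measure_pmf.prob_eq_1[of "{1}" P] by (auto simp: AE_measure_pmf_iff)
  then show False using P_1 by (simp add: pmf.rep_eq)
qed

lemma g2_measurable [measurable]: "g2 P \<in> borel_measurable borel"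
  unfolding g2_def by measurable

lemma g2_nonneg: "0 \<le> x \<Longrightarrow> 0 \<le> g2 P x"
  unfolding g2_def by (intro mult_nonneg_nonneg suminf_nonneg summable_pmf_exp) auto

lemma g2_pos: assumes "0 < x" shows "0 < g2 P x"
proof -
  obtain j where "0 < pmf P (j + 2)" using pmf_pos_ex by blast
  then have "0 < (\<Sum>j. pmf P (j + 2) * x ^ j / fact j)"
    using assms by (intro suminf_pos2[where i = j] summable_pmf_exp) auto
  then show ?thesis by (simp add: g2_def)
qed

lemma g2_le: assumes "0 \<le> x" shows "g2 P x \<le> mgf * exp (- decay * x)"
proof -
  have s: "(\<lambda>j. inverse (fact j) * (exp (- \<theta>) * x) ^ j) sums exp (exp (- \<theta>) * x)"
    using exp_converges[of "exp (- \<theta>) * x"] by simp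
  have "(\<Sum>j. pmf P (j + 2) * x ^ j / fact j) \<le> (\<Sum>j. mgf * (inverse (fact j) * (exp (- \<theta>) * x) ^ j))"
  proof (rule suminf_le[OF _ summable_pmf_exp])
    show "summable (\<lambda>j. mgf * (inverse (fact j) * (exp (- \<theta>) * x) ^ j))"
      using sums_summable[OF s] by (rule summable_mult)
    fix j
    have "exp (- \<theta> * real (j + 2)) \<le> exp (- \<theta> * real j)" using \<theta>_pos by simp
    then have "mgf * exp (- \<theta> * real (j + 2)) \<le> mgf * exp (- \<theta>) ^ j"
      using mgf_nonneg by (intro mult_left_mono) (simp_all add: exp_of_nat_mult[symmetric] mult.commute)
    with pmf_le[of "j + 2"] have "pmf P (j + 2) \<le> mgf * exp (- \<theta>) ^ j" by linarith
    then have "pmf P (j + 2) * (x ^ j / fact j) \<le> mgf * exp (- \<theta>) ^ j * (x ^ j / fact j)"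
      using assms by (intro mult_right_mono) auto
    then show "pmf P (j + 2) * x ^ j / fact j \<le> mgf * (inverse (fact j) * (exp (- \<theta>) * x) ^ j)"
      by (simp add: power_mult_distrib field_simps)
  qed
  also have "\<dots> = mgf * exp (exp (- \<theta>) * x)"
    using s by (simp add: suminf_mult sums_summable sums_unique[symmetric])
  finally have "g2 P x \<le> exp (- x) * (mgf * exp (exp (- \<theta>) * x))"
    unfolding g2_def by (intro mult_left_mono) auto
  also have "\<dots> = mgf * exp (- decay * x)"
    by (simp add: decay_def exp_add[symmetric] algebra_simps)
  finally show ?thesis .
qed

lemma sets_upsilon [measurable_cong]: "sets U = sets borel"
  by (simp add: upsilon_def)

lemma space_upsilon [simp]: "space U = UNIV"
  by (simp add: upsilon_def)

lemma AE_upsilon_pos: "AE z in U. 0 < z"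
proof -
  have "AE z in lborel. z \<noteq> (0::real)" by (rule AE_lborel_singleton)
  then show ?thesis unfolding upsilon_def
    by (subst AE_density) (auto elim!: eventually_mono simp: indicator_def split: if_splits)
qed

lemma AE_upsilonI:
  assumes "AE z in lborel. 0 < z \<longrightarrow> Q z" shows "AE z in U. Q z"
proof -
  have "AE z in U. 0 < z \<longrightarrow> Q z"
    unfolding upsilon_def by (subst AE_density) (use assms in \<open>auto elim!: eventually_mono\<close>)
  with AE_upsilon_pos show ?thesis by eventually_elim auto
qed

text \<open>Strict positivity of \<open>g2\<close> makes Lebesgue measure absolutely continuous with
  respect to \<open>U\<close> on the open half-line.\<close>

lemma AE_upsilonD:
  assumes "AE z in U. Q z" shows "AE z in lborel. 0 < z \<longrightarrow> Q z"
proof -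
  have "AE z in lborel. 0 < ennreal (indicator {0..} z * g2 P z) \<longrightarrow> Q z"
    using assms unfolding upsilon_def by (subst (asm) AE_density) auto
  then show ?thesis by eventually_elim (auto simp: g2_pos)
qed

lemma integrable_upsilon:
  assumes "\<phi> \<in> borel_measurable borel"
  shows "integrable U \<phi> \<longleftrightarrow> set_integrable lborel {0..} (\<lambda>y. g2 P y * \<phi> y)"
  unfolding upsilon_def set_integrable_def
  by (subst integrable_density) (use assms g2_nonneg in \<open>auto simp: mult.assoc indicator_def\<close>)

lemma integral_upsilon:
  assumes "\<phi> \<in> borel_measurable borel"
  shows "(\<integral>y. \<phi> y \<partial>U) = (LBINT y:{0..}. g2 P y * \<phi> y)"
  unfolding upsilon_def set_lebesgue_integral_def
  by (subst integral_density) (use assms g2_nonneg in \<open>auto simp: mult.assoc indicator_def\<close>)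

lemma integrable_exp_upsilon:
  assumes "c < decay" shows "integrable U (\<lambda>x. exp (c * x))"
proof (subst integrable_upsilon)
  let ?a = "decay - c"
  have a: "0 < ?a" using assms by simp
  interpret prob_space "density lborel (exponential_density ?a)"
    by (rule prob_space_exponential_density[OF a])
  have "(\<integral>\<^sup>+ x. ennreal (exponential_density ?a x) \<partial>lborel) = 1"
    using emeasure_space_1 by (simp add: emeasure_density)
  then have "integrable lborel (exponential_density ?a)"
    using a by (intro integrableI_nonneg) (auto simp: exponential_density_nonneg)
  then have i: "integrable lborel (\<lambda>x. mgf / ?a * exponential_density ?a x)" by simp
  show "set_integrable lborel {0..} (\<lambda>y. g2 P y * exp (c * y))"
    unfolding set_integrable_def
  proof (rule Bochner_Integration.integrable_bound[OF i], measurable, intro AE_I2)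
    fix x :: real
    show "norm (indicator {0..} x *\<^sub>R (g2 P x * exp (c * x))) \<le> norm (mgf / ?a * exponential_density ?a x)"
    proof (cases "x \<ge> 0")
      case True
      have "g2 P x * exp (c * x) \<le> mgf * exp (- decay * x) * exp (c * x)"
        using g2_le[OF True] by (intro mult_right_mono) auto
      also have "\<dots> = mgf * exp (- x * ?a)" by (simp add: exp_add[symmetric] algebra_simps)
      finally show ?thesis using True a g2_nonneg[OF True] mgf_nonneg
        by (simp add: exponential_density_def)
    qed simp
  qed
qed simp

lemma le_exp: fixes c x :: real assumes "c > 0" shows "x \<le> 1 / c * exp (c * x)"
proof -
  have "c * x \<le> exp (c * x)" using exp_ge_add_one_self[of "c * x"] by linarith
  then show ?thesis using assms by (simp add: field_simps)
qed

text \<open>The exponent is the \<eta> of \<open>V\<close>. By \<open>le_exp\<close> the factor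
  \<open>x\<close> costs another quarter of \<open>decay\<close>, so the total exponent stays at
  three quarters.\<close>

lemma integrable_exp_times: "integrable U (\<lambda>x. x * exp (decay / 2 * x))"
proof (rule Bochner_Integration.integrable_bound)
  show "integrable U (\<lambda>x. 4 / decay * exp (3 * decay / 4 * x))"
    using integrable_exp_upsilon[of "3 * decay / 4"] decay_pos by simp
  show "AE x in U. norm (x * exp (decay / 2 * x)) \<le> norm (4 / decay * exp (3 * decay / 4 * x))"
    using AE_upsilon_pos
  proof eventually_elim
    case (elim x)
    have "x * exp (decay / 2 * x) \<le> (1 / (decay / 4) * exp (decay / 4 * x)) * exp (decay / 2 * x)"
      using le_exp[of "decay / 4" x] decay_pos by (intro mult_right_mono) auto
    also have "\<dots> = 4 / decay * exp (3 * decay / 4 * x)"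
      by (simp add: exp_add[symmetric] algebra_simps)
    finally show ?case using elim decay_pos by simp
  qed
qed measurable

lemma integrable_square: "integrable U (\<lambda>x. x\<^sup>2)"
proof (rule Bochner_Integration.integrable_bound)
  show "integrable U (\<lambda>x. 2 / decay * (x * exp (decay / 2 * x)))"
    using integrable_exp_times by simp
  show "AE x in U. norm (x\<^sup>2) \<le> norm (2 / decay * (x * exp (decay / 2 * x)))"
    using AE_upsilon_pos
  proof eventually_elim
    case (elim x)
    have "x * x \<le> x * (1 / (decay / 2) * exp (decay / 2 * x))"
      using le_exp[of "decay / 2" x] decay_pos elim by (intro mult_left_mono) auto
    then show ?case using elim decay_pos by (simp add: power2_eq_square mult.left_commute)
  qed
qed measurable

sublocale min_kernel U
proof (intro min_kernel.intro min_kernel_axioms.intro finite_measureI)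
  have "integrable U (\<lambda>x. 1 :: real)" using integrable_exp_upsilon[of 0] decay_pos by simp
  then have "emeasure U (space U) < \<infinity>" by (subst (asm) integrable_iff_bounded) simp
  then show "emeasure U (space U) \<noteq> \<infinity>" by simp
qed (fact sets_upsilon AE_upsilon_pos integrable_square)+

text \<open>Termwise this is a Gamma integral, \<open>(j + 1)!\<close> against \<open>j!\<close>,
  leaving the factor \<open>j + 1\<close>. The computation runs in the extended nonnegative reals,
  where sum and integral commute.\<close>

lemma integral_id: "(\<integral>z. z \<partial>U) = measure_pmf.expectation P real - 1"
proof -
  have "integrable (measure_pmf P) (\<lambda>n. real n)"
  proof (rule Bochner_Integration.integrable_bound)
    show "integrable (measure_pmf P) (\<lambda>n. 1 / \<theta> * exp (\<theta> * real n))" using integrable_exp_P by simp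
    show "AE n in measure_pmf P. norm (real n) \<le> norm (1 / \<theta> * exp (\<theta> * real n))"
      using le_exp[OF \<theta>_pos] \<theta>_pos by auto
  qed simp
  then have i: "integrable (measure_pmf P) (\<lambda>n. real n - 1)" by simp
  have pos: "AE n in measure_pmf P. 0 \<le> real n - 1"
    using P_0 by (auto simp: AE_measure_pmf_iff set_pmf_iff Suc_le_eq intro!: gr0I)
  let ?b = "\<lambda>n. ennreal (pmf P n) * ennreal (real n - 1)"
  have "ennreal (measure_pmf.expectation P (\<lambda>n. real n - 1)) = (\<integral>\<^sup>+ n. ennreal (real n - 1) \<partial>measure_pmf P)"
    using nn_integral_eq_integral[OF i pos] by simp
  also have "\<dots> = (\<Sum>n. ?b n)"
    by (subst nn_integral_measure_pmf) (simp add: nn_integral_count_space_nat)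
  \<comment> \<open>Both split-off terms vanish: 0 has no mass, and \<open>n - 1\<close> is zero at
    \<open>n = 1\<close>.\<close>
  also have "\<dots> = (\<Sum>n. ?b (n + 2)) + (\<Sum>n<2. ?b n)"
    by (rule suminf_offset[OF summableI])
  also have "(\<Sum>n<2. ?b n) = 0" using P_0 by (simp add: numeral_2_eq_2)
  finally have E: "ennreal (measure_pmf.expectation P (\<lambda>n. real n - 1)) = (\<Sum>n. ?b (n + 2))" by simp
  have Up: "AE z in U. 0 \<le> z" using AE_upsilon_pos by eventually_elim simp
  have "ennreal (\<integral>z. z \<partial>U) = (\<integral>\<^sup>+ z. ennreal z \<partial>U)"
    using nn_integral_eq_integral[OF integrable_lin_growth[OF lin_growth_id] Up] by simp
  also have "\<dots> = (\<integral>\<^sup>+ z. ennreal (indicator {0..} z * g2 P z) * ennreal z \<partial>lborel)"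
    unfolding upsilon_def by (rule nn_integral_density) auto
  also have "\<dots> = (\<integral>\<^sup>+ z. (\<Sum>j. ennreal (pmf P (j + 2) / fact j) *
        (ennreal (z ^ Suc j * exp (- z)) * indicator {0..} z)) \<partial>lborel)"
  proof (rule nn_integral_cong)
    fix z :: real
    show "ennreal (indicator {0..} z * g2 P z) * ennreal z = (\<Sum>j. ennreal (pmf P (j + 2) / fact j) *
        (ennreal (z ^ Suc j * exp (- z)) * indicator {0..} z))"
    proof (cases "z \<ge> 0")
      case True
      have s: "summable (\<lambda>j. z * exp (- z) * (pmf P (j + 2) * z ^ j / fact j))"
        by (rule summable_mult[OF summable_pmf_exp])
      have "(\<Sum>j. ennreal (pmf P (j + 2) / fact j) * (ennreal (z ^ Suc j * exp (- z)) * indicator {0..} z))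
        = (\<Sum>j. ennreal (z * exp (- z) * (pmf P (j + 2) * z ^ j / fact j)))"
        using True by (intro suminf_cong) (simp add: ennreal_mult[symmetric] mult_ac)
      also have "\<dots> = ennreal (\<Sum>j. z * exp (- z) * (pmf P (j + 2) * z ^ j / fact j))"
        using True by (intro suminf_ennreal2 s) auto
      also have "\<dots> = ennreal (z * g2 P z)"
        by (subst suminf_mult[OF summable_pmf_exp]) (simp add: g2_def mult.assoc)
      finally show ?thesis using True g2_nonneg[OF True] by (simp add: ennreal_mult[symmetric] mult.commute)
    qed simp
  qed
  also have "\<dots> = (\<Sum>j. ennreal (pmf P (j + 2) / fact j) *
        (\<integral>\<^sup>+ z. ennreal (z ^ Suc j * exp (- z)) * indicator {0..} z \<partial>lborel))"
    by (subst nn_integral_suminf) (auto intro!: suminf_cong nn_integral_cmult)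
  also have "\<dots> = (\<Sum>n. ?b (n + 2))"
  proof (rule suminf_cong)
    fix j :: nat
    have "ennreal (pmf P (j + 2) / fact j) * ennreal (real (fact (Suc j))) = ennreal (pmf P (j + 2) * (real j + 1))"
      by (simp add: ennreal_mult[symmetric] field_simps)
    then show "ennreal (pmf P (j + 2) / fact j) *
        (\<integral>\<^sup>+ z. ennreal (z ^ Suc j * exp (- z)) * indicator {0..} z \<partial>lborel) = ?b (j + 2)"
      by (subst nn_intergal_power_times_exp_Ici) (simp add: ennreal_mult[symmetric] algebra_simps)
  qed
  finally have "ennreal (\<integral>z. z \<partial>U) = ennreal (measure_pmf.expectation P (\<lambda>n. real n - 1))"
    using E by simp
  moreover have "0 \<le> (\<integral>z. z \<partial>U)" using Up by (rule integral_nonneg_AE)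
  moreover have "0 \<le> measure_pmf.expectation P (\<lambda>n. real n - 1)" using pos by (rule integral_nonneg_AE)
  ultimately show ?thesis using \<open>integrable (measure_pmf P) (\<lambda>n. real n)\<close> by simp
qed

section \<open>The series \<open>L\<close>\<close>

lemma lin_growth_pos_part: "lin_growth (\<lambda>z. max (z - x) 0)"
proof (rule lin_growthI[where C = "1 + \<bar>x\<bar>"])
  fix z :: real assume "z > 0"
  moreover from this have "0 \<le> \<bar>x\<bar> * z" by simp
  moreover have "(1 + \<bar>x\<bar>) * (1 + z) = 1 + z + \<bar>x\<bar> + \<bar>x\<bar> * z" by (simp add: algebra_simps)
  ultimately show "\<bar>max (z - x) 0\<bar> \<le> (1 + \<bar>x\<bar>) * (1 + z)" by linarith
qed measurable

text \<open>By Fubini the point \<open>z\<close> is counted by all \<open>y\<close> between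
  \<open>x\<close> and \<open>z\<close>, a set of length \<open>max (z - x) 0\<close>. Hence the
  recursion for \<open>G\<close> iterates one nonnegative kernel.\<close>

lemma double_tail_integral:
  assumes \<phi>: "lin_growth \<phi>" and x: "x \<ge> 0"
  shows "(LBINT y:{x..}. (LBINT z:{y..}. g2 P z * \<phi> z)) = (\<integral>z. max (z - x) 0 * \<phi> z \<partial>U)"
proof -
  have [measurable]: "\<phi> \<in> borel_measurable borel" by (rule lin_growth_measurable[OF \<phi>])
  let ?k = "\<lambda>(z, y). indicator {x..z} y * (g2 P z * \<phi> z)"
  have ind: "indicator {x..z} y = (if x \<le> y \<and> y \<le> z then 1 else 0 :: real)" for y z
    by (auto simp: indicator_def)
  have [measurable]: "?k \<in> borel_measurable (lborel \<Otimes>\<^sub>M lborel)"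
    unfolding ind by measurable
  have len: "(\<integral>y. indicator {x..z} y \<partial>lborel) = max (z - x) 0" for z
    by (cases "x \<le> z") (auto simp: max_def)
  have "integrable U (\<lambda>z. max (z - x) 0 * \<bar>\<phi> z\<bar>)"
    by (rule integrable_lin_growth_mult[OF lin_growth_pos_part lin_growth_abs[OF \<phi>]])
  then have i: "set_integrable lborel {0..} (\<lambda>z. g2 P z * (max (z - x) 0 * \<bar>\<phi> z\<bar>))"
    by (subst (asm) integrable_upsilon) measurable
  have k: "integrable (lborel \<Otimes>\<^sub>M lborel) ?k"
  proof (rule lborel_pair.Fubini_integrable)
    have "(\<integral>y. norm (?k (z, y)) \<partial>lborel) = indicator {0..} z *\<^sub>R (g2 P z * (max (z - x) 0 * \<bar>\<phi> z\<bar>))" for z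
    proof -
      have "(\<integral>y. norm (?k (z, y)) \<partial>lborel) = (\<integral>y. indicator {x..z} y * \<bar>g2 P z * \<phi> z\<bar> \<partial>lborel)"
        by (simp add: abs_mult)
      also have "\<dots> = max (z - x) 0 * \<bar>g2 P z * \<phi> z\<bar>" by (simp add: len)
      also have "\<dots> = indicator {0..} z *\<^sub>R (g2 P z * (max (z - x) 0 * \<bar>\<phi> z\<bar>))"
        using x g2_nonneg[of z] by (auto simp: indicator_def abs_mult)
      finally show ?thesis .
    qed
    then show "integrable lborel (\<lambda>z. \<integral>y. norm (?k (z, y)) \<partial>lborel)"
      using i by (simp add: set_integrable_def)
    show "AE z in lborel. integrable lborel (\<lambda>y. ?k (z, y))"
      by (auto intro!: AE_I2 integrable_mult_left integrable_real_indicator simp: emeasure_lborel_Icc_eq)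
  qed fact
  have "(LBINT y:{x..}. (LBINT z:{y..}. g2 P z * \<phi> z)) = (\<integral>y. (\<integral>z. ?k (z, y) \<partial>lborel) \<partial>lborel)"
    unfolding set_lebesgue_integral_def
  proof (rule Bochner_Integration.integral_cong[OF refl])
    fix y :: real
    show "indicator {x..} y *\<^sub>R (\<integral>z. indicator {y..} z *\<^sub>R (g2 P z * \<phi> z) \<partial>lborel) = (\<integral>z. ?k (z, y) \<partial>lborel)"
      unfolding scaleR_conv_of_real integral_mult_right_zero[symmetric]
      by (intro Bochner_Integration.integral_cong) (auto simp: indicator_def)
  qed
  also have "\<dots> = (\<integral>z. (\<integral>y. ?k (z, y) \<partial>lborel) \<partial>lborel)"
    using lborel_pair.Fubini_integral[of "\<lambda>z y. ?k (z, y)"] k by simp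
  also have "\<dots> = (LBINT z:{0..}. g2 P z * (max (z - x) 0 * \<phi> z))"
    unfolding set_lebesgue_integral_def
  proof (rule Bochner_Integration.integral_cong[OF refl])
    fix z :: real
    have "(\<integral>y. ?k (z, y) \<partial>lborel) = (\<integral>y. indicator {x..z} y \<partial>lborel) * (g2 P z * \<phi> z)" by simp
    also have "\<dots> = indicator {0..} z *\<^sub>R (g2 P z * (max (z - x) 0 * \<phi> z))"
      unfolding len using x by (auto simp: indicator_def max_def)
    finally show "(\<integral>y. ?k (z, y) \<partial>lborel) = indicator {0..} z *\<^sub>R (g2 P z * (max (z - x) 0 * \<phi> z))" .
  qed
  also have "\<dots> = (\<integral>z. max (z - x) 0 * \<phi> z \<partial>U)"
    by (rule integral_upsilon[symmetric]) measurable
  finally show ?thesis .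
qed

lemma G_measurable [measurable]: "G P i \<in> borel_measurable borel"
proof (induction i)
  case (Suc i)
  note [measurable] = Suc
  have ind: "indicator {x..} y = (if x \<le> y then 1 else 0 :: real)" for x y
    by (auto simp: indicator_def)
  show ?case unfolding G.simps set_lebesgue_integral_def ind by measurable
qed simp

lemma tail_small:
  assumes "\<epsilon> > 0"
  obtains R where "R \<ge> 0" "(\<integral>z. z * indicator {R..} z \<partial>U) < \<epsilon>"
proof -
  have "(\<lambda>n. \<integral>z. z * indicator {real n..} z \<partial>U) \<longlonglongrightarrow> (\<integral>z. 0 \<partial>U)"
  proof (rule integral_dominated_convergence[where w = "\<lambda>z. \<bar>z\<bar>"])
    show "integrable U (\<lambda>z. \<bar>z\<bar>)" by (rule integrable_lin_growth[OF lin_growth_abs[OF lin_growth_id]])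
    show "AE z in U. (\<lambda>n. z * indicator {real n..} z) \<longlonglongrightarrow> 0"
    proof (rule AE_I2, rule tendsto_eventually)
      fix z :: real
      obtain N where "z < real N" using reals_Archimedean2 by blast
      then show "eventually (\<lambda>n. z * indicator {real n..} z = 0) sequentially"
        by (intro eventually_sequentiallyI[of N]) (auto simp: indicator_def)
    qed
  qed (auto simp: indicator_def)
  then have "eventually (\<lambda>n. (\<integral>z. z * indicator {real n..} z \<partial>U) < \<epsilon>) sequentially"
    using assms by (intro order_tendstoD) auto
  then obtain n where "(\<integral>z. z * indicator {real n..} z \<partial>U) < \<epsilon>"
    by (auto simp: eventually_sequentially)
  then show thesis by (intro that[of "real n"]) auto
qed

text \<open>
  The weight \<open>w\<close> is a supersolution: \<open>\<integral> (z - x)\<^sup>+ w z U(dz) \<le> \<epsilon> w x\<close>.  Hence the coefficients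
  \<open>G P i\<close> decay faster than any geometric sequence and \<open>L P \<beta>\<close> is entire in \<open>1 / \<beta>\<close>.
\<close>
lemma G_decay:
  assumes "\<epsilon> > 0"
  shows "\<exists>C>0. \<forall>i. \<forall>x\<ge>0. 0 \<le> G P i x \<and> G P i x \<le> C * \<epsilon> ^ i"
proof -
  obtain R where R: "R \<ge> 0" "(\<integral>z. z * indicator {R..} z \<partial>U) < \<epsilon> / 2"
    using tail_small[of "\<epsilon> / 2"] assms by auto
  define M where "M = measure U (space U)"
  \<comment> \<open>On \<open>z < R\<close> the exponential in \<open>w\<close> and the bound
    \<open>z - x \<le> exp (r * (z - x)) / r\<close> multiply to a quantity free of
    \<open>z\<close>, and \<open>r\<close> is so large that its integral is at most
    \<open>\<epsilon> * exp (r * (R - x))\<close>. Beyond \<open>R\<close> the weight is at most 2,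
    matched by the tail \<open>\<epsilon> / 2\<close>. The summand 1 keeps \<open>r\<close>
    positive.\<close>
  define r where "r = 2 * (M + 1) / \<epsilon>"
  have M: "0 \<le> M" by (simp add: M_def)
  then have r: "0 < r" using assms by (simp add: r_def)
  define w where "w = (\<lambda>x. 1 + exp (r * (R - x)))"
  have w_le: "w x \<le> 1 + exp (r * R)" if "x \<ge> 0" for x
    using that r by (simp add: w_def)
  have w_pos: "0 < w x" for x by (simp add: w_def add_pos_pos)
  have w_lin: "lin_growth w"
    by (rule lin_growth_bounded[where C = "1 + exp (r * R)"])
      (use w_le w_pos in \<open>auto simp: w_def abs_of_pos\<close>)
  have super: "(\<integral>z. max (z - x) 0 * w z \<partial>U) \<le> \<epsilon> * w x" if x: "x \<ge> 0" for x
  proof -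
    let ?A = "2 * exp (r * (R - x)) / r"
    have ii: "integrable U (\<lambda>z. z * indicator {R..} z)"
      using integrable_lin_growth[OF lin_growth_id] by (simp add: integrable_real_mult_indicator)
    have "(\<integral>z. max (z - x) 0 * w z \<partial>U) \<le> (\<integral>z. ?A + 2 * (z * indicator {R..} z) \<partial>U)"
    proof (rule integral_mono_AE)
      show "integrable U (\<lambda>z. max (z - x) 0 * w z)"
        by (rule integrable_lin_growth_mult[OF lin_growth_pos_part w_lin])
      show "integrable U (\<lambda>z. ?A + 2 * (z * indicator {R..} z))" using ii by simp
      show "AE z in U. max (z - x) 0 * w z \<le> ?A + 2 * (z * indicator {R..} z)"
        using AE_pos
      proof eventually_elim
        case (elim z)
        consider "z \<le> x" | "x < z" "z < R" | "x < z" "R \<le> z" by linarith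
        then show ?case
        proof cases
          case 1
          then show ?thesis using elim r by (auto simp: indicator_def add_nonneg_nonneg)
        next
          case 2
          have "1 \<le> exp (r * (R - z))" using 2 r by simp
          then have "w z \<le> 2 * exp (r * (R - z))" by (simp add: w_def)
          moreover have "z - x \<le> 1 / r * exp (r * (z - x))" by (rule le_exp[OF r])
          ultimately have "(z - x) * w z \<le> (1 / r * exp (r * (z - x))) * (2 * exp (r * (R - z)))"
            using 2 r w_pos[of z] by (intro mult_mono) auto
          also have "\<dots> = 2 * (exp (r * (z - x)) * exp (r * (R - z))) / r" by simp
          also have "exp (r * (z - x)) * exp (r * (R - z)) = exp (r * (R - x))"
            by (simp add: exp_add[symmetric] algebra_simps)
          finally show ?thesis using 2 by simp
        next
          case 3
          have "exp (r * (R - z)) \<le> 1" using 3 r by (simp add: mult_le_0_iff)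
          then have "w z \<le> 2" by (simp add: w_def)
          then have "(z - x) * w z \<le> z * 2" using 3 x elim w_pos[of z] by (intro mult_mono) auto
          moreover have "0 \<le> ?A" using r by simp
          ultimately show ?thesis using 3 by simp
        qed
      qed
    qed
    also have "\<dots> = M * ?A + 2 * (\<integral>z. z * indicator {R..} z \<partial>U)"
      using ii by (simp add: M_def)
    also have "\<dots> \<le> \<epsilon> * exp (r * (R - x)) + \<epsilon>"
    proof (rule add_mono)
      have "2 * M / r \<le> \<epsilon>" using M assms by (simp add: r_def field_simps)
      then have "2 * M / r * exp (r * (R - x)) \<le> \<epsilon> * exp (r * (R - x))" by (intro mult_right_mono) auto
      then show "M * ?A \<le> \<epsilon> * exp (r * (R - x))" by (simp add: mult_ac)
    qed (use R in simp)
    also have "\<dots> = \<epsilon> * w x" by (simp add: w_def algebra_simps)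
    finally show ?thesis .
  qed
  have G: "\<forall>x\<ge>0. 0 \<le> G P i x \<and> G P i x \<le> \<epsilon> ^ i * w x" for i
  proof (induction i)
    case 0
    then show ?case by (simp add: w_def)
  next
    case (Suc i)
    have lin: "lin_growth (G P i)"
    proof (rule lin_growth_bounded[where C = "\<epsilon> ^ i * (1 + exp (r * R))"])
      fix x :: real assume x: "x > 0"
      have "\<epsilon> ^ i * w x \<le> \<epsilon> ^ i * (1 + exp (r * R))"
        using x assms w_le[of x] by (intro mult_left_mono) auto
      moreover have "0 \<le> G P i x" "G P i x \<le> \<epsilon> ^ i * w x" using Suc x by auto
      ultimately show "\<bar>G P i x\<bar> \<le> \<epsilon> ^ i * (1 + exp (r * R))" by linarith
    qed measurable
    show ?case
    proof (intro allI impI conjI)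
      fix x :: real assume x: "x \<ge> 0"
      have eq: "G P (Suc i) x = (\<integral>z. max (z - x) 0 * G P i z \<partial>U)"
        unfolding G.simps by (rule double_tail_integral[OF lin x])
      show "0 \<le> G P (Suc i) x" unfolding eq
      proof (rule integral_nonneg_AE)
        show "AE z in U. 0 \<le> max (z - x) 0 * G P i z"
          using AE_pos by eventually_elim (use Suc.IH in simp)
      qed
      have "(\<integral>z. max (z - x) 0 * G P i z \<partial>U) \<le> (\<integral>z. \<epsilon> ^ i * (max (z - x) 0 * w z) \<partial>U)"
      proof (rule integral_mono_AE)
        show "integrable U (\<lambda>z. max (z - x) 0 * G P i z)"
          by (rule integrable_lin_growth_mult[OF lin_growth_pos_part lin])
        show "integrable U (\<lambda>z. \<epsilon> ^ i * (max (z - x) 0 * w z))"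
          using integrable_lin_growth_mult[OF lin_growth_pos_part w_lin] by simp
        show "AE z in U. max (z - x) 0 * G P i z \<le> \<epsilon> ^ i * (max (z - x) 0 * w z)"
          using AE_pos
        proof eventually_elim
          case (elim z)
          have "max (z - x) 0 * G P i z \<le> max (z - x) 0 * (\<epsilon> ^ i * w z)"
            using Suc elim by (intro mult_left_mono) auto
          then show ?case by (simp add: mult_ac)
        qed
      qed
      also have "\<dots> = \<epsilon> ^ i * (\<integral>z. max (z - x) 0 * w z \<partial>U)" by simp
      also have "\<dots> \<le> \<epsilon> ^ i * (\<epsilon> * w x)" using super[OF x] assms by (intro mult_left_mono) auto
      finally show "G P (Suc i) x \<le> \<epsilon> ^ Suc i * w x" unfolding eq by (simp add: mult_ac)
    qed
  qed
  show ?thesis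
  proof (intro exI[of _ "1 + exp (r * R)"] conjI allI impI)
    show "0 < 1 + exp (r * R)" by (simp add: add_pos_pos)
    fix i and x :: real assume x: "x \<ge> 0"
    then show "0 \<le> G P i x" using G by blast
    have "\<epsilon> ^ i * w x \<le> \<epsilon> ^ i * (1 + exp (r * R))"
      using x assms w_le[of x] by (intro mult_left_mono) auto
    moreover have "G P i x \<le> \<epsilon> ^ i * w x" using G x by blast
    ultimately show "G P i x \<le> (1 + exp (r * R)) * \<epsilon> ^ i" by (simp add: mult.commute)
  qed
qed

lemma lin_growth_G: "lin_growth (G P i)"
proof -
  obtain C where C: "\<And>i x. x \<ge> 0 \<Longrightarrow> 0 \<le> G P i x \<and> G P i x \<le> C * 1 ^ i"
    using G_decay[OF zero_less_one] by blast
  show ?thesis using C[of _ i] by (intro lin_growth_bounded[where C = C]) auto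
qed

lemma G_Suc: "x \<ge> 0 \<Longrightarrow> G P (Suc i) x = (\<integral>z. max (z - x) 0 * G P i z \<partial>U)"
  unfolding G.simps by (rule double_tail_integral[OF lin_growth_G])

text \<open>Decay of \<open>G\<close> at ratio \<open>b / 2\<close>, against \<open>1 / b\<close>,
  leaves the ratio one half, uniformly in \<open>x\<close>.\<close>

lemma L_terms:
  assumes "b > 0"
  shows "\<exists>C>0. \<forall>i. \<forall>x\<ge>0. \<bar>G P i x * (- 1 / b) ^ i\<bar> \<le> C * (1 / 2) ^ i"
proof -
  obtain C where C: "C > 0" "\<And>i x. x \<ge> 0 \<Longrightarrow> 0 \<le> G P i x \<and> G P i x \<le> C * (b / 2) ^ i"
    using G_decay[OF divide_pos_pos[OF assms zero_less_numeral]] by blast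
  show ?thesis
  proof (intro exI[of _ C] conjI allI impI)
    fix i and x :: real assume "x \<ge> 0"
    then have G: "0 \<le> G P i x" "G P i x \<le> C * (b / 2) ^ i" using C(2)[of x i] by simp_all
    have "\<bar>- 1 / b\<bar> = 1 / b" using assms by simp
    then have "\<bar>G P i x * (- 1 / b) ^ i\<bar> = G P i x * (1 / b) ^ i"
      by (simp only: abs_mult power_abs abs_of_nonneg[OF G(1)])
    also have "\<dots> \<le> C * (b / 2) ^ i * (1 / b) ^ i"
      using G(2) assms by (intro mult_right_mono) auto
    also have "\<dots> = C * (1 / 2) ^ i" using assms by (simp add: power_divide)
    finally show "\<bar>G P i x * (- 1 / b) ^ i\<bar> \<le> C * (1 / 2) ^ i" .
  qed (rule C(1))
qed

lemma summable_L:
  assumes "b > 0" "x \<ge> 0" shows "summable (\<lambda>i. \<bar>G P i x * (- 1 / b) ^ i\<bar>)"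
proof -
  obtain C where "C > 0" and C': "\<forall>i. \<forall>x\<ge>0. \<bar>G P i x * (- 1 / b) ^ i\<bar> \<le> C * (1 / 2) ^ i"
    using L_terms[OF assms(1)] by (elim exE conjE)
  note C = C'[rule_format]
  show ?thesis
  proof (rule summable_comparison_test')
    show "summable (\<lambda>i. C * (1 / 2) ^ i)" by (intro summable_mult summable_geometric) simp
    show "norm \<bar>G P i x * (- 1 / b) ^ i\<bar> \<le> C * (1 / 2) ^ i" for i
      using C[OF assms(2), of i] by (simp only: real_norm_def abs_abs)
  qed
qed

lemma L_measurable [measurable]: "L P b \<in> borel_measurable borel"
  unfolding L_def[abs_def] by measurable

lemma L_bounded:
  assumes "b > 0" shows "\<exists>C. \<forall>x\<ge>0. \<bar>L P b x\<bar> \<le> C"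
proof -
  obtain C where "C > 0" and C': "\<forall>i. \<forall>x\<ge>0. \<bar>G P i x * (- 1 / b) ^ i\<bar> \<le> C * (1 / 2) ^ i"
    using L_terms[OF assms(1)] by (elim exE conjE)
  note C = C'[rule_format]
  have "\<bar>L P b x\<bar> \<le> (\<Sum>i. C * (1 / 2) ^ i)" if "x \<ge> 0" for x
  proof -
    have "\<bar>L P b x\<bar> \<le> (\<Sum>i. \<bar>G P i x * (- 1 / b) ^ i\<bar>)"
      unfolding L_def by (rule summable_rabs[OF summable_L[OF assms that]])
    also have "\<dots> \<le> (\<Sum>i. C * (1 / 2) ^ i)"
      by (intro suminf_le C that summable_L assms summable_mult summable_geometric) auto
    finally show ?thesis .
  qed
  then show ?thesis by blast
qed

lemma lin_growth_L: assumes "b > 0" shows "lin_growth (L P b)"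
proof -
  obtain C where "\<And>x. x \<ge> 0 \<Longrightarrow> \<bar>L P b x\<bar> \<le> C" using L_bounded[OF assms] by blast
  then show ?thesis by (intro lin_growth_bounded[where C = C]) auto
qed

text \<open>The recursion \<open>G_Suc\<close> is summed, with one factor \<open>- 1 / b\<close>
  absorbed by the index shift. The result is the integrated form of
  \<open>b * L'' = - g2 * L\<close> with limit 1 at infinity.\<close>

lemma L_eq:
  assumes b: "b > 0" and x: "x \<ge> 0"
  shows "L P b x = 1 - (\<integral>z. max (z - x) 0 * L P b z \<partial>U) / b"
proof -
  obtain C where "C > 0" and C': "\<forall>i. \<forall>x\<ge>0. \<bar>G P i x * (- 1 / b) ^ i\<bar> \<le> C * (1 / 2) ^ i"
    using L_terms[OF b] by (elim exE conjE)
  note C = C'[rule_format]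
  let ?t = "\<lambda>i z. G P i z * (- 1 / b) ^ i" and ?m = "\<lambda>z. max (z - x) 0"
  have int: "integrable U (\<lambda>z. ?m z * ?t i z)" for i
    by (intro integrable_lin_growth_mult lin_growth_pos_part)
      (use lin_growth_scale[OF lin_growth_G, of "(- 1 / b) ^ i"] in \<open>simp add: mult.commute\<close>)
  have "(\<integral>z. ?m z * L P b z \<partial>U) = (\<integral>z. (\<Sum>i. ?m z * ?t i z) \<partial>U)"
  proof (rule integral_cong_AE)
    show "AE z in U. ?m z * L P b z = (\<Sum>i. ?m z * ?t i z)"
      using AE_pos
    proof eventually_elim
      case (elim z)
      then have "summable (\<lambda>i. ?t i z)" by (intro summable_rabs_cancel[OF summable_L[OF b]]) simp
      then show ?case unfolding L_def by (rule suminf_mult[symmetric])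
    qed
  qed measurable
  also have "\<dots> = (\<Sum>i. \<integral>z. ?m z * ?t i z \<partial>U)"
  proof (rule integral_suminf[OF int])
    show "AE z in U. summable (\<lambda>i. norm (?m z * ?t i z))"
      using AE_pos
    proof eventually_elim
      case (elim z)
      have "summable (\<lambda>i. \<bar>?m z\<bar> * \<bar>?t i z\<bar>)"
        using elim by (intro summable_mult summable_L b) auto
      then show ?case by (simp add: abs_mult)
    qed
    show "summable (\<lambda>i. \<integral>z. norm (?m z * ?t i z) \<partial>U)"
    proof (rule summable_comparison_test')
      show "summable (\<lambda>i. (C * (\<integral>z. ?m z \<partial>U)) * (1 / 2) ^ i)"
        by (intro summable_mult summable_geometric) auto
      fix i :: nat
      have "(\<integral>z. norm (?m z * ?t i z) \<partial>U) \<le> (\<integral>z. (C * (1 / 2) ^ i) * ?m z \<partial>U)"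
      proof (rule integral_mono_AE)
        show "integrable U (\<lambda>z. norm (?m z * ?t i z))" by (rule integrable_norm[OF int])
        show "integrable U (\<lambda>z. (C * (1 / 2) ^ i) * ?m z)"
          by (intro integrable_mult_right impI integrable_lin_growth lin_growth_pos_part)
        show "AE z in U. norm (?m z * ?t i z) \<le> (C * (1 / 2) ^ i) * ?m z"
          using AE_pos
        proof eventually_elim
          case (elim z)
          have "?m z * \<bar>?t i z\<bar> \<le> ?m z * (C * (1 / 2) ^ i)"
            using elim by (intro mult_left_mono C) auto
          then show ?case by (simp add: abs_mult mult.commute)
        qed
      qed
      then show "norm (\<integral>z. norm (?m z * ?t i z) \<partial>U) \<le> (C * (\<integral>z. ?m z \<partial>U)) * (1 / 2) ^ i"
        by (simp add: mult_ac)
    qed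
  qed
  also have "\<dots> = (\<Sum>i. - b * ?t (Suc i) x)"
  proof (rule suminf_cong)
    fix i
    have "(\<integral>z. ?m z * ?t i z \<partial>U) = (\<integral>z. ?m z * G P i z \<partial>U) * (- 1 / b) ^ i"
      by (subst integral_mult_left_zero[symmetric]) (simp add: mult.assoc)
    also have "\<dots> = - b * ?t (Suc i) x" using b by (simp only: G_Suc[OF x]) simp
    finally show "(\<integral>z. ?m z * ?t i z \<partial>U) = - b * ?t (Suc i) x" .
  qed
  also have "\<dots> = - b * (L P b x - 1)"
  proof -
    have s: "summable (\<lambda>i. ?t i x)" using summable_L[OF b x] by (rule summable_rabs_cancel)
    have "(\<Sum>i. ?t (Suc i) x) = L P b x - 1"
      using suminf_split_head[OF s] by (simp add: L_def)
    moreover have "summable (\<lambda>i. ?t (Suc i) x)" using s by (rule summable_Suc_iff[THEN iffD2])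
    ultimately show ?thesis using suminf_mult[of "\<lambda>i. ?t (Suc i) x" "- b"] by simp
  qed
  finally show ?thesis using b by (simp add: field_simps)
qed

text \<open>Uniformity in \<open>x\<close> lets the supremum argument compare signs at all points at
  once. Apart from \<open>(- 1) ^ i\<close> each term of the difference has a fixed sign, so
  absolute values are dominated by the difference of two geometric series with explicit
  sums.\<close>

lemma L_uniformly_continuous:
  assumes b: "b > 0" and e: "e > 0"
  shows "\<exists>d>0. \<forall>b'>0. \<bar>b' - b\<bar> < d \<longrightarrow> (\<forall>x\<ge>0. \<bar>L P b' x - L P b x\<bar> < e)"
proof -
  \<comment> \<open>For parameters above \<open>b / 2\<close> both geometric ratios stay below one
    half.\<close>
  let ?q = "b / 4"
  obtain C where C: "C > 0" "\<And>i x. x \<ge> 0 \<Longrightarrow> 0 \<le> G P i x \<and> G P i x \<le> C * ?q ^ i"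
    using G_decay[OF divide_pos_pos[OF b zero_less_numeral]] by blast
  have diff: "\<bar>L P s x - L P t x\<bar> \<le> C * (1 / (1 - ?q / s) - 1 / (1 - ?q / t))"
    if "b / 2 < s" "s \<le> t" "x \<ge> 0" for s t x
  proof -
    have st: "0 < s" "0 < t" "?q / t \<le> ?q / s" "?q / s < 1" "?q / t < 1" using that b
      by (auto simp: field_simps)
    have S: "summable (\<lambda>i. G P i x * (- 1 / c) ^ i)" if "c > 0" for c
      using summable_L[OF that \<open>x \<ge> 0\<close>] by (rule summable_rabs_cancel)
    have T: "(\<lambda>i. C * ((?q / s) ^ i - (?q / t) ^ i)) sums (C * (1 / (1 - ?q / s) - 1 / (1 - ?q / t)))"
      using st b by (intro sums_mult sums_diff geometric_sums) auto
    have le: "\<bar>G P i x * (- 1 / s) ^ i - G P i x * (- 1 / t) ^ i\<bar> \<le> C * ((?q / s) ^ i - (?q / t) ^ i)" for i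
    proof -
      have mon: "(1 / t) ^ i \<le> (1 / s) ^ i" using st that by (intro power_mono) (auto simp: field_simps)
      have p: "(- 1 / c) ^ i = (- 1) ^ i * (1 / c) ^ i" for c :: real
        by (subst power_mult_distrib[symmetric]) simp
      have "G P i x * (- 1 / s) ^ i - G P i x * (- 1 / t) ^ i = (- 1) ^ i * (G P i x * ((1 / s) ^ i - (1 / t) ^ i))"
        unfolding p by (simp only: right_diff_distrib mult.left_commute)
      then have "\<bar>G P i x * (- 1 / s) ^ i - G P i x * (- 1 / t) ^ i\<bar> = G P i x * ((1 / s) ^ i - (1 / t) ^ i)"
        using C(2)[OF \<open>x \<ge> 0\<close>, of i] mon by (simp add: abs_mult)
      also have "\<dots> \<le> C * ?q ^ i * ((1 / s) ^ i - (1 / t) ^ i)"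
        using C(2)[OF \<open>x \<ge> 0\<close>, of i] mon by (intro mult_right_mono) auto
      also have "\<dots> = C * ((?q / s) ^ i - (?q / t) ^ i)"
        by (simp add: power_divide right_diff_distrib)
      finally show ?thesis .
    qed
    have sa: "summable (\<lambda>i. \<bar>G P i x * (- 1 / s) ^ i - G P i x * (- 1 / t) ^ i\<bar>)"
      by (rule summable_comparison_test'[OF sums_summable[OF T]]) (use le in simp)
    have "\<bar>L P s x - L P t x\<bar> = \<bar>\<Sum>i. G P i x * (- 1 / s) ^ i - G P i x * (- 1 / t) ^ i\<bar>"
      unfolding L_def using suminf_diff[OF S[OF st(1)] S[OF st(2)]] by simp
    also have "\<dots> \<le> (\<Sum>i. \<bar>G P i x * (- 1 / s) ^ i - G P i x * (- 1 / t) ^ i\<bar>)"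
      by (rule summable_rabs[OF sa])
    also have "\<dots> \<le> (\<Sum>i. C * ((?q / s) ^ i - (?q / t) ^ i))"
      by (rule suminf_le[OF le sa sums_summable[OF T]])
    also have "\<dots> = C * (1 / (1 - ?q / s) - 1 / (1 - ?q / t))" using T by (rule sums_unique[symmetric])
    finally show ?thesis .
  qed
  let ?h = "\<lambda>s. C * (1 / (1 - ?q / s))"
  have "isCont ?h b" using b by (intro continuous_intros) auto
  then obtain d where d: "d > 0" "\<And>s. \<bar>s - b\<bar> < d \<Longrightarrow> \<bar>?h s - ?h b\<bar> < e"
    using e unfolding continuous_at_eps_delta by (metis dist_real_def)
  show ?thesis
  proof (intro exI[of _ "min d (b / 2)"] conjI allI impI)
    fix s x :: real assume s: "\<bar>s - b\<bar> < min d (b / 2)" and x: "x \<ge> 0"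
    have h: "\<bar>?h s - ?h b\<bar> < e" by (rule d(2)) (use s in simp)
    have "\<bar>L P s x - L P b x\<bar> \<le> \<bar>?h s - ?h b\<bar>"
    proof (cases "s \<le> b")
      case True
      then show ?thesis using diff[of s b x] s x b by (auto simp: right_diff_distrib abs_le_iff)
    next
      case False
      then show ?thesis using diff[of b s x] s x b by (auto simp: right_diff_distrib abs_le_iff abs_minus_commute)
    qed
    then show "\<bar>L P s x - L P b x\<bar> < e" using h by linarith
  qed (use d b in auto)
qed

section \<open>The largest zero \<open>\<beta>\<^sub>0\<close>\<close>

lemma not_AE_upsilon:
  assumes "0 \<le> a" "a < c" shows "\<not> (AE z in U. z \<notin> {a<..<c})"
proof
  assume "AE z in U. z \<notin> {a<..<c}"
  then have "AE z in lborel. 0 < z \<longrightarrow> z \<notin> {a<..<c}" by (rule AE_upsilonD)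
  then have "AE z in lborel. z \<notin> {a<..<c}" by eventually_elim (use assms in auto)
  then have "emeasure lborel {a<..<c} = 0" by (subst (asm) AE_iff_measurable[of "{a<..<c}"]) auto
  then show False using assms by simp
qed

lemma measure_atLeast_pos: assumes "0 \<le> a" shows "0 < measure U {a..}"
proof (rule ccontr)
  assume "\<not> ?thesis"
  then have "emeasure U {a..} = 0"
    using measure_nonneg[of U "{a..}"] by (simp add: emeasure_eq_measure)
  then have "{a..} \<in> null_sets U" by (simp add: null_sets_def sets_upsilon)
  then have "AE z in U. z \<notin> {a..}" by (rule AE_not_in)
  then have "AE z in U. z \<notin> {a<..<a + 1}" by eventually_elim auto
  then show False using not_AE_upsilon[OF assms, of "a + 1"] by simp
qed

lemma L_diff:
  assumes b: "b > 0" and xy: "0 \<le> x" "0 \<le> y"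
  shows "L P b x - L P b y = (\<integral>z. (max (z - y) 0 - max (z - x) 0) * L P b z \<partial>U) / b"
  using integrable_lin_growth_mult[OF lin_growth_pos_part lin_growth_L[OF b]]
  by (simp add: L_eq[OF b xy(1)] L_eq[OF b xy(2)] left_diff_distrib diff_divide_distrib)

lemma L_mono_of_nonneg:
  assumes b: "b > 0" and nn: "\<And>z. z > 0 \<Longrightarrow> 0 \<le> L P b z" and xy: "0 \<le> x" "x \<le> y"
  shows "L P b x \<le> L P b y"
proof -
  have "0 \<le> (\<integral>z. (max (z - x) 0 - max (z - y) 0) * L P b z \<partial>U)"
  proof (rule integral_nonneg_AE)
    show "AE z in U. 0 \<le> (max (z - x) 0 - max (z - y) 0) * L P b z"
      using AE_pos by eventually_elim (use nn xy in auto)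
  qed
  then have "0 \<le> (\<integral>z. (max (z - x) 0 - max (z - y) 0) * L P b z \<partial>U) / b"
    using b by simp
  then show ?thesis using L_diff[OF b, of y x] xy by linarith
qed

lemma L_large:
  "\<exists>N>0. \<forall>b\<ge>N. \<forall>x\<ge>0. 0 < L P b x"
proof -
  obtain C where C: "C > 0" "\<And>i x. x \<ge> 0 \<Longrightarrow> 0 \<le> G P i x \<and> G P i x \<le> C * 1 ^ i"
    using G_decay[OF zero_less_one] by blast
  \<comment> \<open>The terms with \<open>i \<ge> 1\<close> are at most \<open>C / b ^ i\<close>,
    with sum \<open>C / (b - 1)\<close>; from \<open>b = C + 2\<close> on this is below 1.\<close>
  show ?thesis
  proof (intro exI[of _ "C + 2"] conjI allI impI)
    fix b x :: real assume b: "C + 2 \<le> b" and x: "x \<ge> 0"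
    have b0: "b > 1" using b C by linarith
    let ?t = "\<lambda>i. G P i x * (- 1 / b) ^ i"
    have sa: "summable (\<lambda>i. \<bar>?t i\<bar>)" by (rule summable_L) (use b0 x in auto)
    then have s: "summable ?t" by (rule summable_rabs_cancel)
    have sa1: "summable (\<lambda>i. \<bar>?t (Suc i)\<bar>)" using sa by (rule summable_Suc_iff[THEN iffD2])
    have g: "(\<lambda>i. C * (1 / b) * (1 / b) ^ i) sums (C * (1 / b) * (1 / (1 - 1 / b)))"
      using b0 by (intro sums_mult geometric_sums) auto
    have "\<bar>L P b x - 1\<bar> = \<bar>\<Sum>i. ?t (Suc i)\<bar>"
      using suminf_split_head[OF s] by (simp add: L_def)
    also have "\<dots> \<le> (\<Sum>i. \<bar>?t (Suc i)\<bar>)" by (rule summable_rabs[OF sa1])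
    also have "\<dots> \<le> (\<Sum>i. C * (1 / b) * (1 / b) ^ i)"
    proof (rule suminf_le[OF _ sa1 sums_summable[OF g]])
      fix i
      have "\<bar>- 1 / b\<bar> = 1 / b" using b0 by simp
      then have "\<bar>?t (Suc i)\<bar> = \<bar>G P (Suc i) x\<bar> * (1 / b) ^ Suc i"
        by (simp only: abs_mult power_abs)
      also have "\<dots> \<le> C * (1 / b) ^ Suc i"
        using C(2)[OF x, of "Suc i"] b0 by (intro mult_right_mono) auto
      finally show "\<bar>?t (Suc i)\<bar> \<le> C * (1 / b) * (1 / b) ^ i" by simp
    qed
    also have "\<dots> = C / (b - 1)" using sums_unique[OF g] b0 by (simp add: field_simps)
    also have "\<dots> < 1" using b b0 by (simp add: field_simps)
    finally show "0 < L P b x" by linarith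
  qed (use C in simp)
qed

lemma L_nonpos_ex: "\<exists>b>0. \<exists>x\<ge>0. L P b x \<le> 0"
proof (rule ccontr)
  assume no: "\<not> ?thesis"
  \<comment> \<open>If \<open>L P b\<close> is positive, hence nondecreasing, then
    \<open>b * (L P b 1 - L P b 0)\<close> is at least \<open>measure U {1..} * L P b 1\<close>,
    which is absurd for \<open>b\<close> below that measure.\<close>
  define b where "b = measure U {1..} / 2"
  have b: "b > 0" using measure_atLeast_pos[of 1] by (simp add: b_def)
  have pos: "0 < L P b x" if "x \<ge> 0" for x using no b that by (meson not_le)
  have i1: "integrable U (\<lambda>z. indicator {1..} z * L P b 1)"
    by (simp add: integrable_real_mult_indicator sets_upsilon emeasure_eq_measure)
  have "measure U {1..} * L P b 1 = (\<integral>z. indicator {1..} z * L P b 1 \<partial>U)" by simp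
  also have "\<dots> \<le> (\<integral>z. (max (z - 0) 0 - max (z - 1) 0) * L P b z \<partial>U)"
  proof (rule integral_mono_AE[OF i1])
    show "integrable U (\<lambda>z. (max (z - 0) 0 - max (z - 1) 0) * L P b z)"
      by (intro integrable_lin_growth_mult lin_growth_diff lin_growth_pos_part lin_growth_L b)
    show "AE z in U. indicator {1..} z * L P b 1 \<le> (max (z - 0) 0 - max (z - 1) 0) * L P b z"
      using AE_pos
    proof eventually_elim
      case (elim z)
      have "z \<ge> 1 \<Longrightarrow> L P b 1 \<le> L P b z"
        by (rule L_mono_of_nonneg[OF b]) (use pos in \<open>auto intro: less_imp_le\<close>)
      then show ?case using elim pos[of z] by (auto simp: indicator_def)
    qed
  qed
  also have "\<dots> = b * (L P b 1 - L P b 0)" using L_diff[OF b, of 1 0] b by simp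
  also have "\<dots> < b * L P b 1" using b pos[of 0] by simp
  also have "\<dots> < measure U {1..} * L P b 1"
    using pos[of 1] b by (intro mult_strict_right_mono) (auto simp: b_def)
  finally show False .
qed

text \<open>If \<open>L P s 0\<close> were positive, monotonicity would keep \<open>L P s\<close>
  above it everywhere, and uniform continuity would keep \<open>L P b\<close> positive for all
  \<open>b\<close> slightly below \<open>s\<close>, against the choice of \<open>s\<close>. Every
  parameter with a zero at 0 belongs to \<open>?S\<close>, so \<open>s\<close> is attained as the
  maximum that \<open>GREATEST\<close> requires.\<close>

lemma beta0_props:
  shows beta0_pos: "0 < beta0 P"
    and L_beta0_0: "L P (beta0 P) 0 = 0"
    and L_beta0_nonneg: "\<And>x. x \<ge> 0 \<Longrightarrow> 0 \<le> L P (beta0 P) x"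
proof -
  let ?S = "{b. b > 0 \<and> (\<exists>x\<ge>0. L P b x \<le> 0)}"
  define s where "s = Sup ?S"
  obtain N where N: "N > 0" "\<forall>b\<ge>N. \<forall>x\<ge>0. 0 < L P b x" using L_large by (elim exE conjE)
  have bdd: "bdd_above ?S"
  proof (rule bdd_aboveI[of _ N])
    fix b assume "b \<in> ?S"
    then obtain x where x: "x \<ge> 0" "L P b x \<le> 0" by (elim CollectE exE conjE)
    show "b \<le> N"
    proof (rule ccontr)
      assume "\<not> b \<le> N"
      then have "0 < L P b x" using N(2) x(1) by simp
      then show False using x(2) by simp
    qed
  qed
  from L_nonpos_ex obtain b0 where "b0 > 0 \<and> (\<exists>x\<ge>0. L P b0 x \<le> 0)" ..
  then have b0: "b0 \<in> ?S" by (rule CollectI)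
  then have "b0 \<le> s" unfolding s_def by (intro cSup_upper bdd)
  then have s: "0 < s" using b0 by auto
  have above: "0 < L P b x" if "b > s" "x \<ge> 0" for b x
  proof (rule ccontr)
    assume "\<not> ?thesis"
    then have "b > 0 \<and> (\<exists>x\<ge>0. L P b x \<le> 0)"
      using that s by (intro conjI exI[of _ x]) auto
    then have "b \<in> ?S" by (rule CollectI)
    then have "b \<le> s" unfolding s_def by (intro cSup_upper bdd)
    then show False using that by simp
  qed
  \<comment> \<open>A negative value at \<open>s\<close> would persist for parameters just above
    \<open>s\<close>, where \<open>L\<close> is positive.\<close>
  have nn: "0 \<le> L P s x" if x: "x \<ge> 0" for x
  proof (rule ccontr)
    assume "\<not> ?thesis"
    then have neg: "0 < - L P s x" by simp
    obtain d where d: "d > 0" "\<forall>b'>0. \<bar>b' - s\<bar> < d \<longrightarrow> (\<forall>y\<ge>0. \<bar>L P b' y - L P s y\<bar> < - L P s x)"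
      using L_uniformly_continuous[OF s neg] by (elim exE conjE)
    have "\<bar>L P (s + d / 2) x - L P s x\<bar> < - L P s x" using d s x by simp
    moreover have "0 < L P (s + d / 2) x" using d x by (intro above) auto
    ultimately show False by linarith
  qed
  have z: "L P s 0 = 0"
  proof (rule ccontr)
    assume "L P s 0 \<noteq> 0"
    then have p: "0 < L P s 0" using nn[of 0] by simp
    have ge: "L P s 0 \<le> L P s x" if "x \<ge> 0" for x
      by (rule L_mono_of_nonneg[OF s]) (use nn that in auto)
    obtain d where d: "d > 0" "\<forall>b'>0. \<bar>b' - s\<bar> < d \<longrightarrow> (\<forall>y\<ge>0. \<bar>L P b' y - L P s y\<bar> < L P s 0)"
      using L_uniformly_continuous[OF s p] by (elim exE conjE)
    have "s - d < s" using d by simp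
    then obtain b where b: "b \<in> ?S" "s - d < b"
      using less_cSup_iff[OF _ bdd, of "s - d"] b0 unfolding s_def by (metis (no_types, lifting) empty_iff)
    then have "b \<le> s" unfolding s_def by (intro cSup_upper bdd)
    obtain x where x: "x \<ge> 0" "L P b x \<le> 0" using b(1) by (elim CollectE exE conjE)
    have "\<bar>L P b x - L P s x\<bar> < L P s 0" using d b \<open>b \<le> s\<close> x by simp
    then show False using ge[OF x(1)] x(2) by linarith
  qed
  have "beta0 P = s" unfolding beta0_def
  proof (rule Greatest_equality)
    show "0 < s \<and> L P s 0 = 0" using s z by simp
    fix b assume "0 < b \<and> L P b 0 = 0"
    then have "b \<in> ?S" by (intro CollectI conjI exI[of _ 0]) auto
    then show "b \<le> s" unfolding s_def by (intro cSup_upper bdd)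
  qed
  then show "0 < beta0 P" "L P (beta0 P) 0 = 0" "\<And>x. x \<ge> 0 \<Longrightarrow> 0 \<le> L P (beta0 P) x"
    using s z nn by auto
qed

section \<open>The normalized positive eigenfunction\<close>

abbreviation LL :: "real \<Rightarrow> real" where "LL \<equiv> L P (beta0 P)"

lemma LL_le_1: assumes "x \<ge> 0" shows "LL x \<le> 1"
proof -
  have "0 \<le> (\<integral>z. max (z - x) 0 * LL z \<partial>U)"
  proof (rule integral_nonneg_AE)
    show "AE z in U. 0 \<le> max (z - x) 0 * LL z"
      using AE_pos by eventually_elim (use L_beta0_nonneg in auto)
  qed
  then show ?thesis using L_eq[OF beta0_pos assms] beta0_pos by simp
qed

text \<open>Since \<open>min x z = z - max (z - x) 0\<close>, \<open>T LL x\<close> is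
  \<open>beta0 P\<close> times the increment of \<open>LL\<close> from 0, where \<open>LL\<close>
  vanishes.\<close>

lemma T_LL: assumes "x \<ge> 0" shows "T LL x = beta0 P * LL x"
proof -
  have "T LL x = (\<integral>z. (max (z - 0) 0 - max (z - x) 0) * LL z \<partial>U)" unfolding T_def
  proof (rule integral_cong_AE)
    show "AE z in U. min x z * LL z = (max (z - 0) 0 - max (z - x) 0) * LL z"
      using AE_pos by eventually_elim (use assms in auto)
  qed measurable
  then show ?thesis using L_diff[OF beta0_pos, of x 0] assms beta0_pos L_beta0_0 by simp
qed

text \<open>A zero at some \<open>x > 0\<close> would make the integrand of \<open>T LL x\<close>
  vanish, so that \<open>LL\<close> is zero almost everywhere; the integral equation then returns
  \<open>LL x = 1\<close>.\<close>

lemma LL_pos: assumes "x > 0" shows "0 < LL x"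
proof (rule ccontr)
  assume "\<not> ?thesis"
  then have 0: "LL x = 0" using L_beta0_nonneg[of x] assms by simp
  have nn: "AE z in U. 0 \<le> min x z * LL z"
    using AE_pos by eventually_elim (use assms L_beta0_nonneg in auto)
  have "(\<integral>z. min x z * LL z \<partial>U) = 0" using T_LL[of x] assms 0 by (simp add: T_def)
  then have "AE z in U. min x z * LL z = 0"
    using integral_nonneg_eq_0_iff_AE[OF integrable_min_mult[OF lin_growth_L[OF beta0_pos]] nn] by simp
  then have "AE z in U. max (z - x) 0 * LL z = 0"
    using AE_pos by eventually_elim (use assms in \<open>auto simp: min_def split: if_splits\<close>)
  then have "(\<integral>z. max (z - x) 0 * LL z \<partial>U) = 0" by (rule integral_eq_zero_AE)
  then show False using L_eq[OF beta0_pos, of x] assms 0 by simp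
qed

definition L_norm :: real where "L_norm = sqrt (\<integral>z. LL z * LL z \<partial>U)"

lemma L_norm_pos: "0 < L_norm"
proof -
  have nn: "AE z in U. 0 \<le> LL z * LL z" by simp
  have "(\<integral>z. LL z * LL z \<partial>U) \<noteq> 0"
  proof
    assume "(\<integral>z. LL z * LL z \<partial>U) = 0"
    then have "AE z in U. LL z * LL z = 0"
      using integral_nonneg_eq_0_iff_AE[OF integrable_lin_growth_mult[OF lin_growth_L[OF beta0_pos] lin_growth_L[OF beta0_pos]] nn]
      by simp
    then have "AE z in U. z \<notin> {0<..<1}" by eventually_elim (use LL_pos in force)
    then show False using not_AE_upsilon[of 0 1] by simp
  qed
  moreover have "0 \<le> (\<integral>z. LL z * LL z \<partial>U)" by simp
  ultimately show ?thesis by (simp add: L_norm_def less_le)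
qed

lemma f0_eq: "f0 P x = LL x / L_norm"
  unfolding f0_def L_norm_def by (subst integral_upsilon) (measurable, simp add: power2_eq_square)

sublocale min_kernel_eigen U "beta0 P" "f0 P" "1 / L_norm"
proof (intro min_kernel_eigen.intro min_kernel_eigen_axioms.intro)
  show "min_kernel U" by unfold_locales
  have f0: "f0 P = (\<lambda>x. (1 / L_norm) * LL x)" by (simp add: f0_eq fun_eq_iff)
  show "f0 P \<in> borel_measurable borel" unfolding f0 by measurable
  show "T (f0 P) x = beta0 P * f0 P x" if "x \<ge> 0" for x
    unfolding f0 T_scale by (simp add: T_LL that)
  have "(\<integral>x. f0 P x * f0 P x \<partial>U) = (\<integral>x. LL x * LL x / (L_norm * L_norm) \<partial>U)" by (simp add: f0)
  also have "\<dots> = (\<integral>x. LL x * LL x \<partial>U) / (L_norm * L_norm)" by simp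
  also have "L_norm * L_norm = (\<integral>x. LL x * LL x \<partial>U)" by (simp add: L_norm_def)
  also have "(\<integral>x. LL x * LL x \<partial>U) / (\<integral>x. LL x * LL x \<partial>U) = 1" using L_norm_pos by (auto simp: L_norm_def)
  finally show "(\<integral>x. f0 P x * f0 P x \<partial>U) = 1" .
  show "0 < f0 P x" if "x > 0" for x using LL_pos[OF that] L_norm_pos by (simp add: f0_eq)
  show "f0 P x \<le> 1 / L_norm" if "x > 0" for x
    using LL_le_1[of x] that L_norm_pos by (simp add: f0_eq divide_right_mono)
qed (rule beta0_pos)

section \<open>The iterated kernels\<close>

text \<open>Joint density of the degree and the Erlang variable, with \<open>j\<close> for the
  degree minus one. The discrete target type enters the kernel through this factor alone.\<close>

definition wt :: "nat \<Rightarrow> real \<Rightarrow> real" where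
  "wt j z = pmf P (j + 1) * exp (- z) * z ^ j / fact j"

lemma wt_nonneg: "z \<ge> 0 \<Longrightarrow> 0 \<le> wt j z"
  by (simp add: wt_def)

text \<open>The number \<open>j\<close> of potential children cancels one factor of the factorial,
  which produces the series of \<open>g2\<close>; this is how discrete types are summed out. The
  term \<open>j = 0\<close> vanishes, hence the index shift.\<close>

lemma wt_sums: "(\<lambda>j. real j * wt j z) sums (z * g2 P z)"
proof -
  have "(\<lambda>j. z * exp (- z) * (pmf P (j + 2) * z ^ j / fact j)) sums (z * g2 P z)"
    using sums_mult[OF summable_sums[OF summable_pmf_exp[of 2 z]], of "z * exp (- z)"]
    by (simp add: g2_def mult.assoc)
  moreover have "z * exp (- z) * (pmf P (j + 2) * z ^ j / fact j) = real (Suc j) * wt (Suc j) z" for j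
  proof -
    have "fact (Suc j) = real (Suc j) * fact j" by simp
    then show ?thesis unfolding wt_def by (simp add: divide_simps del: fact_Suc of_nat_Suc)
  qed
  ultimately have "(\<lambda>j. real (Suc j) * wt (Suc j) z) sums (z * g2 P z)" by simp
  from sums_Suc[OF this] show ?thesis by simp
qed

lemma quot0_min: assumes "x \<ge> 0" "z \<ge> 0" shows "quot0 (\<lambda>t. min t z) (\<lambda>t. t) x = kern 0 x z"
proof (cases "x = 0")
  case True
  have "eventually (\<lambda>t. kern 0 t z = min t z / t) (at_right 0)"
    using eventually_at_right_less[of "0::real"] by eventually_elim (simp add: kern.simps)
  then have "((\<lambda>t. min t z / t) \<longlongrightarrow> kern 0 0 z) (at_right 0)"
    by (rule Lim_transform_eventually[OF kern_tendsto_0[OF assms(2)]])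
  then show ?thesis using True by (simp add: quot0_def tendsto_Lim)
qed (simp add: quot0_def kern.simps)

lemma kern_0_mult: "x \<ge> 0 \<Longrightarrow> z \<ge> 0 \<Longrightarrow> x * kern 0 x z = min x z"
  by (simp add: kern.simps)

lemma quot0_f0: assumes "x \<ge> 0"
  shows "quot0 (f0 P) (\<lambda>t. t) x = fquot x" "quot0 (\<lambda>t. t) (f0 P) x = 1 / fquot x"
proof -
  have "((\<lambda>t. inverse (f0 P t / t)) \<longlongrightarrow> inverse slope) (at_right 0)"
    using slope_pos by (intro tendsto_inverse fquot_tendsto) auto
  then have "((\<lambda>t. t / f0 P t) \<longlongrightarrow> inverse slope) (at_right 0)" by simp
  then show "quot0 (f0 P) (\<lambda>t. t) x = fquot x" "quot0 (\<lambda>t. t) (f0 P) x = 1 / fquot x"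
    using fquot_tendsto by (auto simp: quot0_def fquot_def tendsto_Lim field_simps)
qed

lemma fquot_mult: "x \<ge> 0 \<Longrightarrow> x * fquot x = f0 P x"
  using f_0 by (simp add: fquot_def)

lemma f0_deriv: "vector_derivative (f0 P) (at 0 within {0..}) = slope"
proof (rule vector_derivative_within)
  show "at 0 within {0::real..} \<noteq> bot"
    by (simp add: at_within_Ici_at_right trivial_limit_at_right_real)
  have "((\<lambda>t. (f0 P t - f0 P 0) / (t - 0)) \<longlongrightarrow> slope) (at 0 within {0..})"
    using fquot_tendsto by (simp add: f_0 at_within_Ici_at_right)
  then have "(f0 P has_field_derivative slope) (at 0 within {0..})"
    by (simp add: has_field_derivative_iff)
  then show "(f0 P has_vector_derivative slope) (at 0 within {0..})"
    by (simp add: has_real_derivative_iff_has_vector_derivative)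
qed

lemma V_eq: "x \<ge> 0 \<Longrightarrow> V P \<theta> x = slope * exp (decay / 2 * x) / fquot x"
  by (simp add: V_def Let_def f0_deriv quot0_f0 decay_def)

lemma hl_eq: "x > 0 \<Longrightarrow> z \<ge> 0 \<Longrightarrow> hl P (Suc l) x z = x * kern l x z"
proof (induction l arbitrary: z)
  case 0
  then show ?case by (simp add: kern_0_mult)
next
  case (Suc l)
  have [measurable]: "kern l x \<in> borel_measurable borel"
    using lin_growth_kern[of x l] Suc.prems by (auto dest: lin_growth_measurable)
  have "hl P (Suc (Suc l)) x z = (LBINT y:{0..}. g2 P y * (min z y * kern l x y * x))"
    unfolding hl.simps
    by (intro set_lebesgue_integral_cong) (use Suc in \<open>auto simp: min.commute mult_ac\<close>)
  also have "\<dots> = (\<integral>y. min z y * kern l x y * x \<partial>U)" by (rule integral_upsilon[symmetric]) measurable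
  also have "\<dots> = x * kern (Suc l) x z" by (simp add: kern.simps T_def mult.commute)
  finally show ?case .
qed

text \<open>At \<open>x = 0\<close> the second quotient is read as the quotient of
  \<open>hl P (Suc l) t z / t\<close> and \<open>f0 P t / t\<close>, whose denominator tends to the
  positive \<open>slope\<close>.\<close>

lemma quot0_hl: assumes "x \<ge> 0" "z \<ge> 0"
  shows "quot0 (\<lambda>t. hl P (Suc l) t z) (\<lambda>t. t) x = kern l x z" (is ?A)
    and "quot0 (\<lambda>t. hl P (Suc l) t z) (f0 P) x = kern l x z / fquot x" (is ?B)
proof -
  have ev: "eventually (\<lambda>t. kern l t z = hl P (Suc l) t z / t) (at_right 0)"
    using eventually_at_right_less[of "0::real"]
    by eventually_elim (use assms hl_eq in simp)
  have lim: "((\<lambda>t. hl P (Suc l) t z / t) \<longlongrightarrow> kern l 0 z) (at_right 0)"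
    by (rule Lim_transform_eventually[OF kern_tendsto_0[OF assms(2)] ev])
  have "((\<lambda>t. (hl P (Suc l) t z / t) / (f0 P t / t)) \<longlongrightarrow> kern l 0 z / slope) (at_right 0)"
    using slope_pos by (intro tendsto_divide lim fquot_tendsto) auto
  moreover have "eventually (\<lambda>t. (hl P (Suc l) t z / t) / (f0 P t / t) = hl P (Suc l) t z / f0 P t) (at_right 0)"
    using eventually_at_right_less[of "0::real"] by eventually_elim simp
  ultimately have lim2: "((\<lambda>t. hl P (Suc l) t z / f0 P t) \<longlongrightarrow> kern l 0 z / slope) (at_right 0)"
    by (rule Lim_transform_eventually)
  show ?A using lim hl_eq[of x z l] assms by (simp add: quot0_def tendsto_Lim)
  show ?B using lim2 hl_eq[of x z l] assms
    by (simp add: quot0_def tendsto_Lim fquot_def)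
qed

lemma m1_eq: "x \<ge> 0 \<Longrightarrow> z \<ge> 0 \<Longrightarrow> m1 P m x j z = real m * kern 0 x z * wt j z"
  by (simp add: m1_def quot0_min wt_def)

lemma ml_eq: "x \<ge> 0 \<Longrightarrow> z \<ge> 0 \<Longrightarrow> ml P (Suc l) m x j z = real m * kern l x z * wt j z"
proof (induction l arbitrary: j z)
  case 0
  then show ?case by (simp add: m1_eq)
next
  case (Suc l)
  have [measurable]: "kern l x \<in> borel_measurable borel"
    using lin_growth_kern[of x l] Suc.prems by (auto dest: lin_growth_measurable)
  have "ml P (Suc (Suc l)) m x j z = (LBINT y:{0..}. g2 P y * (min z y * kern l x y * (real m * wt j z)))"
    unfolding ml.simps
  proof (intro set_lebesgue_integral_cong allI impI)
    fix y :: real assume "y \<in> {0..}"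
    then have y: "y \<ge> 0" by simp
    have "(\<Sum>j'. ml P (Suc l) m x j' y * m1 P j' y j z)
      = (\<Sum>j'. (real m * kern l x y * kern 0 y z * wt j z) * (real j' * wt j' y))"
      by (intro suminf_cong) (simp add: Suc.IH[OF Suc.prems(1) y] m1_eq[OF y Suc.prems(2)] mult_ac)
    also have "\<dots> = (real m * kern l x y * kern 0 y z * wt j z) * (y * g2 P y)"
      using sums_mult[OF wt_sums[of y]] by (rule sums_unique[symmetric])
    also have "\<dots> = g2 P y * ((y * kern 0 y z) * kern l x y * (real m * wt j z))" by (simp only: mult_ac)
    \<comment> \<open>The factor \<open>y\<close> produced by the sum over types turns the quotient
      kernel back into the symmetric \<open>min\<close>.\<close>
    also have "y * kern 0 y z = min z y" using y Suc.prems by (simp add: kern_0_mult min.commute)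
    finally show "(\<Sum>j'. ml P (Suc l) m x j' y * m1 P j' y j z)
      = g2 P y * (min z y * kern l x y * (real m * wt j z))" .
  qed simp
  also have "\<dots> = (\<integral>y. min z y * kern l x y * (real m * wt j z) \<partial>U)"
    by (rule integral_upsilon[symmetric]) measurable
  also have "\<dots> = real m * kern (Suc l) x z * wt j z" by (simp add: kern.simps T_def)
  finally show ?case .
qed

section \<open>Bounds for \<open>\<beta>\<^sub>0\<close>\<close>

lemma integral_upsilon_pos:
  fixes h :: "real \<Rightarrow> real"
  assumes "integrable U h" "\<And>z. z > 0 \<Longrightarrow> 0 \<le> h z" "0 \<le> a" "a < c"
    and "\<And>z. a < z \<Longrightarrow> z < c \<Longrightarrow> 0 < h z"
  shows "0 < (\<integral>z. h z \<partial>U)"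
proof -
  have nn: "AE z in U. 0 \<le> h z" using AE_pos by eventually_elim (rule assms(2))
  have "(\<integral>z. h z \<partial>U) \<noteq> 0"
  proof
    assume "(\<integral>z. h z \<partial>U) = 0"
    then have "AE z in U. h z = 0" using integral_nonneg_eq_0_iff_AE[OF assms(1) nn] by simp
    then have "AE z in U. z \<notin> {a<..<c}" by eventually_elim (use assms(5) in force)
    then show False using not_AE_upsilon[OF assms(3,4)] by simp
  qed
  with integral_nonneg_AE[OF nn] show ?thesis by simp
qed

text \<open>The integral equation at 0 says that \<open>beta0 P\<close> is the integral of
  \<open>z * LL z\<close>; replacing \<open>LL\<close> by 1 increases it strictly.\<close>

lemma beta0_less: "beta0 P < measure_pmf.expectation P real - 1"
proof -
  have L1: "LL x < 1" if x: "x > 0" for x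
  proof -
    have "0 < (\<integral>z. max (z - x) 0 * LL z \<partial>U)"
    proof (rule integral_upsilon_pos[of _ x "x + 1"])
      show "integrable U (\<lambda>z. max (z - x) 0 * LL z)"
        by (intro integrable_lin_growth_mult lin_growth_pos_part lin_growth_L beta0_pos)
    qed (use x LL_pos in \<open>auto simp: less_imp_le\<close>)
    then show ?thesis using L_eq[OF beta0_pos, of x] x beta0_pos by simp
  qed
  have "0 < (\<integral>z. z * (1 - LL z) \<partial>U)"
  proof (rule integral_upsilon_pos[of _ 0 1])
    show "integrable U (\<lambda>z. z * (1 - LL z))"
      by (intro integrable_lin_growth_mult lin_growth_id lin_growth_diff lin_growth_L beta0_pos
          lin_growth_bounded[where C = 1]) auto
  qed (use L1 in \<open>auto simp: less_imp_le\<close>)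
  also have "\<dots> = (\<integral>z. z \<partial>U) - (\<integral>z. z * LL z \<partial>U)"
    by (simp add: right_diff_distrib integrable_lin_growth[OF lin_growth_id]
        integrable_lin_growth_mult[OF lin_growth_id lin_growth_L[OF beta0_pos]])
  also have "(\<integral>z. z * LL z \<partial>U) = (\<integral>z. max (z - 0) 0 * LL z \<partial>U)"
    by (intro integral_cong_AE) (use AE_pos in \<open>auto elim!: eventually_mono\<close>)
  also have "\<dots> = beta0 P"
    using L_eq[OF beta0_pos, of 0] L_beta0_0 beta0_pos by simp
  finally show ?thesis using integral_id by simp
qed

lemma integrable_indicator_atLeast: "integrable U (\<lambda>z. indicator {a..} z * c :: real)"
  by (simp add: integrable_real_mult_indicator sets_upsilon emeasure_eq_measure)

text \<open>Since \<open>f0 P\<close> is nondecreasing, the part of \<open>T (f0 P) x\<close> over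
  \<open>{x..}\<close> is at least \<open>x * f0 P x * measure U {x..}\<close>, and the points below
  \<open>x\<close> contribute strictly. Continuity and decay at infinity make the maximum
  attained.\<close>

lemma tail_argmax:
  "\<exists>x\<^sub>0. is_arg_max (\<lambda>x. x * measure U {x..}) (\<lambda>x. 0 \<le> x) x\<^sub>0 \<and> x\<^sub>0 * measure U {x\<^sub>0..} < beta0 P"
proof -
  let ?q = "\<lambda>x. x * measure U {x..}"
  have F: "measure U {x..} = (\<integral>z. indicator {x..} z \<partial>U)" for x by simp
  have "continuous_on UNIV (\<lambda>x. measure U {x..})"
    unfolding continuous_on_eq_continuous_at[OF open_UNIV]
  proof
    fix a :: real
    have "(\<lambda>n. measure U {X n..}) \<longlonglongrightarrow> measure U {a..}" if X: "X \<longlonglongrightarrow> a" for X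
      unfolding F
    proof (rule integral_dominated_convergence[where w = "\<lambda>_. 1"])
      \<comment> \<open>Absence of atoms is what makes the tail continuous.\<close>
      have "AE z in U. z \<noteq> a"
        by (rule AE_upsilonI) (use AE_lborel_singleton[of a] in \<open>auto elim!: eventually_mono\<close>)
      then show "AE z in U. (\<lambda>n. indicator {X n..} z :: real) \<longlonglongrightarrow> indicator {a..} z"
      proof eventually_elim
        case (elim z)
        then consider "z < a" | "a < z" by linarith
        then show ?case
        proof cases
          case 1
          have "eventually (\<lambda>n. z < X n) sequentially" using order_tendstoD(1)[OF X 1] .
          then have "eventually (\<lambda>n. indicator {X n..} z = (indicator {a..} z :: real)) sequentially"
            by eventually_elim (use 1 in \<open>auto simp: indicator_def\<close>)
          then show ?thesis by (rule tendsto_eventually)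
        next
          case 2
          have "eventually (\<lambda>n. X n < z) sequentially" using order_tendstoD(2)[OF X 2] .
          then have "eventually (\<lambda>n. indicator {X n..} z = (indicator {a..} z :: real)) sequentially"
            by eventually_elim (use 2 in \<open>auto simp: indicator_def\<close>)
          then show ?thesis by (rule tendsto_eventually)
        qed
      qed
    qed (auto simp: indicator_def)
    then show "continuous (at a) (\<lambda>x. measure U {x..})"
      by (simp add: continuous_at_sequentially o_def)
  qed
  then have cont: "continuous_on S ?q" for S
    by (intro continuous_intros) (auto intro: continuous_on_subset)
  have q1: "0 < ?q 1" using measure_atLeast_pos[of 1] by simp
  obtain R where R: "R \<ge> 0" "(\<integral>z. z * indicator {R..} z \<partial>U) < ?q 1" using tail_small[OF q1] .
  have tail: "?q x < ?q 1" if x: "x \<ge> R" for x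
  proof -
    have "?q x = (\<integral>z. indicator {x..} z * x \<partial>U)" by simp
    also have "\<dots> \<le> (\<integral>z. z * indicator {R..} z \<partial>U)"
    proof (rule integral_mono_AE[OF integrable_indicator_atLeast])
      show "integrable U (\<lambda>z. z * indicator {R..} z)"
        using integrable_lin_growth[OF lin_growth_id] by (simp add: integrable_real_mult_indicator)
      show "AE z in U. indicator {x..} z * x \<le> z * indicator {R..} z"
        using AE_pos by eventually_elim (use x R in \<open>auto simp: indicator_def\<close>)
    qed
    finally show ?thesis using R by linarith
  qed
  \<comment> \<open>The interval contains 1, so its maximum is at least \<open>?q 1\<close> and
    exceeds every value beyond \<open>R\<close>.\<close>
  have "compact {0..max R 1}" "{0..max R 1} \<noteq> {}" by auto
  from continuous_attains_sup[OF this cont] obtain x0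
    where x0: "x0 \<in> {0..max R 1}" "\<forall>y\<in>{0..max R 1}. ?q y \<le> ?q x0" by blast
  have q1x0: "?q 1 \<le> ?q x0" by (rule x0(2)[rule_format]) auto
  have max: "?q y \<le> ?q x0" if "y \<ge> 0" for y
  proof (cases "y \<le> max R 1")
    case True
    then show ?thesis using x0(2) that by auto
  next
    case False
    then have "?q y < ?q 1" by (intro tail) simp
    then show ?thesis using q1x0 by linarith
  qed
  have x0_pos: "0 < x0" using q1 q1x0 x0(1) by (cases "x0 = 0") auto
  let ?h = "\<lambda>z. min x0 z * f0 P z - indicator {x0..} z * (x0 * f0 P x0)"
  have "0 < (\<integral>z. ?h z \<partial>U)"
  proof (rule integral_upsilon_pos[of _ 0 x0])
    show "integrable U ?h"
      by (intro Bochner_Integration.integrable_diff integrable_min_mult lin_growth_f integrable_indicator_atLeast)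
    show "0 \<le> ?h z" if "z > 0" for z
      using that x0_pos f_pos[of z] f_mono[of x0 z] by (auto simp: indicator_def)
    show "0 < ?h z" if "0 < z" "z < x0" for z
      using that f_pos[of z] by (auto simp: indicator_def)
  qed (use x0_pos in auto)
  also have "\<dots> = T (f0 P) x0 - measure U {x0..} * (x0 * f0 P x0)"
    unfolding T_def
    by (subst Bochner_Integration.integral_diff[OF integrable_min_mult[OF lin_growth_f] integrable_indicator_atLeast]) simp
  also have "\<dots> = (beta0 P - ?q x0) * f0 P x0" using eigen[of x0] x0_pos by (simp add: algebra_simps)
  finally have "?q x0 < beta0 P" using f_pos[OF x0_pos] by (simp add: zero_less_mult_iff)
  moreover have "is_arg_max ?q (\<lambda>x. 0 \<le> x) x0"
    unfolding is_arg_max_def using x0_pos max by (auto simp: not_less)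
  ultimately show ?thesis by blast
qed

section \<open>Eigenfunctions of \<open>M\<^sub>1\<close>\<close>

text \<open>Integrability at the single point 1 spreads to all \<open>x\<close> by
  \<open>min x z \<le> (1 + x) * min 1 z\<close>; dividing by \<open>b\<close> turns the bound on
  \<open>T \<phi>\<close> into one on \<open>\<phi>\<close>.\<close>

lemma lin_growth_of_eigen:
  assumes [measurable]: "\<phi> \<in> borel_measurable borel" and int: "integrable U (\<lambda>z. min 1 z * \<phi> z)"
    and b: "b \<noteq> 0" "\<And>x. x \<ge> 0 \<Longrightarrow> T \<phi> x = b * \<phi> x"
  shows "lin_growth \<phi>"
proof (rule lin_growthI[where C = "(\<integral>z. \<bar>min 1 z * \<phi> z\<bar> \<partial>U) / \<bar>b\<bar>"])
  fix x :: real assume x: "x > 0"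
  have i: "integrable U (\<lambda>z. (1 + x) * \<bar>min 1 z * \<phi> z\<bar>)" using int by simp
  have le: "AE z in U. \<bar>min x z * \<phi> z\<bar> \<le> (1 + x) * \<bar>min 1 z * \<phi> z\<bar>"
    using AE_pos
  proof eventually_elim
    case (elim z)
    have "min x z \<le> (1 + x) * min 1 z"
      using min_le_min_1_mult[of z x] elim x by (simp add: min.commute mult.commute)
    then have "min x z * \<bar>\<phi> z\<bar> \<le> (1 + x) * min 1 z * \<bar>\<phi> z\<bar>" by (rule mult_right_mono) simp
    then show ?case using elim x by (simp add: abs_mult mult.assoc)
  qed
  have "\<bar>b * \<phi> x\<bar> = \<bar>T \<phi> x\<bar>" using b x by simp
  also have "\<dots> \<le> (\<integral>z. \<bar>min x z * \<phi> z\<bar> \<partial>U)" unfolding T_def by (rule integral_abs_bound)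
  also have "\<dots> \<le> (\<integral>z. (1 + x) * \<bar>min 1 z * \<phi> z\<bar> \<partial>U)"
  proof (rule integral_mono_AE[OF _ i le])
    show "integrable U (\<lambda>z. \<bar>min x z * \<phi> z\<bar>)"
      by (rule Bochner_Integration.integrable_bound[OF i]) (measurable, use le in \<open>auto elim!: eventually_mono\<close>)
  qed
  also have "\<dots> = (1 + x) * (\<integral>z. \<bar>min 1 z * \<phi> z\<bar> \<partial>U)" by (rule integral_mult_right_zero)
  finally have "\<bar>\<phi> x\<bar> * \<bar>b\<bar> \<le> (\<integral>z. \<bar>min 1 z * \<phi> z\<bar> \<partial>U) * (1 + x)"
    unfolding abs_mult by (simp only: mult.commute)
  moreover have "0 < \<bar>b\<bar>" using b(1) by simp
  ultimately show "\<bar>\<phi> x\<bar> \<le> (\<integral>z. \<bar>min 1 z * \<phi> z\<bar> \<partial>U) / \<bar>b\<bar> * (1 + x)"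
    by (simp only: times_divide_eq_left pos_le_divide_eq)
qed fact

lemma right_sums:
  assumes "x \<ge> 0" "z \<ge> 0" "\<And>j. \<mu> j z = real j * c"
  shows "(\<lambda>j. m1 P m x j z * \<mu> j z) sums (real m * kern 0 x z * (z * c) * g2 P z)"
proof -
  have "(\<lambda>j. real m * kern 0 x z * c * (real j * wt j z)) sums (real m * kern 0 x z * c * (z * g2 P z))"
    by (rule sums_mult[OF wt_sums])
  moreover have "real m * kern 0 x z * c * (real j * wt j z) = m1 P m x j z * \<mu> j z" for j
    using assms by (simp add: m1_eq mult_ac)
  ultimately show ?thesis by (simp add: mult_ac)
qed

text \<open>
  Since the kernel is linear in \<open>m\<close>, a right eigenfunction has the form \<open>m \<phi> x / x\<close>, and summing
  over the types \<open>j\<close> turns the eigenvalue equation into \<open>T \<phi> = b \<phi>\<close>.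
\<close>
lemma right_eigenfunction_reduce:
  assumes \<mu>: "right_eigenfunction P b \<mu>" and b: "b \<noteq> 0"
  obtains \<phi> where "lin_growth \<phi>" "\<forall>x\<ge>0. T \<phi> x = b * \<phi> x" "\<exists>x\<ge>0. \<phi> x \<noteq> 0"
    "\<forall>m. \<forall>x\<ge>0. \<mu> m x = real m * (if x = 0 then (\<integral>z. \<phi> z \<partial>U) / b else \<phi> x / x)"
proof -
  let ?W = "\<lambda>m x z. \<Sum>j. m1 P m x j z * \<mu> j z"
  have eq: "b * \<mu> m x = (LBINT z:{0..}. ?W m x z)" if "x \<ge> 0" for m x
    using \<mu> that unfolding right_eigenfunction_def by blast
  have int: "set_integrable lborel {0..} (?W m x)" if "x \<ge> 0" for m x
    using \<mu> that unfolding right_eigenfunction_def by blast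
  have sm: "AE z in lborel. 0 \<le> z \<longrightarrow> summable (\<lambda>j. m1 P m x j z * \<mu> j z)" if "x \<ge> 0" for m x
    using \<mu> that unfolding right_eigenfunction_def by blast
  have lin: "\<mu> m x = real m * \<mu> 1 x" if x: "x \<ge> 0" for m x
  proof -
    have "b * \<mu> m x = (\<integral>z. indicator {0..} z *\<^sub>R ?W m x z \<partial>lborel)"
      using eq[OF x] by (simp add: set_lebesgue_integral_def)
    also have "\<dots> = (\<integral>z. real m * (indicator {0..} z *\<^sub>R ?W 1 x z) \<partial>lborel)"
    proof (rule integral_cong_AE)
      show "(\<lambda>z. indicator {0..} z *\<^sub>R ?W m x z) \<in> borel_measurable lborel"
        using int[OF x, of m] unfolding set_integrable_def by (rule borel_measurable_integrable)
      have "(\<lambda>z. indicator {0..} z *\<^sub>R ?W 1 x z) \<in> borel_measurable lborel"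
        using int[OF x, of 1] unfolding set_integrable_def by (rule borel_measurable_integrable)
      then show "(\<lambda>z. real m * (indicator {0..} z *\<^sub>R ?W 1 x z)) \<in> borel_measurable lborel"
        by (rule borel_measurable_times[OF borel_measurable_const])
      show "AE z in lborel. indicator {0..} z *\<^sub>R ?W m x z = real m * (indicator {0..} z *\<^sub>R ?W 1 x z)"
        using sm[OF x, of 1]
      proof eventually_elim
        case (elim z)
        show ?case
        proof (cases "z \<ge> 0")
          case True
          have "?W m x z = (\<Sum>j. real m * (m1 P 1 x j z * \<mu> j z))"
            by (simp add: m1_def mult.assoc)
          also have "\<dots> = real m * ?W 1 x z" using elim True by (intro suminf_mult) simp
          finally show ?thesis using True by simp
        qed simp
      qed
    qed
    also have "\<dots> = real m * (\<integral>z. indicator {0..} z *\<^sub>R ?W 1 x z \<partial>lborel)"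
      by (rule integral_mult_right_zero)
    also have "(\<integral>z. indicator {0..} z *\<^sub>R ?W 1 x z \<partial>lborel) = b * \<mu> 1 x"
      using eq[OF x] by (simp add: set_lebesgue_integral_def)
    finally show ?thesis using b by simp
  qed
  \<comment> \<open>The value at 0 agrees with \<open>T \<phi> 0 = 0\<close>;
    \<open>\<mu> 1 0\<close> is recovered from the eigenvalue equation at
    \<open>x = 0\<close>.\<close>
  define \<phi> where "\<phi> z = (if z > 0 then z * \<mu> 1 z else 0)" for z
  have W: "?W 1 x z = g2 P z * (kern 0 x z * \<phi> z)" if "x \<ge> 0" "z \<ge> 0" for x z
  proof -
    have z: "z * \<mu> 1 z = \<phi> z" using that by (simp add: \<phi>_def)
    have "(\<lambda>j. m1 P 1 x j z * \<mu> j z) sums (real 1 * kern 0 x z * (z * \<mu> 1 z) * g2 P z)"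
      by (rule right_sums[OF that]) (rule lin[OF that(2)])
    from sums_unique[OF this] show ?thesis unfolding z by (simp add: mult_ac)
  qed
  have int': "set_integrable lborel {0..} (\<lambda>z. g2 P z * (kern 0 x z * \<phi> z))" if "x \<ge> 0" for x
    using int[OF that, of 1] unfolding set_integrable_def
    by (rule Bochner_Integration.integrable_cong[THEN iffD1, rotated 2])
      (use W[OF that] in \<open>auto simp: indicator_def\<close>)
  have meas: "\<phi> \<in> borel_measurable borel"
  proof -
    have "(\<lambda>z. indicator {0..} z *\<^sub>R (g2 P z * (kern 0 0 z * \<phi> z))) \<in> borel_measurable lborel"
      using int'[of 0] unfolding set_integrable_def by (intro borel_measurable_integrable) simp
    then have [measurable]: "(\<lambda>z. indicator {0..} z *\<^sub>R (g2 P z * (kern 0 0 z * \<phi> z))) \<in> borel_measurable borel"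
      by simp
    \<comment> \<open>At \<open>x = 0\<close> the kernel is 1 on the open half-line, so the
      integrand is \<open>g2 P z * \<phi> z\<close> there, and dividing by the positive
      \<open>g2\<close> recovers \<open>\<phi>\<close>.\<close>
    have "\<phi> = (\<lambda>z. indicator {0..} z *\<^sub>R (g2 P z * (kern 0 0 z * \<phi> z)) / g2 P z)"
    proof
      fix z show "\<phi> z = indicator {0..} z *\<^sub>R (g2 P z * (kern 0 0 z * \<phi> z)) / g2 P z"
        using g2_pos[of z] by (auto simp: \<phi>_def kern.simps)
    qed
    also have "\<dots> \<in> borel_measurable borel" by measurable
    finally show ?thesis .
  qed
  note [measurable] = meas
  have km: "(\<lambda>z. kern 0 x z * \<phi> z) \<in> borel_measurable borel" if "x \<ge> 0" for x
    using lin_growth_measurable[OF lin_growth_kern[OF that, of 0]] by measurable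
  have E: "b * \<mu> 1 x = (\<integral>z. kern 0 x z * \<phi> z \<partial>U)" if x: "x \<ge> 0" for x
  proof -
    have "b * \<mu> 1 x = (LBINT z:{0..}. g2 P z * (kern 0 x z * \<phi> z))"
      unfolding eq[OF x] by (intro set_lebesgue_integral_cong) (use W[OF x] in auto)
    then show ?thesis using integral_upsilon[OF km[OF x]] by simp
  qed
  have "integrable U (\<lambda>z. kern 0 1 z * \<phi> z)"
    using int'[of 1] km[of 1] by (simp add: integrable_upsilon)
  then have int1: "integrable U (\<lambda>z. min 1 z * \<phi> z)" by (simp add: kern.simps)
  have T: "T \<phi> x = b * \<phi> x" if x: "x \<ge> 0" for x
  proof (cases "x = 0")
    case False
    have "b * \<phi> x = x * (\<integral>z. kern 0 x z * \<phi> z \<partial>U)" using E[OF x] x False by (simp add: \<phi>_def)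
    also have "\<dots> = T \<phi> x" unfolding T_def
      using False by (subst integral_mult_right_zero[symmetric]) (simp add: kern.simps)
    finally show ?thesis by simp
  qed (simp add: T_0 \<phi>_def)
  have lg: "lin_growth \<phi>" by (rule lin_growth_of_eigen[OF meas int1 b T])
  have "(\<integral>z. kern 0 0 z * \<phi> z \<partial>U) = (\<integral>z. \<phi> z \<partial>U)"
    using AE_pos km[of 0] by (intro integral_cong_AE) (auto elim!: eventually_mono simp: kern.simps)
  then have \<mu>0: "\<mu> 1 0 = (\<integral>z. \<phi> z \<partial>U) / b" using E[of 0] b by (simp add: field_simps)
  have form: "\<mu> m x = real m * (if x = 0 then (\<integral>z. \<phi> z \<partial>U) / b else \<phi> x / x)" if "x \<ge> 0" for m x
  proof -
    have "\<mu> 1 x = (if x = 0 then (\<integral>z. \<phi> z \<partial>U) / b else \<phi> x / x)"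
      using \<mu>0 that by (auto simp: \<phi>_def)
    with lin[OF that, of m] show ?thesis by simp
  qed
  have nz: "\<exists>x\<ge>0. \<phi> x \<noteq> 0"
  proof (rule ccontr)
    assume no: "\<not> ?thesis"
    then have "(\<integral>z. \<phi> z \<partial>U) = 0"
      by (intro integral_eq_zero_AE) (use AE_pos in \<open>auto elim!: eventually_mono simp: less_imp_le\<close>)
    then have "\<mu> m x = 0" if "x \<ge> 0" for m x using form[OF that, of m] no that by auto
    then show False using \<mu> unfolding right_eigenfunction_def by blast
  qed
  show thesis
    by (rule that[OF lg _ nz]) (use T form in blast)+
qed

lemma right_eigenfunction_f0:
  assumes c: "c \<noteq> 0" and \<mu>: "\<And>m x. x \<ge> 0 \<Longrightarrow> \<mu> m x = c * (real m * fquot x)"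
  shows "right_eigenfunction P (beta0 P) \<mu>"
  unfolding right_eigenfunction_def
proof (intro conjI allI impI)
  have "\<mu> 1 1 \<noteq> 0" using \<mu>[of 1 1] c fquot_pos[of 1] by simp
  then show "\<exists>m. \<exists>x\<ge>0. \<mu> m x \<noteq> 0" using zero_le_one by blast
  fix m and x :: real assume x: "x \<ge> 0"
  have S: "(\<lambda>j. m1 P m x j z * \<mu> j z) sums (g2 P z * (real m * c * (kern 0 x z * f0 P z)))" if "z \<ge> 0" for z
    using right_sums[OF x that, of \<mu> "c * fquot z" m] \<mu>[OF that] fquot_mult[OF that]
    by (simp add: mult_ac)
  have lg: "lin_growth (kern 0 x)" by (rule lin_growth_kern[OF x])
  have i: "integrable U (\<lambda>z. real m * c * (kern 0 x z * f0 P z))"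
    using integrable_lin_growth_mult[OF lg lin_growth_f] by simp
  have meas: "(\<lambda>z. real m * c * (kern 0 x z * f0 P z)) \<in> borel_measurable borel"
    using lin_growth_measurable[OF lg] by measurable
  show "AE z in lborel. 0 \<le> z \<longrightarrow> summable (\<lambda>j. m1 P m x j z * \<mu> j z)"
    using S by (auto simp: sums_iff)
  have "set_integrable lborel {0..} (\<lambda>z. g2 P z * (real m * c * (kern 0 x z * f0 P z)))"
    using i by (subst (asm) integrable_upsilon[OF meas])
  then show "set_integrable lborel {0..} (\<lambda>z. \<Sum>j. m1 P m x j z * \<mu> j z)"
    unfolding set_integrable_def
    by (rule Bochner_Integration.integrable_cong[THEN iffD1, rotated 2])
      (use S in \<open>auto simp: indicator_def sums_iff\<close>)
  have "(LBINT z:{0..}. (\<Sum>j. m1 P m x j z * \<mu> j z))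
      = (LBINT z:{0..}. g2 P z * (real m * c * (kern 0 x z * f0 P z)))"
    by (intro set_lebesgue_integral_cong) (use S in \<open>auto simp: sums_iff\<close>)
  also have "\<dots> = (\<integral>z. real m * c * (kern 0 x z * f0 P z) \<partial>U)"
    by (rule integral_upsilon[OF meas, symmetric])
  also have "\<dots> = beta0 P * \<mu> m x" using kern_integral[OF x, of 0] \<mu>[OF x] by simp
  finally show "beta0 P * \<mu> m x = (LBINT z:{0..}. (\<Sum>j. m1 P m x j z * \<mu> j z))" by simp
qed

section \<open>Left eigenfunctions\<close>

lemma left_sums:
  assumes "x \<ge> 0" "z \<ge> 0" "\<And>m. \<nu> m x = wt m x * c"
  shows "(\<lambda>m. \<nu> m x * m1 P m x j z) sums (g2 P x * (min z x * c * wt j z))"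
proof -
  have "(\<lambda>m. kern 0 x z * c * wt j z * (real m * wt m x)) sums (kern 0 x z * c * wt j z * (x * g2 P x))"
    by (rule sums_mult[OF wt_sums])
  moreover have "kern 0 x z * c * wt j z * (real m * wt m x) = \<nu> m x * m1 P m x j z" for m
    using assms by (simp add: m1_eq mult_ac)
  moreover have "kern 0 x z * c * wt j z * (x * g2 P x) = g2 P x * ((x * kern 0 x z) * c * wt j z)"
    by (simp only: mult_ac)
  ultimately show ?thesis using kern_0_mult[OF assms(1,2)] by (simp add: min.commute)
qed

text \<open>The target type \<open>(j, z)\<close> enters through \<open>wt j z\<close> and
  \<open>kern 0 x z\<close> only, so for fixed \<open>z\<close> the integrals for different
  \<open>j\<close> differ by the ratio of their weights. This forces
  \<open>\<nu> j z = wt j z * \<phi> z\<close>, and for this form the source types sum to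
  \<open>g2\<close>.\<close>

lemma left_eigenfunction_reduce:
  assumes \<nu>: "left_eigenfunction P b \<nu>" and b: "b \<noteq> 0"
  obtains \<phi> where "lin_growth \<phi>" "\<forall>x\<ge>0. T \<phi> x = b * \<phi> x" "\<exists>x\<ge>0. \<phi> x \<noteq> 0"
    "\<forall>j. \<forall>z\<ge>0. \<nu> j z = wt j z * \<phi> z"
proof -
  let ?W = "\<lambda>j z x. \<Sum>m. \<nu> m x * m1 P m x j z"
  have eq: "b * \<nu> j z = (LBINT x:{0..}. ?W j z x)" if "z \<ge> 0" for j z
    using \<nu> that unfolding left_eigenfunction_def by blast
  have int: "set_integrable lborel {0..} (?W j z)" if "z \<ge> 0" for j z
    using \<nu> that unfolding left_eigenfunction_def by blast
  have sm: "AE x in lborel. 0 \<le> x \<longrightarrow> summable (\<lambda>m. \<nu> m x * m1 P m x j z)" if "z \<ge> 0" for j z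
    using \<nu> that unfolding left_eigenfunction_def by blast
  \<comment> \<open>A reference index of positive weight: every other \<open>j\<close> is compared
    with \<open>k\<close>, so no division by a vanishing \<open>pmf P (j + 1)\<close>
    occurs.\<close>
  obtain i where "0 < pmf P (i + 2)" using pmf_pos_ex by blast
  then obtain k where k: "0 < pmf P (k + 1)" by (metis add.assoc nat_1_add_1)
  have wk: "0 < wt k z" if "z > 0" for z using that k by (simp add: wt_def)
  define S where "S x = (\<Sum>m. \<nu> m x * real m)" for x
  \<comment> \<open>Summability is read off at target \<open>(k, 1)\<close>, where the factor
    independent of \<open>m\<close> is nonzero.\<close>
  have ssum: "AE x in lborel. 0 < x \<longrightarrow> summable (\<lambda>m. \<nu> m x * real m)"
    using sm[OF zero_le_one, of k]
  proof eventually_elim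
    case (elim x)
    show ?case
    proof
      assume x: "0 < x"
      have c: "kern 0 x 1 * wt k 1 \<noteq> 0" using x wk[of 1] by (simp add: kern.simps)
      have "summable (\<lambda>m. (\<nu> m x * m1 P m x k 1) * (1 / (kern 0 x 1 * wt k 1)))"
        using elim x by (intro summable_mult2) simp
      then show "summable (\<lambda>m. \<nu> m x * real m)"
        using x c by (simp add: m1_eq mult.assoc)
    qed
  qed
  have W: "AE x in lborel. indicator {0..} x *\<^sub>R ?W j z x = (indicator {0<..} x * (S x * kern 0 x z)) * wt j z"
    if z: "z \<ge> 0" for j z
    using ssum AE_lborel_singleton[of 0]
  proof eventually_elim
    case (elim x)
    show ?case
    proof (cases "x > 0")
      case True
      have "?W j z x = (\<Sum>m. (\<nu> m x * real m) * (kern 0 x z * wt j z))"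
        using True z by (simp add: m1_eq mult_ac)
      also have "\<dots> = S x * (kern 0 x z * wt j z)"
        unfolding S_def using elim True by (intro suminf_mult2[symmetric]) simp
      finally show ?thesis using True by simp
    qed (use elim in auto)
  qed
  define J where "J z = b * \<nu> k z / wt k z" for z
  have int_eq: "(\<integral>x. indicator {0..} x *\<^sub>R ?W j z x \<partial>lborel) = J z * wt j z" if z: "z > 0" for j z
  proof -
    have m: "(\<lambda>x. indicator {0..} x *\<^sub>R ?W j z x) \<in> borel_measurable lborel" for j
      using int[of z j] z unfolding set_integrable_def by (intro borel_measurable_integrable) simp
    have "(\<integral>x. indicator {0..} x *\<^sub>R ?W j z x \<partial>lborel) =
        (\<integral>x. (indicator {0..} x *\<^sub>R ?W k z x) * (wt j z / wt k z) \<partial>lborel)"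
    proof (rule integral_cong_AE[OF m])
      show "(\<lambda>x. (indicator {0..} x *\<^sub>R ?W k z x) * (wt j z / wt k z)) \<in> borel_measurable lborel"
        by (intro borel_measurable_times m borel_measurable_const)
      show "AE x in lborel. indicator {0..} x *\<^sub>R ?W j z x = (indicator {0..} x *\<^sub>R ?W k z x) * (wt j z / wt k z)"
        using W[OF less_imp_le[OF z], of j] W[OF less_imp_le[OF z], of k]
      proof eventually_elim
        case (elim x)
        then show ?case using wk[OF z] by simp
      qed
    qed
    also have "\<dots> = (\<integral>x. indicator {0..} x *\<^sub>R ?W k z x \<partial>lborel) * (wt j z / wt k z)"
      by (rule integral_mult_left_zero)
    also have "(\<integral>x. indicator {0..} x *\<^sub>R ?W k z x \<partial>lborel) = b * \<nu> k z"
      using eq[of z k] z by (simp add: set_lebesgue_integral_def)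
    finally show ?thesis using wk[OF z] by (simp add: J_def)
  qed
  define \<phi> where "\<phi> z = (if z > 0 then J z / b else 0)" for z
  have \<nu>0: "\<nu> j 0 = 0" for j
  proof -
    have "(\<integral>x. indicator {0..} x *\<^sub>R ?W j 0 x \<partial>lborel) = 0"
      by (rule integral_eq_zero_AE) (use W[of 0 j] in \<open>auto elim!: eventually_mono simp: kern.simps indicator_def\<close>)
    then show ?thesis using eq[of 0 j] b by (simp add: set_lebesgue_integral_def)
  qed
  have form: "\<nu> j z = wt j z * \<phi> z" if z: "z \<ge> 0" for j z
  proof (cases "z = 0")
    case False
    then have "b * \<nu> j z = J z * wt j z"
      using eq[OF z, of j] int_eq[of z j] z by (simp add: set_lebesgue_integral_def)
    then show ?thesis using b False z by (simp add: \<phi>_def field_simps)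
  qed (simp add: \<nu>0 \<phi>_def)
  have W': "?W j z x = g2 P x * (min z x * \<phi> x * wt j z)" if "x \<ge> 0" "z \<ge> 0" for j z x
    using sums_unique[OF left_sums[OF that, of \<nu> "\<phi> x" j]] form[OF that(1)] by simp
  have int': "set_integrable lborel {0..} (\<lambda>x. g2 P x * (min z x * \<phi> x * wt j z))" if "z \<ge> 0" for j z
    using int[OF that, of j] unfolding set_integrable_def
    by (rule Bochner_Integration.integrable_cong[THEN iffD1, rotated 2])
      (use W'[OF _ that] in \<open>auto simp: indicator_def\<close>)
  have meas: "\<phi> \<in> borel_measurable borel"
  proof -
    have "(\<lambda>x. indicator {0..} x *\<^sub>R (g2 P x * (min 1 x * \<phi> x * wt k 1))) \<in> borel_measurable lborel"
      using int'[of 1 k] unfolding set_integrable_def by (intro borel_measurable_integrable) simp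
    then have [measurable]: "(\<lambda>x. indicator {0..} x *\<^sub>R (g2 P x * (min 1 x * \<phi> x * wt k 1))) \<in> borel_measurable borel"
      by simp
    have "\<phi> = (\<lambda>x. indicator {0..} x *\<^sub>R (g2 P x * (min 1 x * \<phi> x * wt k 1)) / (g2 P x * min 1 x * wt k 1))"
    proof
      fix x show "\<phi> x = indicator {0..} x *\<^sub>R (g2 P x * (min 1 x * \<phi> x * wt k 1)) / (g2 P x * min 1 x * wt k 1)"
        using g2_pos[of x] wk[of 1] by (auto simp: \<phi>_def min_def)
    qed
    also have "\<dots> \<in> borel_measurable borel" by measurable
    finally show ?thesis .
  qed
  note [measurable] = meas
  have "integrable U (\<lambda>x. min 1 x * \<phi> x * wt k 1)"
    by (rule integrable_upsilon[THEN iffD2, rotated, OF int'[OF zero_le_one]]) measurable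
  then have int1: "integrable U (\<lambda>x. min 1 x * \<phi> x)" using wk[of 1] by simp
  have T: "T \<phi> z = b * \<phi> z" if z: "z \<ge> 0" for z
  proof (cases "z = 0")
    case False
    have "b * \<nu> k z = (LBINT x:{0..}. g2 P x * (min z x * \<phi> x * wt k z))"
      unfolding eq[OF z] by (intro set_lebesgue_integral_cong) (use W'[OF _ z] in auto)
    also have "\<dots> = (\<integral>x. min z x * \<phi> x * wt k z \<partial>U)"
      by (rule integral_upsilon[symmetric]) measurable
    also have "\<dots> = T \<phi> z * wt k z" by (simp add: T_def)
    finally show ?thesis using form[OF z, of k] wk[of z] z False by simp
  qed (simp add: T_0 \<phi>_def)
  have lg: "lin_growth \<phi>" by (rule lin_growth_of_eigen[OF meas int1 b T])
  have nz: "\<exists>x\<ge>0. \<phi> x \<noteq> 0"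
  proof (rule ccontr)
    assume no: "\<not> ?thesis"
    then have "\<nu> j z = 0" if "z \<ge> 0" for j z using form[OF that, of j] that by auto
    then show False using \<nu> unfolding left_eigenfunction_def by blast
  qed
  show thesis
    by (rule that[OF lg _ nz]) (use T form in blast)+
qed

lemma left_eigenfunction_f0:
  assumes c: "c \<noteq> 0" and \<nu>: "\<And>j z. z \<ge> 0 \<Longrightarrow> \<nu> j z = c * (wt j z * f0 P z)"
  shows "left_eigenfunction P (beta0 P) \<nu>"
  unfolding left_eigenfunction_def
proof (intro conjI allI impI)
  obtain i where "0 < pmf P (i + 2)" using pmf_pos_ex by blast
  then have "\<nu> (Suc i) 1 \<noteq> 0" using \<nu>[of 1 "Suc i"] c f_pos[of 1] by (simp add: wt_def)
  then show "\<exists>j. \<exists>z\<ge>0. \<nu> j z \<noteq> 0" using zero_le_one by blast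
  fix j and z :: real assume z: "z \<ge> 0"
  have S: "(\<lambda>m. \<nu> m x * m1 P m x j z) sums (g2 P x * (min z x * f0 P x * (c * wt j z)))" if "x \<ge> 0" for x
    using left_sums[OF that z, of \<nu> "c * f0 P x" j] \<nu>[OF that] by (simp add: mult_ac)
  have i: "integrable U (\<lambda>x. min z x * f0 P x * (c * wt j z))"
    using integrable_min_mult[OF lin_growth_f] by simp
  have meas: "(\<lambda>x. min z x * f0 P x * (c * wt j z)) \<in> borel_measurable borel" by measurable
  show "AE x in lborel. 0 \<le> x \<longrightarrow> summable (\<lambda>m. \<nu> m x * m1 P m x j z)"
    using S by (auto simp: sums_iff)
  have "set_integrable lborel {0..} (\<lambda>x. g2 P x * (min z x * f0 P x * (c * wt j z)))"
    using i by (subst (asm) integrable_upsilon[OF meas])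
  then show "set_integrable lborel {0..} (\<lambda>x. \<Sum>m. \<nu> m x * m1 P m x j z)"
    unfolding set_integrable_def
    by (rule Bochner_Integration.integrable_cong[THEN iffD1, rotated 2])
      (use S in \<open>auto simp: indicator_def sums_iff\<close>)
  have "(LBINT x:{0..}. (\<Sum>m. \<nu> m x * m1 P m x j z))
      = (LBINT x:{0..}. g2 P x * (min z x * f0 P x * (c * wt j z)))"
    by (intro set_lebesgue_integral_cong) (use S in \<open>auto simp: sums_iff\<close>)
  also have "\<dots> = (\<integral>x. min z x * f0 P x * (c * wt j z) \<partial>U)"
    by (rule integral_upsilon[OF meas, symmetric])
  also have "\<dots> = T (f0 P) z * (c * wt j z)" by (simp add: T_def)
  also have "\<dots> = beta0 P * \<nu> j z" using eigen[OF z] \<nu>[OF z] by simp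
  finally show "beta0 P * \<nu> j z = (LBINT x:{0..}. (\<Sum>m. \<nu> m x * m1 P m x j z))" by simp
qed

section \<open>Asymptotics\<close>

text \<open>\<open>contr_range\<close> allows \<open>contr = 0\<close>, whereas the rate in the
  asymptotic statements has to be positive.\<close>

definition rate :: real where "rate = max contr (1 / 2)"

lemma rate_range: "0 < rate" "rate < 1" "contr ^ n \<le> rate ^ n"
  using contr_range by (auto simp: rate_def intro: power_mono)

lemma ml_expansion:
  "\<exists>Mhat>0. \<forall>x\<ge>0. \<forall>z>0. \<forall>k\<ge>1. \<forall>m. \<forall>l\<ge>2. \<exists>r. \<bar>r\<bar> \<le> rate ^ (l - 2) \<and>
      ml P l m x (k - 1) z =
        pmf P k * exp (- z) * z ^ (k - 1) / fact (k - 1) *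
        (real m * quot0 (f0 P) (\<lambda>t. t) x) * beta0 P ^ l * f0 P z *
        (1 + Mhat * r * (quot0 (\<lambda>t. t) (f0 P) x / ((beta0 P)\<^sup>2 * f0 P z)))"
proof -
  let ?b = "beta0 P" and ?f = "f0 P"
  \<comment> \<open>Once the leading factor is multiplied out, neither \<open>f0\<close> nor
    \<open>fquot\<close> is left in the error term. \<open>M\<close> therefore absorbs
    \<open>fquot x * f0 P z\<close> through the bounds \<open>slope\<close> and
    \<open>1 / L_norm\<close>; the summand 1 makes it positive.\<close>
  define M where "M = conv_const * (?b\<^sup>2 * slope * (1 / L_norm)) + 1"
  have "0 \<le> conv_const * (?b\<^sup>2 * slope * (1 / L_norm))"
    using conv_const_nonneg slope_pos L_norm_pos by simp
  then have M: "0 < M" by (simp add: M_def)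
  have main: "\<exists>r. \<bar>r\<bar> \<le> rate ^ n \<and>
      ml P (n + 2) m x j z = wt j z * (real m * fquot x) * ?b ^ (n + 2) * ?f z *
        (1 + M * r * ((1 / fquot x) / (?b\<^sup>2 * ?f z)))"
    if x: "x \<ge> 0" and z: "z > 0" for x z m n j
  proof -
    let ?K = "kern (Suc n) x z" and ?c = "?b ^ (n + 2) * fquot x * ?f z"
    \<comment> \<open>\<open>r\<close> is the exact remainder, rescaled, so that only its size has
      to be estimated.\<close>
    define r where "r = (?K - ?c) / (M * ?b ^ n)"
    have q: "0 < fquot x" and f: "0 < ?f z" and b: "0 < ?b" and fb: "?f z \<le> 1 / L_norm"
      using fquot_pos[OF x] f_pos[OF z] \<beta>_pos f_le[OF z] by auto
    have Mb: "0 < M * ?b ^ n" using M b by simp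
    have "\<bar>?K - ?c\<bar> \<le> conv_const * contr ^ n * ?c"
      using kern_convergence[OF x, of z n] z by simp
    also have "\<dots> = contr ^ n * (?b ^ n * (conv_const * (?b\<^sup>2 * fquot x * ?f z)))"
      by (simp add: power_add mult_ac power2_eq_square)
    also have "\<dots> \<le> rate ^ n * (?b ^ n * M)"
    proof (intro mult_mono)
      have "conv_const * (?b\<^sup>2 * fquot x * ?f z) \<le> conv_const * (?b\<^sup>2 * slope * (1 / L_norm))"
        using q f fb fquot_le[OF x] slope_pos conv_const_nonneg
        by (intro mult_left_mono mult_mono) auto
      then show "conv_const * (?b\<^sup>2 * fquot x * ?f z) \<le> M" by (simp add: M_def)
      show "contr ^ n \<le> rate ^ n" by (rule rate_range(3))
    qed (use rate_range(1) b q f conv_const_nonneg in auto)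
    finally have "\<bar>?K - ?c\<bar> \<le> rate ^ n * (M * ?b ^ n)" by (simp add: mult_ac)
    then have "\<bar>r\<bar> \<le> rate ^ n"
      unfolding r_def abs_divide abs_of_pos[OF Mb] using Mb by (simp add: pos_divide_le_eq)
    moreover have "ml P (n + 2) m x j z = wt j z * (real m * fquot x) * ?b ^ (n + 2) * ?f z *
        (1 + M * r * ((1 / fquot x) / (?b\<^sup>2 * ?f z)))"
    proof -
      have rM: "M * r * ?b ^ n = ?K - ?c" using M b by (simp add: r_def)
      have "fquot x * ?b ^ (n + 2) * ?f z * (1 + M * r * ((1 / fquot x) / (?b\<^sup>2 * ?f z))) = ?c + M * r * ?b ^ n"
        using q f b by (simp add: power_add power2_eq_square field_simps)
      then have "fquot x * ?b ^ (n + 2) * ?f z * (1 + M * r * ((1 / fquot x) / (?b\<^sup>2 * ?f z))) = ?K"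
        unfolding rM by simp
      moreover have "ml P (n + 2) m x j z = wt j z * real m * ?K"
        using ml_eq[OF x, of z "Suc n" m j] z by (simp add: mult_ac)
      ultimately show ?thesis by (metis (no_types, lifting) mult.assoc)
    qed
    ultimately show ?thesis by blast
  qed
  show ?thesis
  proof (rule exI[of _ M], rule conjI[OF M], intro allI impI)
    fix x z :: real and k m l :: nat
    assume *: "0 \<le> x" "0 < z" "1 \<le> k" "2 \<le> l"
    then have lk: "l - 2 + 2 = l" "k - 1 + 1 = k" by auto
    show "\<exists>r. \<bar>r\<bar> \<le> rate ^ (l - 2) \<and>
      ml P l m x (k - 1) z =
        pmf P k * exp (- z) * z ^ (k - 1) / fact (k - 1) *
        (real m * quot0 (f0 P) (\<lambda>t. t) x) * beta0 P ^ l * f0 P z *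
        (1 + M * r * (quot0 (\<lambda>t. t) (f0 P) x / ((beta0 P)\<^sup>2 * f0 P z)))"
      using main[OF *(1,2), of "l - 2" m "k - 1"] by (simp only: lk quot0_f0[OF *(1)] wt_def)
  qed
qed

lemma ml_hl:
  assumes "l \<ge> 1" "x \<ge> 0" "k \<ge> 1" "z \<ge> 0"
  shows "ml P l m x (k - 1) z = real m * quot0 (\<lambda>t. hl P l t z) (\<lambda>t. t) x *
      (pmf P k * exp (- z) * z ^ (k - 1) / fact (k - 1))"
proof -
  obtain n where l: "l = Suc n" using assms(1) by (cases l) auto
  have "k - 1 + 1 = k" using assms by simp
  then show ?thesis
    using ml_eq[OF assms(2,4), of n m "k - 1"] unfolding l quot0_hl(1)[OF assms(2,4)]
    by (simp only: wt_def)
qed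

text \<open>The quotient \<open>f0 P x / x\<close> never exceeds its limit at 0, so an error bound
  that is constant in \<open>x\<close> is also a bound by \<open>V\<close>.\<close>

lemma V_ge_1: assumes "x \<ge> 0" shows "1 \<le> V P \<theta> x"
proof -
  have "1 * 1 \<le> slope / fquot x * exp (decay / 2 * x)"
    using fquot_le[OF assms] fquot_pos[OF assms] slope_pos decay_pos assms by (intro mult_mono) auto
  then show ?thesis by (simp add: V_eq[OF assms])
qed

text \<open>The kernel error at \<open>y\<close> is at most a multiple of \<open>f0 P y\<close>,
  uniformly in \<open>x\<close>, so it suffices that
  \<open>(f0 P y)\<^sup>2 * V P \<theta> y\<close> is integrable.\<close>

lemma geometric_ergodicity:
  "\<exists>M. \<forall>g. set_borel_measurable borel {0..} g \<and> (\<forall>x\<ge>0. \<bar>g x\<bar> \<le> V P \<theta> x) \<longrightarrow>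
      (\<forall>x\<ge>0. \<forall>l\<ge>2.
         \<bar>(LBINT y:{0..}. quot0 (\<lambda>t. hl P l t y) (f0 P) x * g2 P y * f0 P y * g y / beta0 P ^ l)
          - (LBINT y:{0..}. g2 P y * (f0 P y)\<^sup>2 * g y)\<bar>
         \<le> M * rate ^ l * V P \<theta> x)"
proof -
  let ?b = "beta0 P" and ?f = "f0 P"
  \<comment> \<open>This is \<open>(f0 P y)\<^sup>2 * V P \<theta> y\<close>: one factor
    \<open>f0 P y\<close> divided by \<open>fquot y\<close> leaves \<open>y\<close>.\<close>
  define w where "w y = slope * (y * exp (decay / 2 * y)) * ?f y" for y
  have [measurable]: "w \<in> borel_measurable borel" unfolding w_def[abs_def] by measurable
  have w_int: "integrable U w"
  proof (rule Bochner_Integration.integrable_bound)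
    show "integrable U (\<lambda>y. slope * (1 / L_norm) * (y * exp (decay / 2 * y)))"
      using integrable_exp_times by simp
    show "AE y in U. norm (w y) \<le> norm (slope * (1 / L_norm) * (y * exp (decay / 2 * y)))"
      using AE_pos
    proof eventually_elim
      case (elim y)
      have "slope * (y * exp (decay / 2 * y)) * ?f y \<le> slope * (y * exp (decay / 2 * y)) * (1 / L_norm)"
        using slope_pos elim f_le[OF elim] by (intro mult_left_mono) auto
      then show ?case using slope_pos elim f_pos[OF elim] L_norm_pos by (simp add: w_def mult_ac)
    qed
  qed measurable
  have w_V: "?f y * ?f y * V P \<theta> y = w y" if "y \<ge> 0" for y
  proof -
    have "?f y * ?f y / fquot y = y * ?f y"
      using fquot_mult[OF that] fquot_pos[OF that] by (metis less_irrefl mult.assoc mult.commute nonzero_eq_divide_eq)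
    moreover have "?f y * ?f y * V P \<theta> y = (?f y * ?f y / fquot y) * (slope * exp (decay / 2 * y))"
      by (simp add: V_eq[OF that])
    ultimately show ?thesis by (simp only: w_def mult_ac)
  qed
  let ?J = "\<integral>y. w y \<partial>U"
  \<comment> \<open>The division by \<open>rate\<^sup>2\<close> compensates for the convergence
    exponent \<open>l - 2\<close>.\<close>
  define M where "M = conv_const * ?J / rate\<^sup>2"
  have J: "0 \<le> ?J"
  proof (rule integral_nonneg_AE)
    show "AE y in U. 0 \<le> w y"
      using AE_pos by eventually_elim (use slope_pos f_nonneg in \<open>simp add: w_def\<close>)
  qed
  have M: "0 \<le> M" using conv_const_nonneg J by (simp add: M_def)
  show ?thesis
  proof (rule exI[of _ M], intro allI impI, elim conjE)
    fix g :: "real \<Rightarrow> real" and x :: real and l :: nat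
    assume g: "set_borel_measurable borel {0..} g" "\<forall>x\<ge>0. \<bar>g x\<bar> \<le> V P \<theta> x" and x: "0 \<le> x" and l: "2 \<le> l"
    obtain n where n: "l = Suc (Suc n)" by (rule that[of "l - 2"]) (use l in simp)
    \<comment> \<open>\<open>g\<close> is measurable on the half-line only; cutting it off gives a
      Borel function with the same integrals.\<close>
    define h where "h y = indicator {0..} y * g y" for y
    have [measurable]: "h \<in> borel_measurable borel"
      using g(1) by (simp add: set_borel_measurable_def h_def[abs_def])
    define A where "A y = kern (Suc n) x y / fquot x / ?b ^ l" for y
    have [measurable]: "A \<in> borel_measurable borel"
      unfolding A_def[abs_def] using lin_growth_measurable[OF lin_growth_kern[OF x]] by measurable
    have c: "0 < ?b ^ l * fquot x" using \<beta>_pos fquot_pos[OF x] by simp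
    have conv: "\<bar>A y - ?f y\<bar> \<le> conv_const * contr ^ n * ?f y" if "y \<ge> 0" for y
    proof -
      have "A y - ?f y = (kern (Suc n) x y - ?b ^ (n + 2) * fquot x * ?f y) / (?b ^ l * fquot x)"
        using \<beta>_pos fquot_pos[OF x] by (simp add: A_def n diff_divide_distrib mult.commute)
      then have "\<bar>A y - ?f y\<bar> = \<bar>kern (Suc n) x y - ?b ^ (n + 2) * fquot x * ?f y\<bar> / (?b ^ l * fquot x)"
        using c by (simp only: abs_divide abs_of_pos)
      also have "\<dots> \<le> conv_const * contr ^ n * (?b ^ (n + 2) * fquot x * ?f y) / (?b ^ l * fquot x)"
        using c by (intro divide_right_mono kern_convergence x that) simp
      also have "\<dots> = conv_const * contr ^ n * ?f y"
        using \<beta>_pos fquot_pos[OF x] by (simp add: n)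
      finally show ?thesis .
    qed
    have hw: "\<bar>?f y * ?f y * h y\<bar> \<le> w y" if "y > 0" for y
    proof -
      have "?f y * ?f y * \<bar>g y\<bar> \<le> ?f y * ?f y * V P \<theta> y"
        using g(2) that by (intro mult_left_mono) auto
      then show ?thesis using w_V[of y] that by (simp add: h_def abs_mult)
    qed
    have i2: "integrable U (\<lambda>y. ?f y * ?f y * h y)"
      by (rule Bochner_Integration.integrable_bound[OF w_int], measurable)
        (use AE_pos hw in \<open>auto elim!: eventually_mono intro: order_trans[OF _ abs_ge_self]\<close>)
    have dw: "\<bar>(A y - ?f y) * (?f y * h y)\<bar> \<le> conv_const * contr ^ n * w y" if "y > 0" for y
    proof -
      have "\<bar>(A y - ?f y) * (?f y * h y)\<bar> = \<bar>A y - ?f y\<bar> * \<bar>?f y * h y\<bar>" by (rule abs_mult)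
      also have "\<dots> \<le> (conv_const * contr ^ n * ?f y) * \<bar>?f y * h y\<bar>"
        using conv[of y] that by (intro mult_right_mono) auto
      also have "\<dots> = conv_const * contr ^ n * \<bar>?f y * ?f y * h y\<bar>"
        using f_pos[OF that] by (simp add: abs_mult mult.assoc)
      also have "\<dots> \<le> conv_const * contr ^ n * w y"
        using hw[OF that] conv_const_nonneg contr_range by (intro mult_left_mono) auto
      finally show ?thesis .
    qed
    have iw: "integrable U (\<lambda>y. conv_const * contr ^ n * w y)" using w_int by simp
    have id: "integrable U (\<lambda>y. (A y - ?f y) * (?f y * h y))"
      by (rule Bochner_Integration.integrable_bound[OF iw], measurable)
        (use AE_pos dw in \<open>auto elim!: eventually_mono intro: order_trans[OF _ abs_ge_self]\<close>)
    have "(LBINT y:{0..}. quot0 (\<lambda>t. hl P l t y) ?f x * g2 P y * ?f y * g y / ?b ^ l)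
        = (LBINT y:{0..}. g2 P y * (A y * ?f y * h y))"
      by (intro set_lebesgue_integral_cong)
        (auto simp: n quot0_hl(2)[OF x] A_def h_def mult_ac simp del: hl.simps)
    also have "\<dots> = (\<integral>y. A y * ?f y * h y \<partial>U)" by (rule integral_upsilon[symmetric]) measurable
    also have "\<dots> = (\<integral>y. (A y - ?f y) * (?f y * h y) + ?f y * ?f y * h y \<partial>U)"
      by (simp add: algebra_simps)
    also have "\<dots> = (\<integral>y. (A y - ?f y) * (?f y * h y) \<partial>U) + (\<integral>y. ?f y * ?f y * h y \<partial>U)"
      by (rule Bochner_Integration.integral_add[OF id i2])
    also have "(\<integral>y. ?f y * ?f y * h y \<partial>U) = (LBINT y:{0..}. g2 P y * (?f y * ?f y * h y))"
      by (rule integral_upsilon) measurable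
    also have "\<dots> = (LBINT y:{0..}. g2 P y * (?f y)\<^sup>2 * g y)"
      by (intro set_lebesgue_integral_cong) (auto simp: h_def power2_eq_square)
    finally have "\<bar>(LBINT y:{0..}. quot0 (\<lambda>t. hl P l t y) ?f x * g2 P y * ?f y * g y / ?b ^ l)
        - (LBINT y:{0..}. g2 P y * (?f y)\<^sup>2 * g y)\<bar> = \<bar>\<integral>y. (A y - ?f y) * (?f y * h y) \<partial>U\<bar>"
      by simp
    also have "\<dots> \<le> (\<integral>y. \<bar>(A y - ?f y) * (?f y * h y)\<bar> \<partial>U)" by (rule integral_abs_bound)
    also have "\<dots> \<le> (\<integral>y. conv_const * contr ^ n * w y \<partial>U)"
    proof (rule integral_mono_AE[OF _ iw])
      show "integrable U (\<lambda>y. \<bar>(A y - ?f y) * (?f y * h y)\<bar>)" using id by (rule integrable_abs)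
      show "AE y in U. \<bar>(A y - ?f y) * (?f y * h y)\<bar> \<le> conv_const * contr ^ n * w y"
        using AE_pos by eventually_elim (rule dw)
    qed
    also have "\<dots> = contr ^ n * (conv_const * ?J)" by simp
    also have "\<dots> \<le> rate ^ n * (conv_const * ?J)"
      using conv_const_nonneg J by (intro mult_right_mono rate_range(3)) simp
    also have "\<dots> = M * rate ^ l * 1"
      using rate_range(1) by (simp add: M_def n power2_eq_square)
    also have "\<dots> \<le> M * rate ^ l * V P \<theta> x"
      using V_ge_1[OF x] M rate_range(1) by (intro mult_left_mono) auto
    finally show "\<bar>(LBINT y:{0..}. quot0 (\<lambda>t. hl P l t y) ?f x * g2 P y * ?f y * g y / ?b ^ l)
        - (LBINT y:{0..}. g2 P y * (?f y)\<^sup>2 * g y)\<bar> \<le> M * rate ^ l * V P \<theta> x" .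
  qed
qed

lemma mu0_eq: "x \<ge> 0 \<Longrightarrow> mu0 P m x = real m * fquot x"
  by (simp add: mu0_def quot0_f0)

lemma nu0_eq: "nu0 P j z = wt j z * f0 P z"
  by (simp add: nu0_def wt_def)

section \<open>Consequences for the eigenvalues and eigenfunctions of
  \<open>M\<^sub>1\<close>\<close>

lemma right_eigenfunction_dichotomy:
  assumes \<mu>: "right_eigenfunction P b \<mu>" and b: "b \<noteq> 0"
  shows "b \<noteq> beta0 P \<Longrightarrow> \<bar>b\<bar> < beta0 P" "b = beta0 P \<Longrightarrow> proportional \<mu> (mu0 P)"
    "nonneg_fun \<mu> \<Longrightarrow> b = beta0 P"
proof -
  obtain \<phi> where \<phi>: "lin_growth \<phi>" "\<forall>x\<ge>0. T \<phi> x = b * \<phi> x" "\<exists>x\<ge>0. \<phi> x \<noteq> 0"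
    and form: "\<forall>m. \<forall>x\<ge>0. \<mu> m x = real m * (if x = 0 then (\<integral>z. \<phi> z \<partial>U) / b else \<phi> x / x)"
    by (rule right_eigenfunction_reduce[OF assms])
  note T = \<phi>(2)[rule_format]
  show "\<bar>b\<bar> < beta0 P" if "b \<noteq> beta0 P"
    by (rule eigenvalue_bound(1)[OF \<phi>(1) T b \<phi>(3) that])
  show "b = beta0 P" if nn: "nonneg_fun \<mu>"
  proof (rule eigenvalue_bound(2)[OF \<phi>(1) T b \<phi>(3)])
    fix x :: real assume x: "x \<ge> 0"
    show "0 \<le> \<phi> x"
    proof (cases "x = 0")
      case True
      then show ?thesis using T[of 0] b by (simp add: T_0)
    next
      case False
      then have "0 \<le> \<phi> x / x" using nn form x unfolding nonneg_fun_def
        by (metis mult_1 of_nat_1)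
      then show ?thesis using False x by (simp add: zero_le_divide_iff)
    qed
  qed
  show "proportional \<mu> (mu0 P)" if eq: "b = beta0 P"
  proof -
    have "\<exists>c. \<forall>x\<ge>0. \<phi> x = c * f0 P x"
      by (rule eigenfunction_simple[OF \<phi>(1)]) (use T eq in simp)
    then obtain c where c: "\<forall>x\<ge>0. \<phi> x = c * f0 P x" by (elim exE)
    \<comment> \<open>The value of \<open>\<mu>\<close> at \<open>x = 0\<close> is given by this
      integral and has to match \<open>slope\<close>.\<close>
    have "(\<integral>z. \<phi> z \<partial>U) = (\<integral>z. c * f0 P z \<partial>U)"
      by (intro integral_cong_AE) (use c AE_pos lin_growth_measurable[OF \<phi>(1)] in \<open>auto elim!: eventually_mono\<close>)
    then have int: "(\<integral>z. \<phi> z \<partial>U) / b = c * slope" using eq by (simp add: slope_def)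
    have "\<mu> m x = c * mu0 P m x" if x: "x \<ge> 0" for m x
      using form[rule_format, OF x, of m] c[rule_format, OF x] int
      by (simp add: mu0_eq[OF x] fquot_def)
    moreover have "c \<noteq> 0" using \<phi>(3) c by auto
    ultimately show ?thesis unfolding proportional_def by blast
  qed
qed

lemma left_eigenfunction_dichotomy:
  assumes \<nu>: "left_eigenfunction P b \<nu>" and b: "b \<noteq> 0"
  shows "b \<noteq> beta0 P \<Longrightarrow> \<bar>b\<bar> < beta0 P" "b = beta0 P \<Longrightarrow> proportional \<nu> (nu0 P)"
    "nonneg_fun \<nu> \<Longrightarrow> b = beta0 P"
proof -
  obtain \<phi> where \<phi>: "lin_growth \<phi>" "\<forall>x\<ge>0. T \<phi> x = b * \<phi> x" "\<exists>x\<ge>0. \<phi> x \<noteq> 0"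
    and form: "\<forall>j. \<forall>z\<ge>0. \<nu> j z = wt j z * \<phi> z"
    by (rule left_eigenfunction_reduce[OF assms])
  note T = \<phi>(2)[rule_format]
  show "\<bar>b\<bar> < beta0 P" if "b \<noteq> beta0 P"
    by (rule eigenvalue_bound(1)[OF \<phi>(1) T b \<phi>(3) that])
  show "b = beta0 P" if nn: "nonneg_fun \<nu>"
  proof (rule eigenvalue_bound(2)[OF \<phi>(1) T b \<phi>(3)])
    fix x :: real assume x: "x \<ge> 0"
    obtain i where i: "0 < pmf P (i + 2)" using pmf_pos_ex by blast
    show "0 \<le> \<phi> x"
    proof (cases "x = 0")
      case True
      then show ?thesis using T[of 0] b by (simp add: T_0)
    next
      case False
      then have "0 < wt (Suc i) x" using i x by (simp add: wt_def)
      moreover have "0 \<le> wt (Suc i) x * \<phi> x"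
        using nn form x unfolding nonneg_fun_def by metis
      ultimately show ?thesis by (simp add: zero_le_mult_iff)
    qed
  qed
  show "proportional \<nu> (nu0 P)" if eq: "b = beta0 P"
  proof -
    have "\<exists>c. \<forall>x\<ge>0. \<phi> x = c * f0 P x"
      by (rule eigenfunction_simple[OF \<phi>(1)]) (use T eq in simp)
    then obtain c where c: "\<forall>x\<ge>0. \<phi> x = c * f0 P x" by (elim exE)
    have "\<nu> j x = c * nu0 P j x" if x: "x \<ge> 0" for j x
      using form[rule_format, OF x, of j] c[rule_format, OF x] by (simp add: nu0_eq)
    moreover have "c \<noteq> 0" using \<phi>(3) c by auto
    ultimately show ?thesis unfolding proportional_def by blast
  qed
qed

lemma proportional_right_eigenfunction:
  assumes "proportional \<mu> (mu0 P)" shows "right_eigenfunction P (beta0 P) \<mu>"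
proof -
  obtain c where "c \<noteq> 0" "\<forall>m. \<forall>x\<ge>0. \<mu> m x = c * mu0 P m x"
    using assms unfolding proportional_def by (elim exE conjE)
  then show ?thesis by (intro right_eigenfunction_f0[of c]) (auto simp: mu0_eq)
qed

lemma proportional_left_eigenfunction:
  assumes "proportional \<nu> (nu0 P)" shows "left_eigenfunction P (beta0 P) \<nu>"
proof -
  obtain c where "c \<noteq> 0" "\<forall>m. \<forall>x\<ge>0. \<nu> m x = c * nu0 P m x"
    using assms unfolding proportional_def by (elim exE conjE)
  then show ?thesis by (intro left_eigenfunction_f0[of c]) (auto simp: nu0_eq)
qed

lemma nonneg_mu0: "nonneg_fun (mu0 P)"
  unfolding nonneg_fun_def using fquot_pos by (auto simp: mu0_eq less_imp_le)

lemma nonneg_nu0: "nonneg_fun (nu0 P)"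
  unfolding nonneg_fun_def using f_nonneg wt_nonneg by (auto simp: nu0_eq)

lemma is_eigenvalue_beta0: "is_eigenvalue P (beta0 P)"
proof -
  have "proportional (mu0 P) (mu0 P)" unfolding proportional_def by (intro exI[of _ 1]) simp
  then show ?thesis unfolding is_eigenvalue_def by (blast intro: proportional_right_eigenfunction)
qed

text \<open>The reduction to \<open>T\<close> divides by the eigenvalue, so 0 is treated apart;
  there the claim is positivity of \<open>beta0 P\<close>.\<close>

lemma eigenvalue_less:
  assumes "is_eigenvalue P b" "b \<noteq> beta0 P" shows "\<bar>b\<bar> < \<bar>beta0 P\<bar>"
proof (cases "b = 0")
  case False
  then show ?thesis
    using assms right_eigenfunction_dichotomy(1) left_eigenfunction_dichotomy(1) \<beta>_pos
    unfolding is_eigenvalue_def by fastforce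
qed (use \<beta>_pos in simp)

lemma right_eigenfunction_iff: "right_eigenfunction P (beta0 P) \<mu> \<longleftrightarrow> proportional \<mu> (mu0 P)"
  using right_eigenfunction_dichotomy(2)[of "beta0 P" \<mu>] proportional_right_eigenfunction[of \<mu>] \<beta>_pos
  by auto

lemma left_eigenfunction_iff: "left_eigenfunction P (beta0 P) \<nu> \<longleftrightarrow> proportional \<nu> (nu0 P)"
  using left_eigenfunction_dichotomy(2)[of "beta0 P" \<nu>] proportional_left_eigenfunction[of \<nu>] \<beta>_pos
  by auto

end

text \<open>Uniqueness of nonnegative eigenfunctions is stated for nonzero eigenvalues: a
  nonnegative function concentrated on a single type is invisible to the integral and solves the
  equation with eigenvalue 0. The Landau symbol is rendered by a remainder \<open>r\<close> with
  \<open>\<bar>r\<bar> \<le> \<gamma> ^ (l - 2)\<close>, and one \<open>\<gamma>\<close> serves both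
  asymptotic statements.\<close>

theorem theorem5p17:
  fixes P :: "nat pmf" and \<theta> :: real
  assumes "pmf P 0 = 0"
    and "pmf P 1 < 1"
    and "\<theta> > 0"
    and "integrable (measure_pmf P) (\<lambda>n. exp (\<theta> * real n))"
  shows
    "((\<exists>x\<^sub>0. is_arg_max (\<lambda>x. x * measure (upsilon P) {x..}) (\<lambda>x. 0 \<le> x) x\<^sub>0 \<and>
              x\<^sub>0 * measure (upsilon P) {x\<^sub>0..} < beta0 P) \<and>
      beta0 P < measure_pmf.expectation P real - 1 \<and>
      is_eigenvalue P (beta0 P) \<and>
      (\<forall>\<beta>. is_eigenvalue P \<beta> \<and> \<beta> \<noteq> beta0 P \<longrightarrow> \<bar>\<beta>\<bar> < \<bar>beta0 P\<bar>) \<and>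
      (\<forall>\<mu>. right_eigenfunction P (beta0 P) \<mu> \<longleftrightarrow> proportional \<mu> (mu0 P)) \<and>
      (\<forall>\<nu>. left_eigenfunction P (beta0 P) \<nu> \<longleftrightarrow> proportional \<nu> (nu0 P)) \<and>
      nonneg_fun (mu0 P) \<and> nonneg_fun (nu0 P) \<and>
      (\<forall>\<beta> \<mu>. \<beta> \<noteq> 0 \<and> right_eigenfunction P \<beta> \<mu> \<and> nonneg_fun \<mu> \<longrightarrow> proportional \<mu> (mu0 P)) \<and>
      (\<forall>\<beta> \<nu>. \<beta> \<noteq> 0 \<and> left_eigenfunction P \<beta> \<nu> \<and> nonneg_fun \<nu> \<longrightarrow> proportional \<nu> (nu0 P)))
     \<and>
     (\<exists>\<gamma>. 0 < \<gamma> \<and> \<gamma> < 1 \<and>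
       (\<exists>Mhat>0. \<forall>x\<ge>0. \<forall>z>0. \<forall>k\<ge>1. \<forall>m. \<forall>l\<ge>2. \<exists>r. \<bar>r\<bar> \<le> \<gamma> ^ (l - 2) \<and>
          ml P l m x (k - 1) z =
            pmf P k * exp (- z) * z ^ (k - 1) / fact (k - 1) *
            (real m * quot0 (f0 P) (\<lambda>t. t) x) * beta0 P ^ l * f0 P z *
            (1 + Mhat * r * (quot0 (\<lambda>t. t) (f0 P) x / ((beta0 P)\<^sup>2 * f0 P z))))
       \<and>
       (\<forall>l\<ge>1. \<forall>m. \<forall>x\<ge>0. \<forall>k\<ge>1. \<forall>z\<ge>0.
          ml P l m x (k - 1) z =
            real m * quot0 (\<lambda>t. hl P l t z) (\<lambda>t. t) x *
            (pmf P k * exp (- z) * z ^ (k - 1) / fact (k - 1)))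
       \<and>
       (\<exists>M. \<forall>g. set_borel_measurable borel {0..} g \<and> (\<forall>x\<ge>0. \<bar>g x\<bar> \<le> V P \<theta> x) \<longrightarrow>
          (\<forall>x\<ge>0. \<forall>l\<ge>2.
             \<bar>(LBINT y:{0..}. quot0 (\<lambda>t. hl P l t y) (f0 P) x * g2 P y * f0 P y * g y / beta0 P ^ l)
              - (LBINT y:{0..}. g2 P y * (f0 P y)\<^sup>2 * g y)\<bar>
             \<le> M * \<gamma> ^ l * V P \<theta> x)))"
proof -
  interpret ewt P \<theta> using assms by unfold_locales
  show ?thesis
  proof (intro conjI)
    show "\<forall>\<beta>. is_eigenvalue P \<beta> \<and> \<beta> \<noteq> beta0 P \<longrightarrow> \<bar>\<beta>\<bar> < \<bar>beta0 P\<bar>"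
      using eigenvalue_less by blast
    show "\<forall>\<beta> \<mu>. \<beta> \<noteq> 0 \<and> right_eigenfunction P \<beta> \<mu> \<and> nonneg_fun \<mu> \<longrightarrow> proportional \<mu> (mu0 P)"
      using right_eigenfunction_dichotomy(2,3) by blast
    show "\<forall>\<beta> \<nu>. \<beta> \<noteq> 0 \<and> left_eigenfunction P \<beta> \<nu> \<and> nonneg_fun \<nu> \<longrightarrow> proportional \<nu> (nu0 P)"
      using left_eigenfunction_dichotomy(2,3) by blast
    show "\<exists>\<gamma>. 0 < \<gamma> \<and> \<gamma> < 1 \<and>
       (\<exists>Mhat>0. \<forall>x\<ge>0. \<forall>z>0. \<forall>k\<ge>1. \<forall>m. \<forall>l\<ge>2. \<exists>r. \<bar>r\<bar> \<le> \<gamma> ^ (l - 2) \<and>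
          ml P l m x (k - 1) z =
            pmf P k * exp (- z) * z ^ (k - 1) / fact (k - 1) *
            (real m * quot0 (f0 P) (\<lambda>t. t) x) * beta0 P ^ l * f0 P z *
            (1 + Mhat * r * (quot0 (\<lambda>t. t) (f0 P) x / ((beta0 P)\<^sup>2 * f0 P z))))
       \<and>
       (\<forall>l\<ge>1. \<forall>m. \<forall>x\<ge>0. \<forall>k\<ge>1. \<forall>z\<ge>0.
          ml P l m x (k - 1) z =
            real m * quot0 (\<lambda>t. hl P l t z) (\<lambda>t. t) x *
            (pmf P k * exp (- z) * z ^ (k - 1) / fact (k - 1)))
       \<and>
       (\<exists>M. \<forall>g. set_borel_measurable borel {0..} g \<and> (\<forall>x\<ge>0. \<bar>g x\<bar> \<le> V P \<theta> x) \<longrightarrow>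
          (\<forall>x\<ge>0. \<forall>l\<ge>2.
             \<bar>(LBINT y:{0..}. quot0 (\<lambda>t. hl P l t y) (f0 P) x * g2 P y * f0 P y * g y / beta0 P ^ l)
              - (LBINT y:{0..}. g2 P y * (f0 P y)\<^sup>2 * g y)\<bar>
             \<le> M * \<gamma> ^ l * V P \<theta> x))"
      by (intro exI[of _ rate] conjI rate_range(1,2) ml_expansion geometric_ergodicity)
        (intro allI impI ml_hl)
  qed (simp_all only: tail_argmax beta0_less is_eigenvalue_beta0 right_eigenfunction_iff
      left_eigenfunction_iff nonneg_mu0 nonneg_nu0 simp_thms)
qed

end
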